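(* Let $d\ge 3$ and $N\ge 2$ be integers, and define $$\mathcal C(d,N)=\inf_{0\ne u\in H^{1}(\mathbb R^{dN})}\frac{\int_{\mathbb R^{dN}}|\nabla u|^2\,dx}{\sum_{1\le i<j\le N}\int_{\mathbb R^{dN}}\frac{|u|^2}{r_{ij}^2}\,dx}.$$ Then $$\mathcal C(d,N)\ge (d-2)^2\max\left\{\frac1N,\ \frac{1}{1+\sqrt{1+\frac{3(d-2)^2}{2(d-1)^2}(N-1)(N-2)}}\right\}.$$
   Context: Points of $\mathbb R^{dN}$ are written $x=(x_1,\dots,x_N)$ with $x_i\in\mathbb R^d$, and $r_{ij}=|x_i-x_j|$ is the Euclidean distance in $\mathbb R^d$. $\nabla$ is the full gradient on $\mathbb R^{dN}$. $H^1(\mathbb R^{dN})$ is the usual Sobolev space of (complex-valued) functions. *)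

theory Defs
  imports "HOL-Analysis.Analysis"
begin

primrec Ck :: "nat \<Rightarrow> ('a::euclidean_space \<Rightarrow> real) \<Rightarrow> bool" where
  "Ck 0 f \<longleftrightarrow> continuous_on UNIV f"
| "Ck (Suc k) f \<longleftrightarrow> (\<forall>x. f differentiable (at x)) \<and>
     (\<forall>b\<in>Basis. Ck k (\<lambda>x. frechet_derivative f (at x) b))"

text \<open>Real-valued test functions suffice for weak derivatives of complex-valued functions,
  because the defining identity is complex linear in the test function.\<close>

definition test_functions :: "('a::euclidean_space \<Rightarrow> real) set" where
  "test_functions = {\<phi>. (\<forall>k. Ck k \<phi>) \<and> compact (closure {x. \<phi> x \<noteq> 0})}"

text \<open>Elements of \<open>L2\<close> and \<open>H1\<close> are Borel representatives; the equivalence classes modulo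
  Lebesgue null sets are not formed, so a nonzero element is one that is not almost
  everywhere zero.\<close>

definition L2 :: "('a::euclidean_space \<Rightarrow> complex) set" where
  "L2 = {u \<in> borel_measurable lborel. integrable lborel (\<lambda>x. (cmod (u x))\<^sup>2)}"

text \<open>Only used for \<open>u\<close> and \<open>g\<close> in \<open>L2\<close>, where both integrals converge absolutely.\<close>

definition has_weak_partial ::
    "('a::euclidean_space \<Rightarrow> complex) \<Rightarrow> 'a \<Rightarrow> ('a \<Rightarrow> complex) \<Rightarrow> bool" where
  "has_weak_partial u b g \<longleftrightarrow>
     (\<forall>\<phi>\<in>test_functions.
        (LINT x|lborel. frechet_derivative \<phi> (at x) b *\<^sub>R u x) = - (LINT x|lborel. \<phi> x *\<^sub>R g x))"

definition H1 :: "('a::euclidean_space \<Rightarrow> complex) set" where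
  "H1 = {u \<in> L2. \<forall>b\<in>Basis. \<exists>g\<in>L2. has_weak_partial u b g}"

text \<open>The weak partial derivative is determined up to null sets; \<open>SOME\<close> picks a representative.\<close>

definition weak_partial ::
    "('a::euclidean_space \<Rightarrow> complex) \<Rightarrow> 'a \<Rightarrow> 'a \<Rightarrow> complex" where
  "weak_partial u b = (SOME g. g \<in> L2 \<and> has_weak_partial u b g)"

definition weak_grad_sq :: "('a::euclidean_space \<Rightarrow> complex) \<Rightarrow> 'a \<Rightarrow> real" where
  "weak_grad_sq u x = (\<Sum>b\<in>Basis. (cmod (weak_partial u b x))\<^sup>2)"

text \<open>A configuration of \<open>CARD('n)\<close> particles in dimension \<open>CARD('d)\<close> is a point
  \<open>x :: real ^ 'd ^ 'n\<close>, whose \<open>i\<close>-th particle is \<open>x $ i\<close>; the order on \<open>'n\<close> only serves to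
  count each pair once. The integrals and the quotient are taken in the extended nonnegative
  reals, so that no integrability is presupposed. The integrand is zero on the null set where
  \<open>x $ i = x $ j\<close>, by the convention for division by zero.\<close>

definition hardy_denominator :: "(real ^ 'd ^ 'n::{finite,linorder} \<Rightarrow> complex) \<Rightarrow> ennreal" where
  "hardy_denominator u =
     (\<Sum>(i, j)\<in>{(i, j). i < j}.
        \<integral>\<^sup>+ x. ennreal ((cmod (u x))\<^sup>2 / (dist (x $ i) (x $ j))\<^sup>2) \<partial>lborel)"

definition hardy_const :: "'d::finite itself \<Rightarrow> 'n::{finite,linorder} itself \<Rightarrow> ennreal" where
  "hardy_const _ _ =
     (INF u\<in>{u \<in> H1 :: (real ^ 'd ^ 'n::{finite,linorder} \<Rightarrow> complex) set. \<not> (AE x in lborel. u x = 0)}.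
        (\<integral>\<^sup>+ x. ennreal (weak_grad_sq u x) \<partial>lborel) / hardy_denominator u)"

end

theory Submission
  imports Defs "HOL-Real_Asymp.Real_Asymp"
begin

text \<open>
  Write \<open>T\<close> for the Dirichlet integral of \<open>u\<close>. Everything rests on completing a square in a single
  direction \<open>b\<close>: if \<open>v\<close> is a bounded weight with a bounded derivative \<open>v'\<close> along \<open>b\<close> and \<open>g\<close> is the
  weak derivative of \<open>u\<close> along \<open>b\<close>, then integrating \<open>|g + v u|\<^sup>2 \<ge> 0\<close> and moving the derivative in
  the cross term from \<open>|u|\<^sup>2\<close> to \<open>v\<close> gives
  \<open>\<integral> (v' - v\<^sup>2) |u|\<^sup>2 \<le> \<integral> |g|\<^sup>2\<close> (\<open>directional_hardy\<close>). Singular weights are replaced by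
  regularised ones, in which each squared distance \<open>r\<^sub>i\<^sub>j\<^sup>2\<close> becomes \<open>\<rho>\<^sub>i\<^sub>j = r\<^sub>i\<^sub>j\<^sup>2 + \<epsilon>\<close>; these are
  smooth on the whole space, so no cut-off near the singular set is needed.
  The limit \<open>\<epsilon> \<rightarrow> 0\<close> is taken by Fatou's lemma at the very end (\<open>hardy_denominator_le\<close>).

  For the bound with \<open>1 / N\<close>, the weights \<open>(d - 2) (x\<^sub>i - x\<^sub>j)\<^sub>k / \<rho>\<^sub>i\<^sub>j\<close> in the directions
  \<open>\<partial>\<^sub>i\<^sub>,\<^sub>k - \<partial>\<^sub>j\<^sub>,\<^sub>k\<close> give \<open>(d - 2)\<^sup>2 \<integral> |u|\<^sup>2 / \<rho>\<^sub>i\<^sub>j \<le> \<integral> |\<nabla>\<^sub>i u - \<nabla>\<^sub>j u|\<^sup>2\<close>, and the sum of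
  \<open>|a\<^sub>i - a\<^sub>j|\<^sup>2\<close> over \<open>i < j\<close> is at most \<open>N\<close> times the sum of \<open>|a\<^sub>i|\<^sup>2\<close> (\<open>pair_weight_hardy\<close>).

  For the bound with the square root, the weight is the vector field
  \<open>\<alpha> F\<close>, \<open>F\<^sub>i = \<Sum>\<^sub>j (x\<^sub>i - x\<^sub>j) / \<rho>\<^sub>i\<^sub>j\<close> (\<open>all_pairs_hardy\<close>). Its divergence produces the desired
  \<open>\<Sum> 1 / \<rho>\<^sub>i\<^sub>j\<close>, and so does the diagonal part of \<open>|F|\<^sup>2\<close>. The off-diagonal part is a sum over
  triangles; without regularisation the contribution of one triangle is the inverse square of its
  circumradius, and Schur's inequality bounds it by \<open>9 / (\<rho>\<^sub>i\<^sub>j + \<rho>\<^sub>j\<^sub>l + \<rho>\<^sub>l\<^sub>i)\<close>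
  (\<open>triangle_inner_sum_le\<close>). That term is controlled by \<open>T\<close> through the Hardy inequality for the three
  particles relative to their centre of mass, which live in dimension \<open>2 d\<close> and hence come with the
  constant \<open>(2 d - 2)\<^sup>2 / 4 = (d - 1)\<^sup>2\<close> (\<open>triple_hardy\<close>). Optimising over \<open>\<alpha>\<close> gives the constant
  (\<open>optimal_coupling\<close>).

  The integration by parts for an arbitrary \<open>u\<close> in \<open>H1\<close> is justified by mollification: the mollified
  function is continuously differentiable along \<open>b\<close> with derivative the mollified \<open>g\<close>, mollification
  does not increase the \<open>L2\<close> norm, and the mollified functions converge to \<open>u\<close> in \<open>L2\<close> because
  translations are continuous in \<open>L2\<close>. For continuously differentiable integrands on the whole space,
  the boundary-free divergence theorem in one direction is just translation invariance of Lebesgue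
  measure (\<open>integral_directional_derivative_eq_0\<close>).
\<close>

section \<open>Translation invariance and continuity of translations in L2\<close>

lemma nn_integral_lborel_shift:
  fixes f :: "'a::euclidean_space \<Rightarrow> ennreal"
  assumes [measurable]: "f \<in> borel_measurable borel"
  shows "(\<integral>\<^sup>+ x. f (x + c) \<partial>lborel) = (\<integral>\<^sup>+ x. f x \<partial>lborel)"
proof -
  have "(\<integral>\<^sup>+ x. f x \<partial>lborel) = (\<integral>\<^sup>+ x. f x \<partial>(distr lborel borel ((+) c)))"
    by (simp add: lborel_distr_plus)
  also have "\<dots> = (\<integral>\<^sup>+ x. f (c + x) \<partial>lborel)"
    by (subst nn_integral_distr) auto
  finally show ?thesis by (simp add: add.commute)
qed

lemma nn_integral_lborel_reflect:
  fixes f :: "'a::euclidean_space \<Rightarrow> ennreal"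
  assumes [measurable]: "f \<in> borel_measurable borel"
  shows "(\<integral>\<^sup>+ x. f (c - x) \<partial>lborel) = (\<integral>\<^sup>+ x. f x \<partial>lborel)"
proof -
  have "(\<integral>\<^sup>+ x. f x \<partial>lborel) = (\<integral>\<^sup>+ x. f x \<partial>(density (distr lborel borel (\<lambda>x. c + (-1) *\<^sub>R x)) (\<lambda>_. \<bar>-1::real\<bar>^DIM('a))))"
    by (subst (1) lborel_affine[of "-1" c]) auto
  also have "\<dots> = (\<integral>\<^sup>+ x. f (c - x) \<partial>lborel)"
    by (simp add: density_1 nn_integral_distr)
  finally show ?thesis by simp
qed

lemma integral_lborel_shift:
  fixes f :: "'a::euclidean_space \<Rightarrow> 'b::{banach, second_countable_topology}"
  assumes [measurable]: "f \<in> borel_measurable borel"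
  shows "(LINT x|lborel. f (x + c)) = (LINT x|lborel. f x)"
proof -
  have "(LINT x|lborel. f x) = (LINT x|(distr lborel borel ((+) c)). f x)"
    by (simp add: lborel_distr_plus)
  also have "\<dots> = (LINT x|lborel. f (c + x))"
    by (subst integral_distr) auto
  finally show ?thesis by (simp add: add.commute)
qed

lemma integrable_lborel_shift:
  fixes f :: "'a::euclidean_space \<Rightarrow> 'b::{banach, second_countable_topology}"
  assumes "integrable lborel f"
  shows "integrable lborel (\<lambda>x. f (x + c))"
proof -
  have [measurable]: "f \<in> borel_measurable borel" using assms by auto
  have "integrable (distr lborel borel ((+) c)) f"
    using assms by (simp add: lborel_distr_plus)
  then have "integrable lborel (\<lambda>x. f (c + x))"
    by (subst (asm) integrable_distr_eq) auto
  then show ?thesis by (simp add: add.commute)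
qed

text \<open>The integral of a directional derivative vanishes, since \<open>F (x + b) - F x\<close> has integral zero
  and is the average of \<open>F'\<close> over the segment from \<open>x\<close> to \<open>x + b\<close>.\<close>
lemma integral_directional_derivative_eq_0:
  fixes F F' :: "'a::euclidean_space \<Rightarrow> real"
  assumes deriv: "\<And>x. ((\<lambda>t. F (x + t *\<^sub>R b)) has_real_derivative F' x) (at 0)"
    and cont: "continuous_on UNIV F'"
    and F: "integrable lborel F" and F': "integrable lborel F'"
  shows "(LINT x|lborel. F' x) = 0"
proof -
  have [measurable]: "F \<in> borel_measurable borel" "F' \<in> borel_measurable borel"
    using F F' by auto
  have deriv': "((\<lambda>t. F (x + t *\<^sub>R b)) has_real_derivative F' (x + t *\<^sub>R b)) (at t)" for x t
  proof -
    have "((\<lambda>s. F ((x + t *\<^sub>R b) + s *\<^sub>R b)) has_real_derivative F' (x + t *\<^sub>R b)) (at (t - t))"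
      using deriv[of "x + t *\<^sub>R b"] by simp
    then have "((\<lambda>s. F ((x + t *\<^sub>R b) + (s - t) *\<^sub>R b)) has_real_derivative F' (x + t *\<^sub>R b)) (at t)"
      using DERIV_shift[of "\<lambda>s. F ((x + t *\<^sub>R b) + s *\<^sub>R b)" "F' (x + t *\<^sub>R b)" t "-t"] by simp
    then show ?thesis by (simp add: algebra_simps)
  qed
  have ftc: "(LINT t|lborel. F' (x + t *\<^sub>R b) * indicator {0..1} t) = F (x + b) - F x" for x
  proof -
    have "isCont (\<lambda>t. F' (x + t *\<^sub>R b)) t" for t
    proof (rule continuous_on_interior[of UNIV])
      show "continuous_on UNIV (\<lambda>t. F' (x + t *\<^sub>R b))"
        by (rule continuous_on_compose2[OF cont]) (auto intro!: continuous_intros)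
    qed simp
    then show ?thesis
      using integral_FTC_Icc_real[of 0 1 "\<lambda>t. F (x + t *\<^sub>R b)" "\<lambda>t. F' (x + t *\<^sub>R b)"] deriv'
      by simp
  qed
  have "integrable (lborel \<Otimes>\<^sub>M lborel) (\<lambda>(t, x). F' (x + t *\<^sub>R b) * indicator {0..1::real} t)"
  proof (rule lborel_pair.Fubini_integrable)
    have "(LINT x|lborel. \<bar>F' (x + t *\<^sub>R b)\<bar>) = (LINT x|lborel. \<bar>F' x\<bar>)" for t
      by (rule integral_lborel_shift) simp
    then have "(\<lambda>t. LINT x|lborel. norm (case (t, x) of (t, x) \<Rightarrow> F' (x + t *\<^sub>R b) * indicator {0..1::real} t))
      = (\<lambda>t. indicator {0..1} t * (LINT x|lborel. \<bar>F' x\<bar>))"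
      by (auto simp: abs_mult fun_eq_iff indicator_def)
    then show "integrable lborel (\<lambda>t. LINT x|lborel. norm (case (t, x) of (t, x) \<Rightarrow> F' (x + t *\<^sub>R b) * indicator {0..1::real} t))"
      by simp
    show "AE t in lborel. integrable lborel (\<lambda>x. case (t, x) of (t, x) \<Rightarrow> F' (x + t *\<^sub>R b) * indicator {0..1::real} t)"
      by (intro AE_I2) (auto intro!: integrable_mult_left integrable_lborel_shift F')
  qed measurable
  from lborel_pair.Fubini_integral[OF this]
  have "(LINT x|lborel. F (x + b) - F x) = (LINT t|lborel. LINT x|lborel. F' (x + t *\<^sub>R b) * indicator {0..1::real} t)"
    by (simp add: ftc)
  also have "\<dots> = (LINT t|lborel. indicator {0..1::real} t * (LINT x|lborel. F' x))"
    by (simp add: integral_lborel_shift mult.commute)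
  also have "\<dots> = (LINT x|lborel. F' x)" by simp
  also have "(LINT x|lborel. F (x + b) - F x) = 0"
    using F by (simp add: integrable_lborel_shift integral_lborel_shift)
  finally show ?thesis by simp
qed

text \<open>The functions whose translates converge to them in the mean form a closed subset of \<open>L1\<close>.\<close>
lemma L1_translation_approx:
  fixes f :: "'a::euclidean_space \<Rightarrow> 'b::{banach, second_countable_topology}"
  assumes f: "integrable lborel f"
    and approx: "\<And>e. e > 0 \<Longrightarrow> \<exists>g. integrable lborel g \<and> (LINT x|lborel. norm (f x - g x)) \<le> e \<and>
       (\<lambda>n. LINT x|lborel. norm (g (x + h n) - g x)) \<longlonglongrightarrow> 0"
  shows "(\<lambda>n. LINT x|lborel. norm (f (x + h n) - f x)) \<longlonglongrightarrow> 0"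
proof (rule LIMSEQ_I)
  fix e :: real assume "e > 0"
  then obtain g where g: "integrable lborel g" "(LINT x|lborel. norm (f x - g x)) \<le> e/3"
    "(\<lambda>n. LINT x|lborel. norm (g (x + h n) - g x)) \<longlonglongrightarrow> 0"
    using approx[of "e/3"] by auto
  from LIMSEQ_D[OF g(3), of "e/3"] \<open>e > 0\<close>
  obtain N where N: "\<And>n. n \<ge> N \<Longrightarrow> (LINT x|lborel. norm (g (x + h n) - g x)) < e/3" by auto
  have "(LINT x|lborel. norm (f (x + h n) - f x)) < e" if "n \<ge> N" for n
  proof -
    note ints = f g(1) integrable_lborel_shift[OF f, of "h n"] integrable_lborel_shift[OF g(1), of "h n"]
    have "(LINT x|lborel. norm (f (x + h n) - f x)) \<le>
      (LINT x|lborel. norm (f (x + h n) - g (x + h n)) + norm (g (x + h n) - g x) + norm (f x - g x))"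
    proof (intro integral_mono)
      fix x
      have "f (x + h n) - f x = (f (x + h n) - g (x + h n)) + (g (x + h n) - g x) - (f x - g x)" by simp
      then show "norm (f (x + h n) - f x) \<le> norm (f (x + h n) - g (x + h n)) + norm (g (x + h n) - g x) + norm (f x - g x)"
        by (metis norm_triangle_ineq norm_triangle_ineq4 order_trans add_right_mono)
    qed (use ints in auto)
    also have "\<dots> = (LINT x|lborel. norm (f (x + h n) - g (x + h n))) + (LINT x|lborel. norm (g (x + h n) - g x)) + (LINT x|lborel. norm (f x - g x))"
      using ints by simp
    also have "(LINT x|lborel. norm (f (x + h n) - g (x + h n))) = (LINT x|lborel. norm (f x - g x))"
      using f g(1) by (intro integral_lborel_shift) auto
    finally show ?thesis using g(2) N[OF that] by simp
  qed
  then show "\<exists>N. \<forall>n\<ge>N. norm ((LINT x|lborel. norm (f (x + h n) - f x)) - 0) < e" by auto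
qed

text \<open>For an open set, indicators of translates converge pointwise on the set itself; invariance of the
  measure turns this into convergence in the mean.\<close>
lemma L1_translation_open:
  fixes U :: "'a::euclidean_space set" and c :: "'b::{banach, second_countable_topology}"
  assumes U: "open U" "emeasure lborel U < \<infinity>" and h: "h \<longlonglongrightarrow> 0"
  shows "(\<lambda>n. LINT x|lborel. norm (indicator U (x + h n) *\<^sub>R c - indicator U x *\<^sub>R c)) \<longlonglongrightarrow> 0"
proof -
  have iU: "integrable lborel (indicator U :: 'a \<Rightarrow> real)" using U by simp
  have iUn: "integrable lborel (\<lambda>x. indicator U (x + h n) :: real)" for n
    by (rule integrable_lborel_shift[OF iU])
  have [measurable]: "U \<in> sets borel" using U by simp
  have iUUn: "integrable lborel (\<lambda>x. indicator U (x + h n) * indicator U x :: real)" for n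
    by (rule Bochner_Integration.integrable_bound[OF iU]) (auto simp: indicator_def)
  have lim: "(\<lambda>n. LINT x|lborel. indicator U (x + h n) * indicator U x :: real) \<longlonglongrightarrow> (LINT x|lborel. indicator U x)"
  proof (rule integral_dominated_convergence[where w="indicator U"])
    show "AE x in lborel. (\<lambda>n. indicator U (x + h n) * indicator U x :: real) \<longlonglongrightarrow> indicator U x"
    proof (rule AE_I2)
      fix x
      show "(\<lambda>n. indicator U (x + h n) * indicator U x :: real) \<longlonglongrightarrow> indicator U x"
      proof (cases "x \<in> U")
        case True
        have "(\<lambda>n. x + h n) \<longlonglongrightarrow> x" using tendsto_add[OF tendsto_const h, of x] by simp
        then have "eventually (\<lambda>n. x + h n \<in> U) sequentially"
          using U(1) True by (rule topological_tendstoD)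
        then have "eventually (\<lambda>n. indicator U (x + h n) * indicator U x = (indicator U x :: real)) sequentially"
          by eventually_elim (simp add: True)
        then show ?thesis by (rule tendsto_eventually)
      qed simp
    qed
  qed (use iU in \<open>auto simp: indicator_def\<close>)
  have eq: "(LINT x|lborel. norm (indicator U (x + h n) *\<^sub>R c - indicator U x *\<^sub>R c)) =
     norm c * (2 * (LINT x|lborel. indicator U x) - 2 * (LINT x|lborel. indicator U (x + h n) * indicator U x))" for n
  proof -
    have "(LINT x|lborel. norm (indicator U (x + h n) *\<^sub>R c - indicator U x *\<^sub>R c)) =
      (LINT x|lborel. norm c * (indicator U (x + h n) + indicator U x - 2 * (indicator U (x + h n) * indicator U x)))"
      by (intro Bochner_Integration.integral_cong) (auto simp: indicator_def)
    also have "\<dots> = norm c * ((LINT x|lborel. indicator U (x + h n)) + (LINT x|lborel. indicator U x) - 2 * (LINT x|lborel. indicator U (x + h n) * indicator U x))"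
      using iU iUn iUUn by simp
    also have "(LINT x|lborel. indicator U (x + h n) :: real) = (LINT x|lborel. indicator U x)"
      by (rule integral_lborel_shift) simp
    finally show ?thesis by simp
  qed
  have "(\<lambda>n. norm c * (2 * (LINT x|lborel. indicator U x) - 2 * (LINT x|lborel. indicator U (x + h n) * indicator U x :: real)))
      \<longlonglongrightarrow> norm c * (2 * (LINT x|lborel. indicator U x) - 2 * (LINT x|lborel. indicator U x))"
    by (intro tendsto_intros lim)
  then show ?thesis by (simp add: eq)
qed

lemma L1_translation_continuous:
  fixes f :: "'a::euclidean_space \<Rightarrow> 'b::{banach, second_countable_topology}"
  assumes "integrable lborel f" and h: "h \<longlonglongrightarrow> 0"
  shows "(\<lambda>n. LINT x|lborel. norm (f (x + h n) - f x)) \<longlonglongrightarrow> 0"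
  using assms(1)
proof (induction rule: integrable_induct)
  case (base A c)
  show ?case
  proof (rule L1_translation_approx)
    show "integrable lborel (\<lambda>x. indicator A x *\<^sub>R c)" using base by simp
    fix e :: real assume "e > 0"
    define d where "d = e / (norm c + 1)"
    have "d > 0" using \<open>e > 0\<close> by (simp add: d_def add_nonneg_pos)
    have A: "A \<in> sets borel" using base by simp
    obtain U where U: "open U" "A \<subseteq> U" "emeasure lborel (U - A) < d"
      using outer_regular_lborel[OF A \<open>d > 0\<close>] by blast
    have [measurable]: "U \<in> sets borel" "A \<in> sets borel" using U A by auto
    have "emeasure lborel U \<le> emeasure lborel A + emeasure lborel (U - A)"
      using emeasure_subadditive[of A lborel "U - A"] U(2) by (simp add: Un_absorb1)
    also have "\<dots> < \<infinity>"
    proof -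
      have "emeasure lborel (U - A) < \<infinity>"
        using order.strict_trans[OF U(3) ennreal_less_top] by simp
      then show ?thesis using base(2) by simp
    qed
    finally have fU: "emeasure lborel U < \<infinity>" .
    have "(LINT x|lborel. norm (indicator A x *\<^sub>R c - indicator U x *\<^sub>R c)) = (LINT x|lborel. norm c * indicator (U - A) x)"
      using U(2) by (intro Bochner_Integration.integral_cong) (auto simp: indicator_def)
    also have "\<dots> = norm c * measure lborel (U - A)" by simp
    also have "\<dots> \<le> norm c * d"
      using U(3) \<open>d > 0\<close> by (intro mult_left_mono) (simp_all add: measure_def enn2real_leI)
    also have "\<dots> = e * (norm c / (norm c + 1))" by (simp add: d_def)
    also have "\<dots> \<le> e" using \<open>e > 0\<close> by (intro mult_left_le) (auto simp: divide_le_eq_1 add_nonneg_pos)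
    finally show "\<exists>g. integrable lborel g \<and> (LINT x|lborel. norm (indicator A x *\<^sub>R c - g x)) \<le> e \<and>
       (\<lambda>n. LINT x|lborel. norm (g (x + h n) - g x)) \<longlonglongrightarrow> 0"
      using L1_translation_open[OF U(1) fU h, of c] fU
      by (intro exI[of _ "\<lambda>x. indicator U x *\<^sub>R c"]) simp
  qed
next
  case (add f g)
  have lim: "(\<lambda>n. (LINT x|lborel. norm (f (x + h n) - f x)) + (LINT x|lborel. norm (g (x + h n) - g x))) \<longlonglongrightarrow> 0"
    using tendsto_add[OF add.IH] by simp
  have bd: "(LINT x|lborel. norm (f (x + h n) + g (x + h n) - (f x + g x))) \<le>
     (LINT x|lborel. norm (f (x + h n) - f x)) + (LINT x|lborel. norm (g (x + h n) - g x))" for n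
  proof -
    note ints = add.hyps integrable_lborel_shift[OF add.hyps(1), of "h n"] integrable_lborel_shift[OF add.hyps(2), of "h n"]
    have "(LINT x|lborel. norm (f (x + h n) + g (x + h n) - (f x + g x))) \<le>
      (LINT x|lborel. norm (f (x + h n) - f x) + norm (g (x + h n) - g x))"
      using ints by (intro integral_mono) (auto simp: norm_diff_triangle_ineq)
    also have "\<dots> = (LINT x|lborel. norm (f (x + h n) - f x)) + (LINT x|lborel. norm (g (x + h n) - g x))"
      using ints by simp
    finally show ?thesis .
  qed
  show ?case
    by (rule tendsto_sandwich[OF _ _ tendsto_const lim]) (auto simp: bd)
next
  case (lim f s)
  show ?case
  proof (rule L1_translation_approx)
    show "integrable lborel f" by fact
    have "(\<lambda>i. LINT x|lborel. norm (f x - s i x)) \<longlonglongrightarrow> (LINT x|(lborel :: 'a measure). 0)"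
    proof (rule integral_dominated_convergence[where w="\<lambda>x. 3 * norm (f x)"])
      show "AE x in lborel. (\<lambda>i. norm (f x - s i x)) \<longlonglongrightarrow> 0"
      proof (rule AE_I2)
        fix x
        have "(\<lambda>i. norm (f x - s i x)) \<longlonglongrightarrow> norm (f x - f x)"
          by (intro tendsto_intros lim.hyps(2)) simp
        then show "(\<lambda>i. norm (f x - s i x)) \<longlonglongrightarrow> 0" by simp
      qed
      show "AE x in lborel. norm (norm (f x - s i x)) \<le> 3 * norm (f x)" for i
      proof (rule AE_I2)
        fix x
        show "norm (norm (f x - s i x)) \<le> 3 * norm (f x)"
          using lim.hyps(3)[of x i] norm_triangle_ineq4[of "f x" "s i x"] by simp
      qed
      show "(\<lambda>x. norm (f x - s i x)) \<in> borel_measurable lborel" for i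
        using borel_measurable_integrable[OF lim.hyps(1)[of i]] borel_measurable_integrable[OF lim.hyps(4)]
        by measurable
      show "integrable lborel (\<lambda>x. 3 * norm (f x))"
        by (intro integrable_mult_right integrable_norm lim.hyps(4))
    qed simp
    then have *: "(\<lambda>i. LINT x|lborel. norm (f x - s i x)) \<longlonglongrightarrow> 0" by simp
    fix e :: real assume "e > 0"
    from LIMSEQ_D[OF * this] obtain i where "(LINT x|lborel. norm (f x - s i x)) < e" by auto
    then show "\<exists>g. integrable lborel g \<and> (LINT x|lborel. norm (f x - g x)) \<le> e \<and>
       (\<lambda>n. LINT x|lborel. norm (g (x + h n) - g x)) \<longlonglongrightarrow> 0"
      using lim.hyps(1)[of i] lim.IH[of i] by (intro exI[of _ "s i"] conjI) simp_all
  qed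
qed

text \<open>The map \<open>a \<mapsto> |a| a\<close> has a Hoelder continuous inverse of exponent one half. It carries \<open>L2\<close> into
  \<open>L1\<close>, which reduces continuity of translations in \<open>L2\<close> to the case of \<open>L1\<close>.\<close>
lemma norm_diff_sq_le_signed_square:
  fixes a b :: "'a::real_inner"
  shows "(norm (a - b))\<^sup>2 \<le> 2 * norm (norm a *\<^sub>R a - norm b *\<^sub>R b)"
proof (cases "a = b")
  case False
  define s t p where "s = norm a" and "t = norm b" and "p = a \<bullet> b"
  have n2: "(norm (a - b))\<^sup>2 = s\<^sup>2 + t\<^sup>2 - 2 * p"
    by (simp add: s_def t_def p_def power2_norm_eq_inner inner_diff_left inner_diff_right inner_commute)
  have "norm (a - b) \<le> s + t" by (simp add: s_def t_def norm_triangle_ineq4)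
  have "norm (a - b) * (norm (a - b))\<^sup>2 \<le> (s + t) * (norm (a - b))\<^sup>2"
    by (intro mult_right_mono) (use \<open>norm (a - b) \<le> s + t\<close> in auto)
  also have "\<dots> \<le> (s + t) * ((norm (a - b))\<^sup>2 + (s - t)\<^sup>2)"
    by (intro mult_left_mono) (auto simp: s_def t_def)
  also have "\<dots> = 2 * ((norm a *\<^sub>R a - norm b *\<^sub>R b) \<bullet> (a - b))"
  proof -
    have "a \<bullet> a = s\<^sup>2" "b \<bullet> b = t\<^sup>2" "a \<bullet> b = p" "b \<bullet> a = p"
      by (simp_all add: s_def t_def p_def power2_norm_eq_inner inner_commute)
    then show ?thesis
      unfolding n2 s_def[symmetric] t_def[symmetric]
      by (simp add: inner_diff_left inner_diff_right) (simp add: power2_eq_square algebra_simps)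
  qed
  also have "\<dots> \<le> 2 * (norm (norm a *\<^sub>R a - norm b *\<^sub>R b) * norm (a - b))"
    by (intro mult_left_mono norm_cauchy_schwarz) auto
  finally have "norm (a - b) * (norm (a - b))\<^sup>2 \<le> norm (a - b) * (2 * norm (norm a *\<^sub>R a - norm b *\<^sub>R b))"
    by (simp add: algebra_simps)
  then show ?thesis using False by (simp add: mult_le_cancel_left)
qed simp

lemma L2_translation_continuous:
  fixes u :: "'a::euclidean_space \<Rightarrow> complex"
  assumes u: "u \<in> L2" and h: "h \<longlonglongrightarrow> 0"
  shows "(\<lambda>n. \<integral>\<^sup>+x. ennreal ((cmod (u (x + h n) - u x))\<^sup>2) \<partial>lborel) \<longlonglongrightarrow> 0"
proof -
  have [measurable]: "u \<in> borel_measurable borel" using u by (simp add: L2_def)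
  define f where "f x = norm (u x) *\<^sub>R u x" for x
  have f: "integrable lborel f"
  proof (rule Bochner_Integration.integrable_bound)
    show "integrable lborel (\<lambda>x. (cmod (u x))\<^sup>2)" using u by (simp add: L2_def)
  qed (auto simp: f_def[abs_def] power2_eq_square)
  have [measurable]: "f \<in> borel_measurable borel" using f by auto
  have "(\<lambda>n. ennreal (2 * (LINT x|lborel. norm (f (x + h n) - f x)))) \<longlonglongrightarrow> ennreal (2 * 0)"
    by (intro tendsto_intros tendsto_ennrealI L1_translation_continuous[OF f h])
  then have lim: "(\<lambda>n. ennreal (2 * (LINT x|lborel. norm (f (x + h n) - f x)))) \<longlonglongrightarrow> 0" by simp
  have bd: "(\<integral>\<^sup>+x. ennreal ((cmod (u (x + h n) - u x))\<^sup>2) \<partial>lborel) \<le> ennreal (2 * (LINT x|lborel. norm (f (x + h n) - f x)))" for n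
  proof -
    have "(\<integral>\<^sup>+x. ennreal ((cmod (u (x + h n) - u x))\<^sup>2) \<partial>lborel) \<le> (\<integral>\<^sup>+x. ennreal (2 * norm (f (x + h n) - f x)) \<partial>lborel)"
      unfolding f_def by (intro nn_integral_mono ennreal_leI norm_diff_sq_le_signed_square)
    also have "\<dots> = ennreal (LINT x|lborel. 2 * norm (f (x + h n) - f x))"
      using f integrable_lborel_shift[OF f, of "h n"] by (intro nn_integral_eq_integral) auto
    finally show ?thesis by simp
  qed
  show ?thesis
    by (rule tendsto_sandwich[OF _ _ tendsto_const lim]) (auto simp: bd)
qed

section \<open>Smooth bump functions\<close>

text \<open>The functions \<open>t\<^bsup>- m\<^esup> exp (- 1 / t)\<close>, extended by zero to \<open>t \<le> 0\<close>. Their linear span is closed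
  under differentiation.\<close>
definition flat_exp :: "nat \<Rightarrow> real \<Rightarrow> real" where
  "flat_exp m t = (if t > 0 then exp (- 1 / t) / t ^ m else 0)"

lemma flat_exp_tendsto_0: "(flat_exp m \<longlongrightarrow> 0) (at 0)"
proof -
  have "((\<lambda>t::real. exp (- 1 / t) / t ^ m) \<longlongrightarrow> 0) (at_right 0)"
    by real_asymp
  then have "(flat_exp m \<longlongrightarrow> 0) (at_right 0)"
    by (rule Lim_transform_eventually) (auto simp: eventually_at_right_less flat_exp_def eventually_at_filter)
  moreover have "(flat_exp m \<longlongrightarrow> 0) (at_left 0)"
    by (rule tendsto_eventually) (auto simp: flat_exp_def eventually_at_filter)
  ultimately show ?thesis by (simp add: filterlim_split_at)
qed

lemma flat_exp_has_derivative:
  "(flat_exp m has_real_derivative (flat_exp (m + 2) t - real m * flat_exp (m + 1) t)) (at t)"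
proof -
  consider "t > 0" | "t < 0" | "t = 0" by linarith
  then show ?thesis
  proof cases
    case 1
    have p: "((\<lambda>t. t ^ m) has_real_derivative real m * t ^ m / t) (at t)"
      using DERIV_pow[of m t] 1 by (cases m) auto
    have e: "((\<lambda>t. exp (- 1 / t)) has_real_derivative exp (- 1 / t) / t\<^sup>2) (at t)"
      using 1 by (auto intro!: derivative_eq_intros simp: power2_eq_square)
    have "((\<lambda>t. exp (- 1 / t) * inverse (t ^ m)) has_real_derivative
        (flat_exp (m + 2) t - real m * flat_exp (m + 1) t)) (at t)"
      by (rule DERIV_cong[OF DERIV_mult[OF e DERIV_inverse'[OF p]]])
         (use 1 in \<open>auto simp: flat_exp_def field_simps power2_eq_square\<close>)
    then show ?thesis
    proof (rule has_field_derivative_transform_within_open[of _ _ _ "{0<..}"])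
      show "exp (- 1 / s) * inverse (s ^ m) = flat_exp m s" if "s \<in> {0<..}" for s
        using that by (simp add: flat_exp_def field_simps)
    qed (use 1 in auto)
  next
    case 2
    have "((\<lambda>t. 0) has_real_derivative (flat_exp (m + 2) t - real m * flat_exp (m + 1) t)) (at t)"
      using 2 by (simp add: flat_exp_def)
    then show ?thesis
      by (rule has_field_derivative_transform_within_open[of _ _ _ "{..<0}"])
         (use 2 in \<open>auto simp: flat_exp_def\<close>)
  next
    case 3
    have "(\<lambda>h. (flat_exp m (0 + h) - flat_exp m 0) / h) = flat_exp (m + 1)"
      by (auto simp: flat_exp_def fun_eq_iff)
    then show ?thesis
      using flat_exp_tendsto_0[of "m + 1"] 3 by (simp add: DERIV_def flat_exp_def)
  qed
qed

lemma continuous_flat_exp: "continuous_on UNIV (flat_exp m)"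
  by (intro continuous_at_imp_continuous_on ballI DERIV_isCont[OF flat_exp_has_derivative])

text \<open>A family of functions that contains the radial bump around \<open>x\<close>, whose squared radius is \<open>r\<close>, and is
  closed under partial derivatives. All its members are therefore smooth, without computing
  higher derivatives.\<close>
inductive_set bump_class :: "real \<Rightarrow> 'a::euclidean_space \<Rightarrow> ('a \<Rightarrow> real) set" for r x where
  base: "(\<lambda>y. flat_exp m (r - (y - x) \<bullet> (y - x))) \<in> bump_class r x"
| mult: "f \<in> bump_class r x \<Longrightarrow> (\<lambda>y. ((y - x) \<bullet> b) * f y) \<in> bump_class r x"
| scale: "f \<in> bump_class r x \<Longrightarrow> (\<lambda>y. c * f y) \<in> bump_class r x"
| add: "f \<in> bump_class r x \<Longrightarrow> g \<in> bump_class r x \<Longrightarrow> (\<lambda>y. f y + g y) \<in> bump_class r x"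

lemma flat_exp_ball_has_derivative:
  "((\<lambda>y. flat_exp m (r - (y - x) \<bullet> (y - x))) has_derivative
     (\<lambda>b. (- 2 * ((y - x) \<bullet> b)) * (flat_exp (m + 2) (r - (y - x) \<bullet> (y - x)) - real m * flat_exp (m + 1) (r - (y - x) \<bullet> (y - x))))) (at y)"
proof -
  have "((\<lambda>y. r - (y - x) \<bullet> (y - x)) has_derivative (\<lambda>b. - 2 * ((y - x) \<bullet> b))) (at y)"
    by (auto intro!: derivative_eq_intros simp: inner_commute)
  from has_derivative_compose[OF this, of "flat_exp m"] flat_exp_has_derivative[of m "r - (y - x) \<bullet> (y - x)"]
  show ?thesis unfolding has_field_derivative_def by (fastforce simp: algebra_simps)
qed

lemma bump_class_derivative:
  assumes "f \<in> bump_class r x"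
  shows "\<exists>f'. (\<forall>y. (f has_derivative (\<lambda>b. f' b y)) (at y)) \<and> (\<forall>b. f' b \<in> bump_class r x)"
  using assms
proof induction
  case (base m)
  define f' where "f' = (\<lambda>b y. ((y - x) \<bullet> b) * ((- 2) * flat_exp (m + 2) (r - (y - x) \<bullet> (y - x)) + (2 * real m) * flat_exp (m + 1) (r - (y - x) \<bullet> (y - x))))"
  have "f' b \<in> bump_class r x" for b
    unfolding f'_def by (intro bump_class.intros)
  moreover have "((\<lambda>y. flat_exp m (r - (y - x) \<bullet> (y - x))) has_derivative (\<lambda>b. f' b y)) (at y)" for y
    using flat_exp_ball_has_derivative[of m r x y] by (simp add: f'_def algebra_simps)
  ultimately show ?case by blast
next
  case (mult f c)
  then obtain f' where f': "\<And>y. (f has_derivative (\<lambda>b. f' b y)) (at y)" "\<And>b. f' b \<in> bump_class r x" by blast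
  have "((\<lambda>y. ((y - x) \<bullet> c) * f y) has_derivative (\<lambda>b. ((y - x) \<bullet> c) * f' b y + (b \<bullet> c) * f y)) (at y)" for y
    by (auto intro!: derivative_eq_intros f'(1))
  moreover have "(\<lambda>y. ((y - x) \<bullet> c) * f' b y + (b \<bullet> c) * f y) \<in> bump_class r x" for b
    by (intro bump_class.intros f'(2) mult.hyps)
  ultimately show ?case by (intro exI[of _ "\<lambda>b y. ((y - x) \<bullet> c) * f' b y + (b \<bullet> c) * f y"]) auto
next
  case (scale f c)
  then obtain f' where f': "\<And>y. (f has_derivative (\<lambda>b. f' b y)) (at y)" "\<And>b. f' b \<in> bump_class r x" by blast
  have "((\<lambda>y. c * f y) has_derivative (\<lambda>b. c * f' b y)) (at y)" for y
    by (auto intro!: derivative_eq_intros f'(1))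
  then show ?case using bump_class.scale[OF f'(2)] by (intro exI[of _ "\<lambda>b y. c * f' b y"]) auto
next
  case (add f g)
  then obtain f' g' where f': "\<And>y. (f has_derivative (\<lambda>b. f' b y)) (at y)" "\<And>b. f' b \<in> bump_class r x"
    and g': "\<And>y. (g has_derivative (\<lambda>b. g' b y)) (at y)" "\<And>b. g' b \<in> bump_class r x" by metis
  have "((\<lambda>y. f y + g y) has_derivative (\<lambda>b. f' b y + g' b y)) (at y)" for y
    by (auto intro!: derivative_eq_intros f'(1) g'(1))
  then show ?case using bump_class.add[OF f'(2) g'(2)] by (intro exI[of _ "\<lambda>b y. f' b y + g' b y"]) auto
qed

lemma bump_class_Ck: "f \<in> bump_class r x \<Longrightarrow> Ck k f"
proof (induction k arbitrary: f)
  case 0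
  then obtain f' where "\<And>y. (f has_derivative (\<lambda>b. f' b y)) (at y)" using bump_class_derivative by blast
  then show ?case
    by (auto intro!: continuous_at_imp_continuous_on has_derivative_continuous)
next
  case (Suc k)
  then obtain f' where f': "\<And>y. (f has_derivative (\<lambda>b. f' b y)) (at y)" "\<And>b. f' b \<in> bump_class r x"
    using bump_class_derivative by blast
  have "frechet_derivative f (at y) = (\<lambda>b. f' b y)" for y
    using frechet_derivative_at[OF f'(1)] by metis
  then show ?case using f' Suc.IH by (auto simp: differentiable_def)
qed

lemma bump_test_function:
  assumes "r > 0"
  shows "(\<lambda>y. c * flat_exp m (r\<^sup>2 - (y - x) \<bullet> (y - x))) \<in> test_functions"
proof -
  have "{y. c * flat_exp m (r\<^sup>2 - (y - x) \<bullet> (y - x)) \<noteq> 0} \<subseteq> cball x r"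
  proof safe
    fix y assume "c * flat_exp m (r\<^sup>2 - (y - x) \<bullet> (y - x)) \<noteq> 0"
    then have "(norm (y - x))\<^sup>2 < r\<^sup>2"
      by (auto simp: flat_exp_def power2_norm_eq_inner split: if_splits)
    then show "y \<in> cball x r"
      using assms power2_less_imp_less[of "norm (y - x)" r] by (simp add: dist_norm norm_minus_commute)
  qed
  then have "closure {y. c * flat_exp m (r\<^sup>2 - (y - x) \<bullet> (y - x)) \<noteq> 0} \<subseteq> cball x r"
    by (intro closure_minimal) auto
  then have "compact (closure {y. c * flat_exp m (r\<^sup>2 - (y - x) \<bullet> (y - x)) \<noteq> 0})"
    by (meson bounded_cball bounded_subset closed_closure compact_eq_bounded_closed)
  then show ?thesis
    using bump_class_Ck[OF bump_class.scale[OF bump_class.base]] by (auto simp: test_functions_def)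
qed

text \<open>A smooth nonnegative bump supported in the closed ball of radius \<open>r\<close>, not yet normalised.\<close>
definition bump :: "real \<Rightarrow> 'a::euclidean_space \<Rightarrow> real" where
  "bump r y = flat_exp 0 (r\<^sup>2 - y \<bullet> y)"

lemma flat_exp_nonneg: "flat_exp m t \<ge> 0" by (simp add: flat_exp_def)

lemma continuous_flat_exp_ball: "continuous_on UNIV (\<lambda>y::'a::euclidean_space. flat_exp m (r - y \<bullet> y))"
  by (intro continuous_on_compose2[OF continuous_flat_exp] continuous_intros) auto

lemma bounded_compact_support:
  fixes f :: "'a::euclidean_space \<Rightarrow> real"
  assumes "continuous_on UNIV f" and "\<And>y. y \<notin> cball 0 r \<Longrightarrow> f y = 0"
  obtains C where "C > 0" "\<And>y. \<bar>f y\<bar> \<le> C * indicator (cball 0 r) y"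
proof -
  have "compact (f ` cball 0 r)"
    by (intro compact_continuous_image continuous_on_subset[OF assms(1)]) auto
  then obtain C where "C > 0" "\<forall>y\<in>cball 0 r. \<bar>f y\<bar> \<le> C"
    using bounded_pos[of "f ` cball 0 r"] compact_imp_bounded by (auto simp: Ball_def)
  then show ?thesis using that[of C] assms(2) by (auto simp: indicator_def)
qed

lemma flat_exp_ball_support:
  fixes y :: "'a::euclidean_space"
  assumes "r > 0" "y \<notin> cball 0 r" shows "flat_exp m (r\<^sup>2 - y \<bullet> y) = 0"
proof -
  have "r\<^sup>2 \<le> (norm y)\<^sup>2" using assms by (intro power_mono) auto
  then show ?thesis by (simp add: flat_exp_def power2_norm_eq_inner)
qed

lemma bump_integral_pos:
  assumes "r > 0"
  shows "integrable lborel (bump r :: 'a::euclidean_space \<Rightarrow> real)" "(LINT y|lborel. bump r (y::'a)) > 0"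
proof -
  have c: "continuous_on UNIV (bump r :: 'a \<Rightarrow> real)"
    unfolding bump_def[abs_def] by (rule continuous_flat_exp_ball)
  have supp: "bump r y = 0" if "y \<notin> cball 0 r" for y :: 'a
    using flat_exp_ball_support[OF assms that] by (simp add: bump_def)
  obtain C where C: "C > 0" "\<And>y::'a. \<bar>bump r y\<bar> \<le> C * indicator (cball 0 r) y"
    using bounded_compact_support[OF c supp] by blast
  have [measurable]: "(bump r :: 'a \<Rightarrow> real) \<in> borel_measurable borel"
    using borel_measurable_continuous_onI[OF c] .
  show int: "integrable lborel (bump r :: 'a \<Rightarrow> real)"
  proof (rule Bochner_Integration.integrable_bound)
    show "integrable lborel (\<lambda>y. C * indicator (cball (0::'a) r) y)"
      by (intro integrable_mult_right integrable_real_indicator emeasure_bounded_finite) auto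
  qed (use C in auto)
  have nn: "bump r y \<ge> 0" for y :: 'a by (simp add: bump_def flat_exp_nonneg)
  have "(LINT y|lborel. bump r (y::'a)) \<noteq> 0"
  proof
    assume "(LINT y|lborel. bump r (y::'a)) = 0"
    then have "AE y in lborel. bump r (y::'a) = 0"
      using integral_nonneg_eq_0_iff_AE[OF int] nn by auto
    then have "AE y in lborel. y \<notin> ball (0::'a) r"
    proof eventually_elim
      case (elim y)
      have "\<not> norm y < r" 
      proof
        assume "norm y < r"
        then have "(norm y)\<^sup>2 < r\<^sup>2" by (intro power_strict_mono) auto
        then show False using elim by (simp add: bump_def flat_exp_def power2_norm_eq_inner)
      qed
      then show ?case by simp
    qed
    then have "emeasure lborel (ball (0::'a) r) = 0"
      by (subst (asm) AE_iff_measurable[OF _ refl]) (auto simp: ball_def)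
    then have "negligible (ball (0::'a) r)" by (simp add: negligible_iff_null_sets null_sets_def)
    then show False using \<open>r > 0\<close> open_not_negligible[of "ball (0::'a) r"] by auto
  qed
  moreover have "(LINT y|lborel. bump r (y::'a)) \<ge> 0" using nn by (simp add: integral_nonneg)
  ultimately show "(LINT y|lborel. bump r (y::'a)) > 0" by simp
qed

section \<open>Convolution and mollification\<close>

lemma L2_integrable_cball:
  fixes u :: "'a::euclidean_space \<Rightarrow> complex"
  assumes u: "u \<in> L2"
  shows "integrable lborel (\<lambda>y. indicator (cball 0 R) y * cmod (u y))"
proof -
  have [measurable]: "u \<in> borel_measurable borel" using u by (simp add: L2_def)
  have "integrable lborel (indicator (cball (0::'a) R) :: _ \<Rightarrow> real)"
    by (intro integrable_real_indicator emeasure_bounded_finite) auto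
  moreover have "integrable lborel (\<lambda>x. (cmod (u x))\<^sup>2)" using u by (simp add: L2_def)
  ultimately have "integrable lborel (\<lambda>y. indicator (cball 0 R) y + (cmod (u y))\<^sup>2)"
    by (rule Bochner_Integration.integrable_add)
  then show ?thesis
  proof (rule Bochner_Integration.integrable_bound)
    show "AE y in lborel. norm (indicator (cball 0 R) y * cmod (u y)) \<le> norm (indicator (cball 0 R) y + (cmod (u y))\<^sup>2)"
    proof (rule AE_I2)
      fix y
      have "0 \<le> (cmod (u y) - 1)\<^sup>2" by simp
      then have "2 * cmod (u y) \<le> 1 + (cmod (u y))\<^sup>2"
        by (simp add: power2_diff)
      then have "cmod (u y) \<le> 1 + (cmod (u y))\<^sup>2"
        using norm_ge_zero[of "u y"] by linarith
      then show "norm (indicator (cball 0 R) y * cmod (u y)) \<le> norm (indicator (cball 0 R) y + (cmod (u y))\<^sup>2)"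
        by (auto simp: indicator_def abs_if)
    qed
    show "(\<lambda>y. indicator (cball 0 R) y * cmod (u y)) \<in> borel_measurable lborel"
      by (intro borel_measurable_times borel_measurable_indicator) auto
  qed
qed

text \<open>Dominated convergence against a function in \<open>L2\<close>, for kernels with a common bound and a common
  compact support.\<close>
lemma L2_integral_tendsto:
  fixes u :: "'a::euclidean_space \<Rightarrow> complex"
  assumes u: "u \<in> L2"
    and [measurable]: "\<And>n. \<psi>' n \<in> borel_measurable borel" "\<psi> \<in> borel_measurable borel"
    and bd: "\<And>n y. \<bar>\<psi>' n y\<bar> \<le> C * indicator (cball 0 R) y"
    and lim: "\<And>y. (\<lambda>n. \<psi>' n y) \<longlonglongrightarrow> \<psi> y"
  shows "(\<lambda>n. LINT y|lborel. \<psi>' n y *\<^sub>R u y) \<longlonglongrightarrow> (LINT y|lborel. \<psi> y *\<^sub>R u y)"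
proof (rule integral_dominated_convergence[where w="\<lambda>y. C * (indicator (cball 0 R) y * cmod (u y))"])
  have [measurable]: "u \<in> borel_measurable borel" using u by (simp add: L2_def)
  show "(\<lambda>y. \<psi> y *\<^sub>R u y) \<in> borel_measurable lborel" by measurable
  show "(\<lambda>y. \<psi>' n y *\<^sub>R u y) \<in> borel_measurable lborel" for n by measurable
  show "integrable lborel (\<lambda>y. C * (indicator (cball 0 R) y * cmod (u y)))"
    by (intro integrable_mult_right L2_integrable_cball u)
  show "AE y in lborel. (\<lambda>n. \<psi>' n y *\<^sub>R u y) \<longlonglongrightarrow> \<psi> y *\<^sub>R u y"
    by (intro AE_I2 tendsto_intros lim)
  show "AE y in lborel. norm (\<psi>' n y *\<^sub>R u y) \<le> C * (indicator (cball 0 R) y * cmod (u y))" for n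
    using mult_right_mono[OF bd norm_ge_zero] by (auto simp: mult.assoc)
qed

lemma L2_integrable_scaleR:
  fixes u :: "'a::euclidean_space \<Rightarrow> complex"
  assumes u: "u \<in> L2" and [measurable]: "\<psi> \<in> borel_measurable borel"
    and bd: "\<And>y. \<bar>\<psi> y\<bar> \<le> C * indicator (cball 0 R) y"
  shows "integrable lborel (\<lambda>y. \<psi> y *\<^sub>R u y)"
proof (rule Bochner_Integration.integrable_bound)
  have [measurable]: "u \<in> borel_measurable borel" using u by (simp add: L2_def)
  show "integrable lborel (\<lambda>y. C * (indicator (cball 0 R) y * cmod (u y)))"
    by (intro integrable_mult_right L2_integrable_cball u)
  show "(\<lambda>y. \<psi> y *\<^sub>R u y) \<in> borel_measurable lborel" by measurable
  show "AE y in lborel. norm (\<psi> y *\<^sub>R u y) \<le> norm (C * (indicator (cball 0 R) y * cmod (u y)))"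
  proof (rule AE_I2)
    fix y
    have "norm (\<psi> y *\<^sub>R u y) \<le> C * (indicator (cball 0 R) y * cmod (u y))"
      using mult_right_mono[OF bd norm_ge_zero, of y "u y"] by (simp add: mult.assoc)
    then show "norm (\<psi> y *\<^sub>R u y) \<le> norm (C * (indicator (cball 0 R) y * cmod (u y)))" by simp
  qed
qed

text \<open>Convolution of a real kernel with a complex function. It is only used for a bounded kernel of
  compact support and a function in \<open>L2\<close>, where the integral converges absolutely.\<close>
definition conv :: "('a::euclidean_space \<Rightarrow> real) \<Rightarrow> ('a \<Rightarrow> complex) \<Rightarrow> 'a \<Rightarrow> complex" where
  "conv \<psi> u x = (LINT y|lborel. \<psi> (x - y) *\<^sub>R u y)"

lemma continuous_conv:
  fixes u :: "'a::euclidean_space \<Rightarrow> complex"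
  assumes u: "u \<in> L2" and c: "continuous_on UNIV \<psi>" and supp: "\<And>y. y \<notin> cball 0 r \<Longrightarrow> \<psi> y = 0"
  shows "continuous_on UNIV (conv \<psi> u)"
  unfolding continuous_on_sequentially
proof safe
  fix X :: "nat \<Rightarrow> 'a" and x assume X: "X \<longlonglongrightarrow> x"
  obtain C where C: "C > 0" "\<And>y. \<bar>\<psi> y\<bar> \<le> C * indicator (cball 0 r) y"
    using bounded_compact_support[OF c supp] by blast
  have [measurable]: "\<psi> \<in> borel_measurable borel" using borel_measurable_continuous_onI[OF c] .
  obtain M where M: "\<And>n. norm (X n) \<le> M"
    using convergent_imp_Bseq[of X] X by (auto simp: convergent_def Bseq_def)
  have "(\<lambda>n. conv \<psi> u (X n)) \<longlonglongrightarrow> conv \<psi> u x"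
    unfolding conv_def
  proof (rule L2_integral_tendsto[OF u, where C=C and R="M + r"])
    show "(\<lambda>n. \<psi> (X n - y)) \<longlonglongrightarrow> \<psi> (x - y)" for y
      by (rule continuous_on_tendsto_compose[OF c]) (auto intro!: tendsto_intros X)
    fix n y
    have "norm y \<le> M + r" if "X n - y \<in> cball 0 r"
      using norm_triangle_ineq4[of "X n" "X n - y"] M[of n] that by simp
    then show "\<bar>\<psi> (X n - y)\<bar> \<le> C * indicator (cball 0 (M + r)) y"
      using C(2)[of "X n - y"] C(1) supp[of "X n - y"]
      by (cases "X n - y \<in> cball 0 r") simp_all
  qed measurable
  then show "(conv \<psi> u \<circ> X) \<longlonglongrightarrow> conv \<psi> u x" by (simp add: o_def)
qed

lemma has_vector_derivative_slopeI:
  fixes f :: "real \<Rightarrow> 'b::real_normed_vector"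
  assumes "((\<lambda>h. (f h - f 0) /\<^sub>R h) \<longlongrightarrow> D) (at 0)"
  shows "(f has_vector_derivative D) (at 0)"
proof -
  have "((\<lambda>h. norm ((f h - f 0) /\<^sub>R h - D)) \<longlongrightarrow> norm (D - D)) (at 0)"
    by (intro tendsto_intros assms)
  then have "((\<lambda>h. norm (f (0 + h) - f 0 - h *\<^sub>R D) / norm h) \<longlongrightarrow> 0) (at 0)"
    unfolding diff_self norm_zero
  proof (rule tendsto_cong[THEN iffD1, rotated])
    show "\<forall>\<^sub>F h in at 0. norm ((f h - f 0) /\<^sub>R h - D) = norm (f (0 + h) - f 0 - h *\<^sub>R D) / norm h"
      unfolding eventually_at_filter
    proof (intro always_eventually allI impI)
      fix h :: real assume "h \<noteq> 0"
      then have "(f h - f 0) /\<^sub>R h - D = (f h - f 0 - h *\<^sub>R D) /\<^sub>R h"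
        by (simp add: scaleR_diff_right)
      then show "norm ((f h - f 0) /\<^sub>R h - D) = norm (f (0 + h) - f 0 - h *\<^sub>R D) / norm h"
        by (simp add: divide_inverse mult.commute)
    qed
  qed
  then show ?thesis
    by (simp add: has_vector_derivative_def has_derivative_at bounded_linear_scaleR_left)
qed

lemma conv_has_vector_derivative:
  fixes u :: "'a::euclidean_space \<Rightarrow> complex"
  assumes u: "u \<in> L2"
    and c: "continuous_on UNIV \<psi>" and supp: "\<And>y. y \<notin> cball 0 r \<Longrightarrow> \<psi> y = 0"
    and c': "continuous_on UNIV \<psi>'" and supp': "\<And>y. y \<notin> cball 0 r \<Longrightarrow> \<psi>' y = 0"
    and deriv: "\<And>w t. ((\<lambda>t. \<psi> (w + t *\<^sub>R b)) has_real_derivative \<psi>' (w + t *\<^sub>R b)) (at t)"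
  shows "((\<lambda>t. conv \<psi> u (x + t *\<^sub>R b)) has_vector_derivative conv \<psi>' u x) (at 0)"
proof (rule has_vector_derivative_slopeI, unfold tendsto_at_iff_sequentially, safe)
  fix H :: "nat \<Rightarrow> real" assume H0: "\<forall>i. H i \<in> UNIV - {0}" and H: "H \<longlonglongrightarrow> 0"
  obtain C where C: "C > 0" "\<And>y. \<bar>\<psi> y\<bar> \<le> C * indicator (cball 0 r) y"
    using bounded_compact_support[OF c supp] by blast
  obtain C' where C': "C' > 0" "\<And>y. \<bar>\<psi>' y\<bar> \<le> C' * indicator (cball 0 r) y"
    using bounded_compact_support[OF c' supp'] by blast
  have [measurable]: "\<psi> \<in> borel_measurable borel" "\<psi>' \<in> borel_measurable borel"
    using borel_measurable_continuous_onI[OF c] borel_measurable_continuous_onI[OF c'] by auto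
  obtain M where M: "\<And>n. \<bar>H n\<bar> \<le> M"
    using convergent_imp_Bseq[of H] H by (auto simp: convergent_def Bseq_def)
  have [simp]: "H n \<noteq> 0" for n using H0 by auto
  define R where "R = norm x + M * norm b + r"
  have "M \<ge> 0" using M[of 0] by linarith
  have int: "integrable lborel (\<lambda>y. \<psi> (x + h *\<^sub>R b - y) *\<^sub>R u y)" if "\<bar>h\<bar> \<le> M" for h
  proof (rule L2_integrable_scaleR[OF u, of _ C R])
    fix y
    have "norm y \<le> R" if *: "x + h *\<^sub>R b - y \<in> cball 0 r"
    proof -
      have "norm y \<le> norm (x + h *\<^sub>R b) + norm (x + h *\<^sub>R b - y)"
        using norm_triangle_ineq4[of "x + h *\<^sub>R b" "x + h *\<^sub>R b - y"] by simp
      also have "\<dots> \<le> norm x + \<bar>h\<bar> * norm b + r"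
        using norm_triangle_ineq[of x "h *\<^sub>R b"] * by simp
      also have "\<dots> \<le> R" unfolding R_def using mult_right_mono[OF \<open>\<bar>h\<bar> \<le> M\<close> norm_ge_zero[of b]] by simp
      finally show ?thesis .
    qed
    then show "\<bar>\<psi> (x + h *\<^sub>R b - y)\<bar> \<le> C * indicator (cball 0 R) y"
      using C(2)[of "x + h *\<^sub>R b - y"] C(1) supp[of "x + h *\<^sub>R b - y"]
      by (cases "x + h *\<^sub>R b - y \<in> cball 0 r") simp_all
  qed measurable
  have eq: "(conv \<psi> u (x + H n *\<^sub>R b) - conv \<psi> u (x + 0 *\<^sub>R b)) /\<^sub>R H n
      = (LINT y|lborel. ((\<psi> (x - y + H n *\<^sub>R b) - \<psi> (x - y)) / H n) *\<^sub>R u y)" for n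
  proof -
    have "conv \<psi> u (x + H n *\<^sub>R b) - conv \<psi> u x
        = (LINT y|lborel. \<psi> (x + H n *\<^sub>R b - y) *\<^sub>R u y - \<psi> (x - y) *\<^sub>R u y)"
      unfolding conv_def using int[OF M[of n]] int[of 0] \<open>M \<ge> 0\<close>
      by (subst Bochner_Integration.integral_diff) auto
    then have "(conv \<psi> u (x + H n *\<^sub>R b) - conv \<psi> u (x + 0 *\<^sub>R b)) /\<^sub>R H n
      = (LINT y|lborel. (\<psi> (x + H n *\<^sub>R b - y) *\<^sub>R u y - \<psi> (x - y) *\<^sub>R u y) /\<^sub>R H n)" by simp
    also have "\<dots> = (LINT y|lborel. ((\<psi> (x - y + H n *\<^sub>R b) - \<psi> (x - y)) / H n) *\<^sub>R u y)"
    proof (intro Bochner_Integration.integral_cong refl)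
      fix y
      have "x + H n *\<^sub>R b - y = x - y + H n *\<^sub>R b" by simp
      then show "(\<psi> (x + H n *\<^sub>R b - y) *\<^sub>R u y - \<psi> (x - y) *\<^sub>R u y) /\<^sub>R H n
          = ((\<psi> (x - y + H n *\<^sub>R b) - \<psi> (x - y)) / H n) *\<^sub>R u y"
        by (simp only: scaleR_diff_left[symmetric] scaleR_scaleR divide_inverse mult.commute)
    qed
    finally show ?thesis .
  qed
  have "(\<lambda>n. LINT y|lborel. ((\<psi> (x - y + H n *\<^sub>R b) - \<psi> (x - y)) / H n) *\<^sub>R u y) \<longlonglongrightarrow> conv \<psi>' u x"
    unfolding conv_def
  proof (rule L2_integral_tendsto[OF u, where C=C' and R=R])
    fix y
    have "((\<lambda>h. (\<psi> (x - y + h *\<^sub>R b) - \<psi> (x - y)) / h) \<longlongrightarrow> \<psi>' (x - y)) (at 0)"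
      using deriv[of "x - y" 0] by (simp add: DERIV_def)
    then show "(\<lambda>n. (\<psi> (x - y + H n *\<^sub>R b) - \<psi> (x - y)) / H n) \<longlonglongrightarrow> \<psi>' (x - y)"
      using H unfolding tendsto_at_iff_sequentially by (auto simp: o_def)
    fix n
    show "\<bar>(\<psi> (x - y + H n *\<^sub>R b) - \<psi> (x - y)) / H n\<bar> \<le> C' * indicator (cball 0 R) y"
    proof (cases "norm y \<le> R")
      case True
      have "norm (\<psi> (x - y + H n *\<^sub>R b) - \<psi> (x - y + 0 *\<^sub>R b)) \<le> C' * norm (H n - 0)"
      proof (rule field_differentiable_bound[of UNIV])
        show "((\<lambda>h. \<psi> (x - y + h *\<^sub>R b)) has_real_derivative \<psi>' (x - y + t *\<^sub>R b)) (at t within UNIV)" for t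
          using deriv by simp
        show "norm (\<psi>' (x - y + t *\<^sub>R b)) \<le> C'" for t
          using C'(2)[of "x - y + t *\<^sub>R b"] C'(1) supp'[of "x - y + t *\<^sub>R b"]
          by (cases "x - y + t *\<^sub>R b \<in> cball 0 r") simp_all
      qed auto
      then show ?thesis using True by (simp add: pos_divide_le_eq)
    next
      case False
      have far: "x - y + h *\<^sub>R b \<notin> cball 0 r" if "\<bar>h\<bar> \<le> M" for h
      proof
        assume "x - y + h *\<^sub>R b \<in> cball 0 r"
        then have "norm (x - y + h *\<^sub>R b) \<le> r" by simp
        have "y = x + h *\<^sub>R b - (x - y + h *\<^sub>R b)" by simp
        then have "norm y \<le> norm (x + h *\<^sub>R b) + norm (x - y + h *\<^sub>R b)" by (metis norm_triangle_ineq4)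
        also have "\<dots> \<le> norm x + \<bar>h\<bar> * norm b + r"
          using norm_triangle_ineq[of x "h *\<^sub>R b"] \<open>norm (x - y + h *\<^sub>R b) \<le> r\<close> by simp
        also have "\<dots> \<le> R" unfolding R_def using mult_right_mono[OF that norm_ge_zero[of b]] by simp
        finally show False using False by simp
      qed
      have "\<psi> (x - y + H n *\<^sub>R b) = 0" "\<psi> (x - y) = 0"
        using supp[OF far[OF M]] supp[OF far[of 0]] \<open>M \<ge> 0\<close> by auto
      then show ?thesis using C' by simp
    qed
  qed measurable
  then show "((\<lambda>h. (conv \<psi> u (x + h *\<^sub>R b) - conv \<psi> u (x + 0 *\<^sub>R b)) /\<^sub>R h) \<circ> H) \<longlonglongrightarrow> conv \<psi>' u x"
    unfolding o_def eq .
qed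

text \<open>The normalised bump, a probability density supported in the closed ball of radius \<open>r\<close>.\<close>
definition mollifier :: "real \<Rightarrow> 'a::euclidean_space \<Rightarrow> real" where
  "mollifier r y = bump r y / (LINT z|lborel. bump r (z::'a))"

lemma continuous_mollifier: "continuous_on UNIV (mollifier r :: 'a::euclidean_space \<Rightarrow> real)"
  unfolding mollifier_def[abs_def] bump_def divide_inverse
  by (intro continuous_on_mult continuous_flat_exp_ball continuous_on_const)

lemma borel_measurable_mollifier [measurable]: "(mollifier r :: 'a::euclidean_space \<Rightarrow> real) \<in> borel_measurable borel"
  by (rule borel_measurable_continuous_onI[OF continuous_mollifier])

lemma mollifier_support: "r > 0 \<Longrightarrow> y \<notin> cball 0 r \<Longrightarrow> mollifier r (y::'a::euclidean_space) = 0"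
  unfolding mollifier_def by (simp add: bump_def flat_exp_ball_support)

lemma mollifier_nonneg: "r > 0 \<Longrightarrow> mollifier r (y::'a::euclidean_space) \<ge> 0"
  using bump_integral_pos(2)[of r, where 'a='a] by (simp add: mollifier_def bump_def flat_exp_nonneg)

lemma mollifier_integral:
  assumes "r > 0"
  shows "integrable lborel (mollifier r :: 'a::euclidean_space \<Rightarrow> real)" "(LINT y|lborel. mollifier r (y::'a)) = 1"
  using bump_integral_pos[OF assms, where 'a='a] by (simp_all add: mollifier_def[abs_def])

lemma nn_integral_mollifier:
  fixes x :: "'a::euclidean_space"
  assumes "r > 0"
  shows "(\<integral>\<^sup>+y. ennreal (mollifier r (y::'a)) \<partial>lborel) = 1"
    "(\<integral>\<^sup>+y. ennreal (mollifier r (x - y)) \<partial>lborel) = (1::ennreal)" 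
    "(\<integral>\<^sup>+y. ennreal (mollifier r (y - x)) \<partial>lborel) = (1::ennreal)" 
proof -
  show 1: "(\<integral>\<^sup>+y. ennreal (mollifier r (y::'a)) \<partial>lborel) = 1"
  proof -
    have "(\<integral>\<^sup>+y. ennreal (mollifier r (y::'a)) \<partial>lborel) = ennreal (LINT y|lborel. mollifier r (y::'a))"
      by (intro nn_integral_eq_integral mollifier_integral AE_I2 mollifier_nonneg assms)
    then show ?thesis using mollifier_integral(2)[OF assms, where 'a='a] by simp
  qed
  show "(\<integral>\<^sup>+y. ennreal (mollifier r (x - y)) \<partial>lborel) = 1"
    by (subst nn_integral_lborel_reflect[of "\<lambda>y. ennreal (mollifier r y)"]) (simp_all add: 1)
  show "(\<integral>\<^sup>+y. ennreal (mollifier r (y - x)) \<partial>lborel) = 1"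
    using nn_integral_lborel_shift[of "\<lambda>y. ennreal (mollifier r y)" "-x"] by (simp add: 1)
qed

section \<open>Mollified functions in L2\<close>

text \<open>The derivative of the mollifier along \<open>b\<close>.\<close>
definition mollifier_deriv :: "real \<Rightarrow> 'a::euclidean_space \<Rightarrow> 'a \<Rightarrow> real" where
  "mollifier_deriv r b y =
     - 2 * (y \<bullet> b) * flat_exp 2 (r\<^sup>2 - y \<bullet> y) / (LINT z|lborel. bump r (z::'a))"

lemma mollifier_test_function:
  assumes "r > 0" shows "(\<lambda>y. mollifier r (x - y)) \<in> test_functions"
proof -
  have "(\<lambda>y. mollifier r (x - y)) =
      (\<lambda>y. (1 / (LINT z|lborel. bump r (z::'a))) * flat_exp 0 (r\<^sup>2 - (y - x) \<bullet> (y - x)))"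
    by (simp add: mollifier_def bump_def fun_eq_iff inner_diff_left inner_diff_right inner_commute algebra_simps)
  then show ?thesis using bump_test_function[OF assms] by metis
qed

lemma mollifier_frechet_derivative:
  "frechet_derivative (\<lambda>y. mollifier r (x - y)) (at y) b = - mollifier_deriv r b (x - y)"
proof -
  let ?I = "LINT z|lborel. bump r (z::'a)"
  have eq: "(\<lambda>y. mollifier r (x - y)) = (\<lambda>y. (1 / ?I) * flat_exp 0 (r\<^sup>2 - (y - x) \<bullet> (y - x)))"
    by (simp add: mollifier_def bump_def fun_eq_iff inner_diff_left inner_diff_right inner_commute algebra_simps)
  have "((\<lambda>y. (1 / ?I) * flat_exp 0 (r\<^sup>2 - (y - x) \<bullet> (y - x))) has_derivative
      (\<lambda>b. (1 / ?I) * ((- 2 * ((y - x) \<bullet> b)) * flat_exp 2 (r\<^sup>2 - (y - x) \<bullet> (y - x))))) (at y)"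
    using has_derivative_mult_right[OF flat_exp_ball_has_derivative[of 0 "r\<^sup>2" x y], of "1 / ?I"] by (simp add: numeral_2_eq_2)
  from frechet_derivative_at[OF this, symmetric]
  have "frechet_derivative (\<lambda>y. mollifier r (x - y)) (at y) b =
      (1 / ?I) * ((- 2 * ((y - x) \<bullet> b)) * flat_exp 2 (r\<^sup>2 - (y - x) \<bullet> (y - x)))"
    unfolding eq by simp
  moreover have "(x - y) \<bullet> (x - y) = (y - x) \<bullet> (y - x)" "(x - y) \<bullet> b = - ((y - x) \<bullet> b)"
    by (simp_all add: inner_diff_left inner_diff_right inner_commute algebra_simps)
  ultimately show ?thesis by (simp add: mollifier_deriv_def)
qed

lemma mollifier_has_derivative:
  "((\<lambda>t. mollifier r (w + t *\<^sub>R b)) has_real_derivative mollifier_deriv r b (w + t *\<^sub>R b)) (at t)"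
proof -
  let ?I = "LINT z|lborel. bump r (z::'a)"
  have "((\<lambda>t. r\<^sup>2 - (w + t *\<^sub>R b) \<bullet> (w + t *\<^sub>R b)) has_real_derivative (- 2 * ((w + t *\<^sub>R b) \<bullet> b))) (at t)"
    unfolding inner_add_left inner_add_right inner_scaleR_left inner_scaleR_right
    by (auto intro!: derivative_eq_intros simp: inner_commute)
  from DERIV_chain2[OF flat_exp_has_derivative[of 0] this]
  have "((\<lambda>t. flat_exp 0 (r\<^sup>2 - (w + t *\<^sub>R b) \<bullet> (w + t *\<^sub>R b))) has_real_derivative
     flat_exp 2 (r\<^sup>2 - (w + t *\<^sub>R b) \<bullet> (w + t *\<^sub>R b)) * (- 2 * ((w + t *\<^sub>R b) \<bullet> b))) (at t)"
    by (simp add: numeral_2_eq_2)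
  from DERIV_cdivide[OF this, of ?I] show ?thesis
    unfolding mollifier_def bump_def mollifier_deriv_def by (simp add: mult_ac)
qed

lemma continuous_mollifier_deriv: "continuous_on UNIV (mollifier_deriv r b)"
  unfolding mollifier_deriv_def[abs_def] divide_inverse
  by (intro continuous_intros continuous_flat_exp_ball)

lemma mollifier_deriv_support: "r > 0 \<Longrightarrow> y \<notin> cball 0 r \<Longrightarrow> mollifier_deriv r b y = 0"
  unfolding mollifier_deriv_def by (simp add: flat_exp_ball_support)

text \<open>Mollification commutes with weak differentiation: \<open>y \<mapsto> mollifier r (x - y)\<close> is a test function.\<close>
lemma conv_mollifier_has_vector_derivative:
  fixes u g :: "'a::euclidean_space \<Rightarrow> complex"
  assumes r: "r > 0" and u: "u \<in> L2" and weak: "has_weak_partial u b g"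
  shows "((\<lambda>t. conv (mollifier r) u (x + t *\<^sub>R b)) has_vector_derivative conv (mollifier r) g x) (at 0)"
proof -
  have "(LINT y|lborel. - mollifier_deriv r b (x - y) *\<^sub>R u y) = - (LINT y|lborel. mollifier r (x - y) *\<^sub>R g y)"
    using bspec[OF weak[unfolded has_weak_partial_def] mollifier_test_function[OF r, of x]]
    by (simp only: mollifier_frechet_derivative)
  then have "conv (mollifier_deriv r b) u x = conv (mollifier r) g x"
    by (simp add: conv_def)
  then show ?thesis
    using conv_has_vector_derivative[OF u continuous_mollifier mollifier_support[OF r]
        continuous_mollifier_deriv[of r b] mollifier_deriv_support[OF r] mollifier_has_derivative, of r x]
    by simp
qed

text \<open>Jensen's inequality for the square of the modulus, from the nonnegativity of the variance.\<close>
lemma norm_integral_square_le: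
  fixes k :: "'a \<Rightarrow> real" and f :: "'a \<Rightarrow> complex"
  assumes k: "\<And>y. k y \<ge> 0" "integrable M k" "(LINT y|M. k y) = 1"
    and f: "integrable M (\<lambda>y. k y *\<^sub>R f y)" "integrable M (\<lambda>y. k y * (cmod (f y))\<^sup>2)"
  shows "ennreal ((cmod (LINT y|M. k y *\<^sub>R f y))\<^sup>2) \<le> (\<integral>\<^sup>+y. ennreal (k y * (cmod (f y))\<^sup>2) \<partial>M)"
proof -
  define m where "m = (LINT y|M. k y *\<^sub>R f y)"
  have eq: "k y * (cmod (f y - m))\<^sup>2 = k y * (cmod (f y))\<^sup>2 - 2 * ((k y *\<^sub>R f y) \<bullet> m) + k y * (cmod m)\<^sup>2" for y
    by (simp add: power2_norm_eq_inner inner_diff_left inner_diff_right inner_commute algebra_simps)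
  have im: "integrable M (\<lambda>y. (k y *\<^sub>R f y) \<bullet> m)"
    using f(1) by (rule integrable_inner_left)
  have "0 \<le> (LINT y|M. k y * (cmod (f y - m))\<^sup>2)"
    using k(1) by (intro Bochner_Integration.integral_nonneg) auto
  also have "\<dots> = (LINT y|M. k y * (cmod (f y))\<^sup>2) - 2 * (LINT y|M. (k y *\<^sub>R f y) \<bullet> m) + (LINT y|M. k y) * (cmod m)\<^sup>2"
    unfolding eq using f(2) im k(2) by simp
  also have "(LINT y|M. (k y *\<^sub>R f y) \<bullet> m) = m \<bullet> m"
    using integral_inner_left[of m M "\<lambda>y. k y *\<^sub>R f y"] f(1) by (simp add: m_def)
  finally have "(cmod m)\<^sup>2 \<le> (LINT y|M. k y * (cmod (f y))\<^sup>2)"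
    using k(3) by (simp add: power2_norm_eq_inner)
  moreover have "(\<integral>\<^sup>+y. ennreal (k y * (cmod (f y))\<^sup>2) \<partial>M) = ennreal (LINT y|M. k y * (cmod (f y))\<^sup>2)"
    using f(2) k(1) by (intro nn_integral_eq_integral) auto
  ultimately show ?thesis by (simp add: m_def ennreal_leI)
qed

lemma mollifier_integrable:
  fixes u :: "'a::euclidean_space \<Rightarrow> complex"
  assumes r: "r > 0" and u: "u \<in> L2"
  shows "integrable lborel (\<lambda>y. mollifier r (x - y))" (is ?a)
    and "(LINT y|lborel. mollifier r (x - y)) = 1" (is ?b)
    and "integrable lborel (\<lambda>y. mollifier r (x - y) *\<^sub>R u y)" (is ?c)
    and "integrable lborel (\<lambda>y. mollifier r (x - y) * (cmod (u y))\<^sup>2)" (is ?d)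
proof -
  have [measurable]: "u \<in> borel_measurable borel" using u by (simp add: L2_def)
  obtain C where C: "C > 0" "\<And>y::'a. \<bar>mollifier r y\<bar> \<le> C * indicator (cball 0 r) y"
    using bounded_compact_support[OF continuous_mollifier mollifier_support[OF r]] by blast
  have bd: "mollifier r y \<le> C" for y :: 'a
    using C(2)[of y] C(1) by (cases "y \<in> cball 0 r") auto
  note nn = mollifier_nonneg[OF r, where 'a='a]
  show a: ?a
    by (rule integrableI_nonneg) (use nn nn_integral_mollifier(2)[OF r, of x] in auto)
  show ?b
    using nn_integral_mollifier(2)[OF r, of x] nn nn_integral_eq_integral[OF a] Bochner_Integration.integral_nonneg[of lborel "\<lambda>y. mollifier r (x - y)"]
    by simp
  show ?c
  proof (rule L2_integrable_scaleR[OF u, where C=C and R="norm x + r"])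
    fix y
    have "norm y \<le> norm x + r" if "x - y \<in> cball 0 r"
      using norm_triangle_ineq4[of x "x - y"] that by simp
    then show "\<bar>mollifier r (x - y)\<bar> \<le> C * indicator (cball 0 (norm x + r)) y"
      using C(2)[of "x - y"] C(1) by (cases "x - y \<in> cball 0 r") simp_all
  qed measurable
  show ?d
  proof (rule Bochner_Integration.integrable_bound)
    show "integrable lborel (\<lambda>y. C * (cmod (u y))\<^sup>2)" using u by (simp add: L2_def)
    show "AE y in lborel. norm (mollifier r (x - y) * (cmod (u y))\<^sup>2) \<le> norm (C * (cmod (u y))\<^sup>2)"
      using C(1) nn bd by (auto simp: abs_mult intro!: mult_right_mono)
  qed measurable
qed

lemma L2_nn_integral:
  assumes "u \<in> L2"
  shows "(\<integral>\<^sup>+x. ennreal ((cmod (u x))\<^sup>2) \<partial>lborel) = ennreal (LINT x|lborel. (cmod (u x))\<^sup>2)"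
  using assms by (intro nn_integral_eq_integral) (auto simp: L2_def)

lemma conv_mollifier_nn_integral_le:
  fixes u :: "'a::euclidean_space \<Rightarrow> complex"
  assumes r: "r > 0" and u: "u \<in> L2"
  shows "(\<integral>\<^sup>+x. ennreal ((cmod (conv (mollifier r) u x))\<^sup>2) \<partial>lborel) \<le> (\<integral>\<^sup>+x. ennreal ((cmod (u x))\<^sup>2) \<partial>lborel)"
proof -
  have [measurable]: "u \<in> borel_measurable borel" using u by (simp add: L2_def)
  note nn = mollifier_nonneg[OF r, where 'a='a]
  have "(\<integral>\<^sup>+x. ennreal ((cmod (conv (mollifier r) u x))\<^sup>2) \<partial>lborel)
      \<le> (\<integral>\<^sup>+x. \<integral>\<^sup>+y. ennreal (mollifier r (x - y) * (cmod (u y))\<^sup>2) \<partial>lborel \<partial>lborel)"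
    unfolding conv_def by (intro nn_integral_mono norm_integral_square_le mollifier_integrable[OF r u] nn)
  also have "\<dots> = (\<integral>\<^sup>+y. \<integral>\<^sup>+x. ennreal (mollifier r (x - y) * (cmod (u y))\<^sup>2) \<partial>lborel \<partial>lborel)"
    by (rule lborel_pair.Fubini') measurable
  also have "\<dots> = (\<integral>\<^sup>+y. ennreal ((cmod (u y))\<^sup>2) \<partial>lborel)"
    using nn by (simp add: ennreal_mult nn_integral_multc nn_integral_mollifier(3)[OF r])
  finally show ?thesis .
qed

lemma conv_mollifier_L2:
  fixes u :: "'a::euclidean_space \<Rightarrow> complex"
  assumes r: "r > 0" and u: "u \<in> L2"
  shows "continuous_on UNIV (conv (mollifier r) u)"
    and "conv (mollifier r) u \<in> L2"
    and "(LINT x|lborel. (cmod (conv (mollifier r) u x))\<^sup>2) \<le> (LINT x|lborel. (cmod (u x))\<^sup>2)"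
proof -
  show c: "continuous_on UNIV (conv (mollifier r) u)"
    by (rule continuous_conv[OF u continuous_mollifier mollifier_support[OF r]])
  have [measurable]: "conv (mollifier r) u \<in> borel_measurable borel"
    by (rule borel_measurable_continuous_onI[OF c])
  have "integrable lborel (\<lambda>x. (cmod (conv (mollifier r) u x))\<^sup>2)"
  proof (rule integrableI_nonneg)
    show "(\<integral>\<^sup>+x. ennreal ((cmod (conv (mollifier r) u x))\<^sup>2) \<partial>lborel) < \<infinity>"
      using conv_mollifier_nn_integral_le[OF r u] L2_nn_integral[OF u]
      by (simp add: order.strict_trans1)
  qed auto
  then show 2: "conv (mollifier r) u \<in> L2" by (simp add: L2_def)
  show "(LINT x|lborel. (cmod (conv (mollifier r) u x))\<^sup>2) \<le> (LINT x|lborel. (cmod (u x))\<^sup>2)"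
    using conv_mollifier_nn_integral_le[OF r u] unfolding L2_nn_integral[OF u] L2_nn_integral[OF 2]
    by (simp add: Bochner_Integration.integral_nonneg)
qed

text \<open>By Jensen's inequality, the distance to the mollified function is at most a weighted average of the
  distances to the translates.\<close>
lemma conv_mollifier_diff_le:
  fixes u :: "'a::euclidean_space \<Rightarrow> complex"
  assumes r: "r > 0" and u: "u \<in> L2"
  shows "(\<integral>\<^sup>+x. ennreal ((cmod (conv (mollifier r) u x - u x))\<^sup>2) \<partial>lborel)
     \<le> (\<integral>\<^sup>+z. ennreal (mollifier r z) * (\<integral>\<^sup>+x. ennreal ((cmod (u (x - z) - u x))\<^sup>2) \<partial>lborel) \<partial>lborel)"
proof -
  have [measurable]: "u \<in> borel_measurable borel" using u by (simp add: L2_def)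
  note nn = mollifier_nonneg[OF r, where 'a='a]
  note mi = mollifier_integrable[OF r u]
  have "ennreal ((cmod (conv (mollifier r) u x - u x))\<^sup>2)
      \<le> (\<integral>\<^sup>+z. ennreal (mollifier r z * (cmod (u (x - z) - u x))\<^sup>2) \<partial>lborel)" for x
  proof -
    have i1: "integrable lborel (\<lambda>y. mollifier r (x - y) *\<^sub>R (u y - u x))"
      using mi(1,3)[of x] by (simp add: scaleR_diff_right)
    have "conv (mollifier r) u x - u x = (LINT y|lborel. mollifier r (x - y) *\<^sub>R (u y - u x))"
      using mi[of x] by (simp add: scaleR_diff_right conv_def)
    moreover have "integrable lborel (\<lambda>y. mollifier r (x - y) * (cmod (u y - u x))\<^sup>2)"
    proof -
      have i2: "integrable lborel (\<lambda>y. (mollifier r (x - y) *\<^sub>R u y) \<bullet> u x)"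
        using mi(3) by (rule integrable_inner_left)
      have "(\<lambda>y. mollifier r (x - y) * (cmod (u y - u x))\<^sup>2) = (\<lambda>y. mollifier r (x - y) * (cmod (u y))\<^sup>2
          - 2 * ((mollifier r (x - y) *\<^sub>R u y) \<bullet> u x) + mollifier r (x - y) * (cmod (u x))\<^sup>2)"
        by (auto simp: fun_eq_iff power2_norm_eq_inner inner_diff_left inner_diff_right inner_commute algebra_simps)
      then show ?thesis using mi[of x] i2 by simp
    qed
    ultimately have "ennreal ((cmod (conv (mollifier r) u x - u x))\<^sup>2)
        \<le> (\<integral>\<^sup>+y. ennreal (mollifier r (x - y) * (cmod (u y - u x))\<^sup>2) \<partial>lborel)"
      using norm_integral_square_le[OF nn mi(1,2) i1] by simp
    also have "\<dots> = (\<integral>\<^sup>+z. ennreal (mollifier r z * (cmod (u (x - z) - u x))\<^sup>2) \<partial>lborel)"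
      by (subst nn_integral_lborel_reflect[of _ x, symmetric]) auto
    finally show ?thesis .
  qed
  then have "(\<integral>\<^sup>+x. ennreal ((cmod (conv (mollifier r) u x - u x))\<^sup>2) \<partial>lborel)
      \<le> (\<integral>\<^sup>+x. \<integral>\<^sup>+z. ennreal (mollifier r z * (cmod (u (x - z) - u x))\<^sup>2) \<partial>lborel \<partial>lborel)"
    by (intro nn_integral_mono)
  also have "\<dots> = (\<integral>\<^sup>+z. \<integral>\<^sup>+x. ennreal (mollifier r z * (cmod (u (x - z) - u x))\<^sup>2) \<partial>lborel \<partial>lborel)"
    by (rule lborel_pair.Fubini') measurable
  also have "\<dots> = (\<integral>\<^sup>+z. ennreal (mollifier r z) * (\<integral>\<^sup>+x. ennreal ((cmod (u (x - z) - u x))\<^sup>2) \<partial>lborel) \<partial>lborel)"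
    using nn by (simp add: ennreal_mult nn_integral_cmult)
  finally show ?thesis .
qed

lemma conv_mollifier_tendsto:
  fixes u :: "'a::euclidean_space \<Rightarrow> complex"
  assumes u: "u \<in> L2"
  shows "(\<lambda>n. \<integral>\<^sup>+x. ennreal ((cmod (conv (mollifier (1 / Suc n)) u x - u x))\<^sup>2) \<partial>lborel) \<longlonglongrightarrow> 0"
proof -
  define \<omega> where "\<omega> h = (\<integral>\<^sup>+x. ennreal ((cmod (u (x + h) - u x))\<^sup>2) \<partial>lborel)" for h
  have "(\<omega> \<longlongrightarrow> 0) (at 0)"
    unfolding tendsto_at_iff_sequentially o_def \<omega>_def using L2_translation_continuous[OF u] by auto
  moreover have "\<omega> 0 = 0" by (simp add: \<omega>_def)
  ultimately have cont: "(\<omega> \<longlongrightarrow> \<omega> 0) (nhds 0)"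
    by (metis tendsto_at_iff_tendsto_nhds)
  show ?thesis
  proof (rule order_tendstoI)
    fix a :: ennreal assume "a > 0"
    obtain e where e: "0 < e" "e < a" using dense[OF \<open>a > 0\<close>] by blast
    have "eventually (\<lambda>h. \<omega> h < e) (nhds 0)"
      using order_tendstoD(2)[OF cont, of e] e \<open>\<omega> 0 = 0\<close> by simp
    then obtain d where d: "d > 0" "\<And>h. norm h < d \<Longrightarrow> \<omega> h < e"
      unfolding eventually_nhds_metric by (auto simp: dist_norm)
    have "eventually (\<lambda>n. 1 / real (Suc n) < d) sequentially"
      using order_tendstoD(2)[OF LIMSEQ_Suc[OF lim_inverse_n'] d(1)] by simp
    then show "eventually (\<lambda>n. (\<integral>\<^sup>+x. ennreal ((cmod (conv (mollifier (1 / Suc n)) u x - u x))\<^sup>2) \<partial>lborel) < a) sequentially"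
    proof eventually_elim
      case (elim n)
      let ?r = "1 / real (Suc n)"
      have r: "?r > 0" by simp
      have "(\<integral>\<^sup>+x. ennreal ((cmod (conv (mollifier ?r) u x - u x))\<^sup>2) \<partial>lborel)
          \<le> (\<integral>\<^sup>+z. ennreal (mollifier ?r z) * \<omega> (- z) \<partial>lborel)"
        using conv_mollifier_diff_le[OF r u] by (simp add: \<omega>_def)
      also have "\<dots> \<le> (\<integral>\<^sup>+z. ennreal (mollifier ?r (z::'a)) * e \<partial>lborel)"
      proof (intro nn_integral_mono)
        fix z :: 'a
        show "ennreal (mollifier ?r z) * \<omega> (- z) \<le> ennreal (mollifier ?r z) * e"
        proof (cases "z \<in> cball 0 ?r")
          case True
          then show ?thesis using d(2)[of "-z"] elim by (intro mult_left_mono) auto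
        next
          case False
          then have "mollifier ?r z = 0" by (rule mollifier_support[OF r])
          then show ?thesis by (simp only:) simp
        qed
      qed
      also have "\<dots> = e"
        by (subst nn_integral_multc) (simp_all add: nn_integral_mollifier(1))
      finally show ?case using e by simp
    qed
  qed simp
qed

section \<open>The Hardy inequality in one direction\<close>

text \<open>A bounded continuous weight with a bounded continuous derivative in direction \<open>b\<close>.\<close>
definition C1_weight :: "'a::euclidean_space \<Rightarrow> ('a \<Rightarrow> real) \<Rightarrow> ('a \<Rightarrow> real) \<Rightarrow> bool" where
  "C1_weight b v v' \<longleftrightarrow>
     (\<forall>x. ((\<lambda>t. v (x + t *\<^sub>R b)) has_real_derivative v' x) (at 0)) \<and>
     continuous_on UNIV v \<and> continuous_on UNIV v' \<and>
     (\<exists>C. \<forall>x. \<bar>v x\<bar> \<le> C) \<and> (\<exists>C. \<forall>x. \<bar>v' x\<bar> \<le> C)"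

lemma C1_weight_0: "C1_weight b (\<lambda>x. 0) (\<lambda>x. 0)"
  by (auto simp: C1_weight_def)

lemma C1_weight_add:
  assumes "C1_weight b v v'" "C1_weight b w w'"
  shows "C1_weight b (\<lambda>x. v x + w x) (\<lambda>x. v' x + w' x)"
proof -
  have bd: "\<exists>C. \<forall>x. \<bar>p x + q x\<bar> \<le> C" if "\<exists>C. \<forall>x. \<bar>p x\<bar> \<le> C" "\<exists>C. \<forall>x. \<bar>q x\<bar> \<le> C"
    for p q :: "'a \<Rightarrow> real"
    using that by (meson abs_triangle_ineq add_mono order_trans)
  show ?thesis
    using assms unfolding C1_weight_def
    by (auto intro!: derivative_intros continuous_intros bd)
qed

lemma C1_weight_scale:
  assumes "C1_weight b v v'"
  shows "C1_weight b (\<lambda>x. c * v x) (\<lambda>x. c * v' x)"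
proof -
  have bd: "\<exists>C. \<forall>x. \<bar>c * p x\<bar> \<le> C" if "\<exists>C. \<forall>x. \<bar>p x\<bar> \<le> C" for p :: "'a \<Rightarrow> real"
    unfolding abs_mult using that by (meson abs_ge_zero mult_left_mono)
  show ?thesis
    using assms bd[of v] bd[of v'] unfolding C1_weight_def
    by (auto intro!: DERIV_cmult continuous_intros)
qed

lemma C1_weight_sum:
  assumes "\<And>i. i \<in> I \<Longrightarrow> C1_weight b (v i) (v' i)"
  shows "C1_weight b (\<lambda>x. \<Sum>i\<in>I. v i x) (\<lambda>x. \<Sum>i\<in>I. v' i x)"
  using assms by (induction I rule: infinite_finite_induct) (simp_all add: C1_weight_0 C1_weight_add)

text \<open>The components of the regularisation of \<open>y / |y|\<^sup>2\<close> at \<open>y = P x\<close> are the building blocks of all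
  weights below.\<close>
lemma C1_weight_regularised:
  fixes P :: "'a::euclidean_space \<Rightarrow> 'b::euclidean_space"
  assumes P: "linear P" and Pb: "P b = c *\<^sub>R e" and \<epsilon>: "\<epsilon> > 0"
  shows "C1_weight b (\<lambda>x. (P x \<bullet> e) / (P x \<bullet> P x + \<epsilon>))
    (\<lambda>x. c * ((e \<bullet> e) / (P x \<bullet> P x + \<epsilon>) - 2 * ((P x \<bullet> e) / (P x \<bullet> P x + \<epsilon>))\<^sup>2))"
proof -
  have pos: "y \<bullet> y + \<epsilon> > 0" for y :: 'b using \<epsilon> by (simp add: add_nonneg_pos)
  have cP: "continuous_on UNIV P" using P by (simp add: linear_continuous_on linear_linear)
  have bd: "\<bar>(y \<bullet> e) / (y \<bullet> y + \<epsilon>)\<bar> \<le> (1 + 1 / \<epsilon>) * norm e" for y :: 'b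
  proof -
    have "0 \<le> (norm y - 1)\<^sup>2" by simp
    then have "2 * norm y \<le> 1 + (norm y)\<^sup>2" by (simp add: power2_diff)
    then have "norm y \<le> 1 + (norm y)\<^sup>2" using norm_ge_zero[of y] by linarith
    also have "\<dots> \<le> (1 + 1 / \<epsilon>) * (y \<bullet> y + \<epsilon>)"
      using \<epsilon> by (simp add: power2_norm_eq_inner distrib_right distrib_left)
    finally have "norm y * norm e \<le> (1 + 1 / \<epsilon>) * (y \<bullet> y + \<epsilon>) * norm e"
      by (rule mult_right_mono) simp
    then have "\<bar>y \<bullet> e\<bar> \<le> (1 + 1 / \<epsilon>) * norm e * (y \<bullet> y + \<epsilon>)"
      using Cauchy_Schwarz_ineq2[of y e] by (simp add: mult_ac)
    then show ?thesis using pos[of y] by (simp add: pos_divide_le_eq)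
  qed
  have bd2: "\<bar>c * ((e \<bullet> e) / (y \<bullet> y + \<epsilon>) - 2 * ((y \<bullet> e) / (y \<bullet> y + \<epsilon>))\<^sup>2)\<bar>
      \<le> \<bar>c\<bar> * ((e \<bullet> e) / \<epsilon> + 2 * ((1 + 1 / \<epsilon>) * norm e)\<^sup>2)" for y :: 'b
  proof -
    have "((y \<bullet> e) / (y \<bullet> y + \<epsilon>))\<^sup>2 \<le> ((1 + 1 / \<epsilon>) * norm e)\<^sup>2"
      using bd[of y] by (metis abs_ge_zero power2_abs power_mono)
    moreover have "(e \<bullet> e) / (y \<bullet> y + \<epsilon>) \<le> (e \<bullet> e) / \<epsilon>"
      using \<epsilon> by (intro divide_left_mono) (auto simp: pos)
    moreover have "0 \<le> (e \<bullet> e) / (y \<bullet> y + \<epsilon>)" using pos[of y] by simp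
    ultimately have "\<bar>(e \<bullet> e) / (y \<bullet> y + \<epsilon>) - 2 * ((y \<bullet> e) / (y \<bullet> y + \<epsilon>))\<^sup>2\<bar>
      \<le> (e \<bullet> e) / \<epsilon> + 2 * ((1 + 1 / \<epsilon>) * norm e)\<^sup>2"
      using zero_le_power2[of "(y \<bullet> e) / (y \<bullet> y + \<epsilon>)"] by linarith
    then show ?thesis unfolding abs_mult by (intro mult_left_mono) auto
  qed
  have deriv: "((\<lambda>t. (P (x + t *\<^sub>R b) \<bullet> e) / (P (x + t *\<^sub>R b) \<bullet> P (x + t *\<^sub>R b) + \<epsilon>)) has_real_derivative
     c * ((e \<bullet> e) / (P x \<bullet> P x + \<epsilon>) - 2 * ((P x \<bullet> e) / (P x \<bullet> P x + \<epsilon>))\<^sup>2)) (at 0)" for x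
  proof -
    have eq: "P (x + t *\<^sub>R b) = P x + (t * c) *\<^sub>R e" for t
      using P Pb by (simp add: linear_add linear_scale)
    have n: "((\<lambda>t. P x \<bullet> e + t * c * (e \<bullet> e)) has_real_derivative c * (e \<bullet> e)) (at 0)"
      by (auto intro!: derivative_eq_intros)
    have d: "((\<lambda>t. P x \<bullet> P x + t * c * (2 * (P x \<bullet> e)) + t * t * (c * c * (e \<bullet> e)) + \<epsilon>) has_real_derivative c * (2 * (P x \<bullet> e))) (at 0)"
      by (auto intro!: derivative_eq_intros)
    have 1: "(P (x + t *\<^sub>R b) \<bullet> e) / (P (x + t *\<^sub>R b) \<bullet> P (x + t *\<^sub>R b) + \<epsilon>) =
       (P x \<bullet> e + t * c * (e \<bullet> e)) / (P x \<bullet> P x + t * c * (2 * (P x \<bullet> e)) + t * t * (c * c * (e \<bullet> e)) + \<epsilon>)" for t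
      unfolding eq by (simp add: inner_add_left inner_add_right inner_commute algebra_simps)
    have ne: "P x \<bullet> P x + 0 * c * (2 * (P x \<bullet> e)) + 0 * 0 * (c * c * (e \<bullet> e)) + \<epsilon> \<noteq> 0"
      using pos[of "P x"] by simp
    have "P x \<bullet> P x + \<epsilon> \<noteq> 0" using pos[of "P x"] by simp
    then have "(c * E * (P x \<bullet> P x + \<epsilon>) - A * (c * (2 * A))) / ((P x \<bullet> P x + \<epsilon>) * (P x \<bullet> P x + \<epsilon>))
        = c * (E / (P x \<bullet> P x + \<epsilon>) - 2 * (A / (P x \<bullet> P x + \<epsilon>))\<^sup>2)" for A E
      by (simp add: diff_divide_distrib right_diff_distrib power2_eq_square mult_ac)
    then show ?thesis unfolding 1
      by (intro DERIV_cong[OF DERIV_divide[OF n d ne]]) simp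
  qed
  show ?thesis unfolding C1_weight_def
  proof (intro conjI allI deriv)
    show "continuous_on UNIV (\<lambda>x. (P x \<bullet> e) / (P x \<bullet> P x + \<epsilon>))"
      using pos by (intro continuous_intros cP) (metis less_irrefl)
    show "continuous_on UNIV (\<lambda>x. c * ((e \<bullet> e) / (P x \<bullet> P x + \<epsilon>) - 2 * ((P x \<bullet> e) / (P x \<bullet> P x + \<epsilon>))\<^sup>2))"
      using pos by (intro continuous_intros cP) (metis less_irrefl)+
  qed (use bd bd2 in blast)+
qed

lemma L2_weighted_integrable:
  assumes u: "u \<in> L2" and [measurable]: "f \<in> borel_measurable borel" and bd: "\<And>x. \<bar>f x\<bar> \<le> C"
  shows "integrable lborel (\<lambda>x. f x * (cmod (u x))\<^sup>2)"
proof (rule Bochner_Integration.integrable_bound)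
  have [measurable]: "u \<in> borel_measurable lborel" using u by (simp add: L2_def)
  show "integrable lborel (\<lambda>x. C * (cmod (u x))\<^sup>2)" using u by (simp add: L2_def)
  show "AE x in lborel. norm (f x * (cmod (u x))\<^sup>2) \<le> norm (C * (cmod (u x))\<^sup>2)"
    using order_trans[OF bd abs_ge_self] by (auto simp: abs_mult intro!: mult_right_mono)
  show "(\<lambda>x. f x * (cmod (u x))\<^sup>2) \<in> borel_measurable lborel" by measurable
qed

lemma L2_inner_integrable:
  assumes u: "u \<in> L2" and g: "g \<in> L2" and [measurable]: "f \<in> borel_measurable borel" and bd: "\<And>x. \<bar>f x\<bar> \<le> C"
  shows "integrable lborel (\<lambda>x. f x * (u x \<bullet> g x))"
proof (rule Bochner_Integration.integrable_bound)
  have [measurable]: "u \<in> borel_measurable borel" "g \<in> borel_measurable borel"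
    using u g by (simp_all add: L2_def)
  show "integrable lborel (\<lambda>x. C * ((cmod (u x))\<^sup>2 + (cmod (g x))\<^sup>2))" using u g by (simp add: L2_def)
  have "\<bar>u x \<bullet> g x\<bar> \<le> (cmod (u x))\<^sup>2 + (cmod (g x))\<^sup>2" for x
  proof -
    have "0 \<le> (cmod (u x) - cmod (g x))\<^sup>2" by simp
    then have "2 * (cmod (u x) * cmod (g x)) \<le> (cmod (u x))\<^sup>2 + (cmod (g x))\<^sup>2" by (simp add: power2_diff)
    moreover have "0 \<le> cmod (u x) * cmod (g x)" by simp
    ultimately show ?thesis using Cauchy_Schwarz_ineq2[of "u x" "g x"] by linarith
  qed
  then show "AE x in lborel. norm (f x * (u x \<bullet> g x)) \<le> norm (C * ((cmod (u x))\<^sup>2 + (cmod (g x))\<^sup>2))"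
    using order_trans[OF bd abs_ge_self] by (auto simp: abs_mult intro!: mult_mono)
  show "(\<lambda>x. f x * (u x \<bullet> g x)) \<in> borel_measurable lborel" by measurable
qed

lemma directional_hardy_mollified:
  fixes u g :: "'a::euclidean_space \<Rightarrow> complex"
  assumes r: "r > 0" and u: "u \<in> L2" and g: "g \<in> L2" and weak: "has_weak_partial u b g"
    and v: "C1_weight b v v'"
  shows "(LINT x|lborel. (v' x - (v x)\<^sup>2) * (cmod (conv (mollifier r) u x))\<^sup>2) \<le> (LINT x|lborel. (cmod (g x))\<^sup>2)"
proof -
  define w h where "w = conv (mollifier r) u" and "h = conv (mollifier r) g"
  have w: "w \<in> L2" "continuous_on UNIV w" and h: "h \<in> L2" "continuous_on UNIV h"
    using conv_mollifier_L2[OF r] u g by (auto simp: w_def h_def)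
  have c: "continuous_on UNIV v" "continuous_on UNIV v'" using v by (auto simp: C1_weight_def)
  have [measurable]: "v \<in> borel_measurable borel" "v' \<in> borel_measurable borel"
    using c by (auto intro: borel_measurable_continuous_onI)
  obtain C C' where C: "\<And>x. \<bar>v x\<bar> \<le> C" "\<And>x. \<bar>v' x\<bar> \<le> C'" using v by (auto simp: C1_weight_def)
  have C2: "\<bar>(v x)\<^sup>2\<bar> \<le> C\<^sup>2" for x
    using power_mono[OF C(1)[of x] abs_ge_zero, of 2] by simp
  have hsq: "integrable lborel (\<lambda>x. (cmod (h x))\<^sup>2)" using h by (simp add: L2_def)
  note ints = L2_weighted_integrable[OF w(1) _ C(1)] L2_weighted_integrable[OF w(1) _ C(2)]
    L2_weighted_integrable[OF w(1) _ C2] L2_inner_integrable[OF w(1) h(1) _ C(1)] hsq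
  have deriv: "((\<lambda>t. v (x + t *\<^sub>R b) * (cmod (w (x + t *\<^sub>R b)))\<^sup>2) has_real_derivative
      v' x * (cmod (w x))\<^sup>2 + 2 * (v x * (w x \<bullet> h x))) (at 0)" for x
  proof -
    have "((\<lambda>t. w (x + t *\<^sub>R b)) has_vector_derivative h x) (at 0)"
      unfolding w_def h_def by (rule conv_mollifier_has_vector_derivative[OF r u weak])
    then have d: "((\<lambda>t. w (x + t *\<^sub>R b)) has_derivative (\<lambda>t. t *\<^sub>R h x)) (at 0)"
      by (simp add: has_vector_derivative_def)
    have "((\<lambda>t. w (x + t *\<^sub>R b) \<bullet> w (x + t *\<^sub>R b)) has_real_derivative 2 * (w x \<bullet> h x)) (at 0)"
      unfolding has_field_derivative_def
      by (rule has_derivative_eq_rhs[OF has_derivative_inner[OF d d]]) (auto simp: inner_commute)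
    moreover have "((\<lambda>t. v (x + t *\<^sub>R b)) has_real_derivative v' x) (at 0)"
      using v by (simp add: C1_weight_def)
    ultimately show ?thesis
      by (auto intro!: derivative_eq_intros simp: power2_norm_eq_inner)
  qed
  have "(LINT x|lborel. v' x * (cmod (w x))\<^sup>2 + 2 * (v x * (w x \<bullet> h x))) = 0"
  proof (rule integral_directional_derivative_eq_0[OF deriv])
    show "continuous_on UNIV (\<lambda>x. v' x * (cmod (w x))\<^sup>2 + 2 * (v x * (w x \<bullet> h x)))"
      by (intro continuous_intros c w h)
  qed (use ints in auto)
  then have parts: "2 * (LINT x|lborel. v x * (w x \<bullet> h x)) = - (LINT x|lborel. v' x * (cmod (w x))\<^sup>2)"
    using ints by simp
  have eq: "(cmod (h x + v x *\<^sub>R w x))\<^sup>2 = (cmod (h x))\<^sup>2 + 2 * (v x * (w x \<bullet> h x)) + (v x)\<^sup>2 * (cmod (w x))\<^sup>2" for x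
    unfolding power2_norm_eq_inner by (simp add: inner_add_left inner_add_right inner_commute power2_eq_square)
  have "0 \<le> (LINT x|lborel. (cmod (h x + v x *\<^sub>R w x))\<^sup>2)" by (simp add: Bochner_Integration.integral_nonneg)
  also have "\<dots> = (LINT x|lborel. (cmod (h x))\<^sup>2) - (LINT x|lborel. v' x * (cmod (w x))\<^sup>2) + (LINT x|lborel. (v x)\<^sup>2 * (cmod (w x))\<^sup>2)"
    unfolding eq using ints parts by simp
  finally have "(LINT x|lborel. (v' x - (v x)\<^sup>2) * (cmod (w x))\<^sup>2) \<le> (LINT x|lborel. (cmod (h x))\<^sup>2)"
    unfolding left_diff_distrib using ints by simp
  also have "\<dots> \<le> (LINT x|lborel. (cmod (g x))\<^sup>2)"
    unfolding h_def by (rule conv_mollifier_L2(3)[OF r g])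
  finally show ?thesis by (simp add: w_def)
qed

text \<open>A consequence of the inequality between arithmetic and geometric mean. It makes \<open>L2\<close> convergence
  pass to the squares under a bounded weight.\<close>
lemma norm_square_diff_le:
  fixes a b :: "'a::real_inner"
  assumes "\<eta> > 0"
  shows "\<bar>(norm a)\<^sup>2 - (norm b)\<^sup>2\<bar> \<le> \<eta> * (norm a)\<^sup>2 + (1 + 1 / \<eta>) * (norm (b - a))\<^sup>2"
proof -
  define s where "s = sqrt \<eta>"
  have s: "s > 0" "s\<^sup>2 = \<eta>" using assms by (auto simp: s_def)
  have eq: "(norm b)\<^sup>2 - (norm a)\<^sup>2 = (norm (b - a))\<^sup>2 + 2 * (a \<bullet> (b - a))"
    by (simp add: power2_norm_eq_inner inner_diff_left inner_diff_right inner_commute algebra_simps)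
  have "0 \<le> (s * norm a - norm (b - a) / s)\<^sup>2" by simp
  then have "2 * (norm a * norm (b - a)) \<le> \<eta> * (norm a)\<^sup>2 + (norm (b - a))\<^sup>2 / \<eta>"
    using s by (simp add: power2_diff power_mult_distrib power_divide)
  moreover have "\<bar>a \<bullet> (b - a)\<bar> \<le> norm a * norm (b - a)" by (rule Cauchy_Schwarz_ineq2)
  ultimately show ?thesis using eq by (simp add: distrib_right) (use zero_le_power2[of "norm (b - a)"] in linarith)
qed

lemma L2_diff:
  assumes f: "f \<in> L2" and g: "g \<in> L2"
  shows "(\<lambda>x. f x - g x) \<in> L2"
proof -
  have [measurable]: "f \<in> borel_measurable borel" "g \<in> borel_measurable borel"
    using f g by (simp_all add: L2_def)
  have "integrable lborel (\<lambda>x. (cmod (f x - g x))\<^sup>2)"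
  proof (rule Bochner_Integration.integrable_bound)
    show "integrable lborel (\<lambda>x. 2 * (cmod (f x))\<^sup>2 + 2 * (cmod (g x))\<^sup>2)" using f g by (simp add: L2_def)
    have "(cmod (a - b))\<^sup>2 \<le> 2 * (cmod a)\<^sup>2 + 2 * (cmod b)\<^sup>2" for a b
    proof -
      have "0 \<le> (cmod (a + b))\<^sup>2" by simp
      then show ?thesis
        unfolding power2_norm_eq_inner
        by (simp add: inner_add_left inner_add_right inner_diff_left inner_diff_right inner_commute)
    qed
    then show "AE x in lborel. norm ((cmod (f x - g x))\<^sup>2) \<le> norm (2 * (cmod (f x))\<^sup>2 + 2 * (cmod (g x))\<^sup>2)"
      by simp
  qed measurable
  then show ?thesis by (simp add: L2_def)
qed

text \<open>For the mollified functions this is \<open>directional_hardy_mollified\<close>, whose right-hand side does not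
  depend on the radius; the left-hand side converges since \<open>v' - v\<^sup>2\<close> is bounded.\<close>
theorem directional_hardy:
  fixes u g :: "'a::euclidean_space \<Rightarrow> complex"
  assumes u: "u \<in> L2" and g: "g \<in> L2" and weak: "has_weak_partial u b g"
    and v: "C1_weight b v v'"
  shows "(LINT x|lborel. (v' x - (v x)\<^sup>2) * (cmod (u x))\<^sup>2) \<le> (LINT x|lborel. (cmod (g x))\<^sup>2)"
proof -
  define W where "W x = v' x - (v x)\<^sup>2" for x
  define un where "un n = conv (mollifier (1 / Suc n)) u" for n
  define D where "D n = (LINT x|lborel. (cmod (un n x - u x))\<^sup>2)" for n
  define N where "N = (LINT x|lborel. (cmod (u x))\<^sup>2)"
  define T where "T = (LINT x|lborel. (cmod (g x))\<^sup>2)"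
  have un: "un n \<in> L2" for n unfolding un_def by (rule conv_mollifier_L2(2)[OF _ u]) simp
  have c: "continuous_on UNIV v" "continuous_on UNIV v'" using v by (auto simp: C1_weight_def)
  have "continuous_on UNIV W" unfolding W_def[abs_def] by (intro continuous_intros c)
  then have [measurable]: "W \<in> borel_measurable borel" by (rule borel_measurable_continuous_onI)
  have [measurable]: "u \<in> borel_measurable borel" "\<And>n. un n \<in> borel_measurable borel"
    using u un by (auto simp: L2_def)
  obtain C1 C2 where C12: "\<And>x. \<bar>v x\<bar> \<le> C1" "\<And>x. \<bar>v' x\<bar> \<le> C2" using v by (auto simp: C1_weight_def)
  define C where "C = C2 + C1\<^sup>2"
  have C: "\<bar>W x\<bar> \<le> C" for x
  proof -
    have "(v x)\<^sup>2 \<le> C1\<^sup>2" using power_mono[OF C12(1)[of x] abs_ge_zero, of 2] by simp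
    then show ?thesis using C12(2)[of x] zero_le_power2[of "v x"] unfolding W_def C_def by linarith
  qed
  have "C \<ge> 0" using C[of 0] by linarith
  have uq: "integrable lborel (\<lambda>x. (cmod (u x))\<^sup>2)" using u by (simp add: L2_def)
  have dq: "integrable lborel (\<lambda>x. (cmod (un n x - u x))\<^sup>2)" for n
    using L2_diff[OF un[of n] u] by (simp add: L2_def)
  have D0: "D \<longlonglongrightarrow> 0"
  proof -
    have "(\<lambda>n. ennreal (D n)) \<longlonglongrightarrow> ennreal 0"
      using conv_mollifier_tendsto[OF u] nn_integral_eq_integral[OF dq] by (simp add: D_def un_def)
    then show ?thesis
      by (subst (asm) tendsto_ennreal_iff) (auto simp: D_def Bochner_Integration.integral_nonneg)
  qed
  \<comment> \<open>The error terms vanish on letting first \<open>n \<rightarrow> \<infinity>\<close> and then \<open>\<eta> \<rightarrow> 0\<close>.\<close>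
  have main: "(LINT x|lborel. W x * (cmod (u x))\<^sup>2) \<le> T + C * (\<eta> * N + (1 + 1 / \<eta>) * D n)" if "\<eta> > 0" for \<eta> n
  proof -
    have iu: "integrable lborel (\<lambda>x. W x * (cmod (u x))\<^sup>2)" by (rule L2_weighted_integrable[OF u _ C]) simp
    have iun: "integrable lborel (\<lambda>x. W x * (cmod (un n x))\<^sup>2)" by (rule L2_weighted_integrable[OF un _ C]) simp
    have "(LINT x|lborel. W x * (cmod (u x))\<^sup>2) - (LINT x|lborel. W x * (cmod (un n x))\<^sup>2)
        = (LINT x|lborel. W x * (cmod (u x))\<^sup>2 - W x * (cmod (un n x))\<^sup>2)"
      using iu iun by simp
    also have "\<dots> \<le> (LINT x|lborel. C * (\<eta> * (cmod (u x))\<^sup>2 + (1 + 1 / \<eta>) * (cmod (un n x - u x))\<^sup>2))"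
    proof (intro integral_mono)
      fix x
      have "W x * (cmod (u x))\<^sup>2 - W x * (cmod (un n x))\<^sup>2 = W x * ((cmod (u x))\<^sup>2 - (cmod (un n x))\<^sup>2)"
        by (simp add: right_diff_distrib)
      also have "\<dots> \<le> \<bar>W x\<bar> * \<bar>(cmod (u x))\<^sup>2 - (cmod (un n x))\<^sup>2\<bar>"
        unfolding abs_mult[symmetric] by (rule abs_ge_self)
      also have "\<dots> \<le> C * (\<eta> * (cmod (u x))\<^sup>2 + (1 + 1 / \<eta>) * (cmod (un n x - u x))\<^sup>2)"
        by (intro mult_mono C norm_square_diff_le that \<open>C \<ge> 0\<close>) auto
      finally show "W x * (cmod (u x))\<^sup>2 - W x * (cmod (un n x))\<^sup>2 \<le> C * (\<eta> * (cmod (u x))\<^sup>2 + (1 + 1 / \<eta>) * (cmod (un n x - u x))\<^sup>2)" .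
    qed (use iu iun uq dq[of n] in auto)
    also have "\<dots> = C * (\<eta> * N + (1 + 1 / \<eta>) * D n)"
      using uq dq[of n] by (simp add: N_def D_def)
    finally have "(LINT x|lborel. W x * (cmod (u x))\<^sup>2) \<le> (LINT x|lborel. W x * (cmod (un n x))\<^sup>2) + C * (\<eta> * N + (1 + 1 / \<eta>) * D n)"
      by simp
    moreover have "(LINT x|lborel. W x * (cmod (un n x))\<^sup>2) \<le> T"
      unfolding W_def un_def T_def by (rule directional_hardy_mollified[OF _ u g weak v]) simp
    ultimately show ?thesis by linarith
  qed
  have main2: "(LINT x|lborel. W x * (cmod (u x))\<^sup>2) \<le> T + C * (\<eta> * N)" if "\<eta> > 0" for \<eta>
  proof (rule LIMSEQ_le_const)
    show "(\<lambda>n. T + C * (\<eta> * N + (1 + 1 / \<eta>) * D n)) \<longlonglongrightarrow> T + C * (\<eta> * N)"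
      by (rule tendsto_eq_intros D0 refl | simp)+
  qed (use main[OF that] in auto)
  have "(LINT x|lborel. W x * (cmod (u x))\<^sup>2) \<le> T"
  proof (rule LIMSEQ_le_const)
    have "(\<lambda>n. T + C * (1 / real (Suc n) * N)) \<longlonglongrightarrow> T + C * (0 * N)"
      by (intro tendsto_intros LIMSEQ_Suc[OF lim_inverse_n'])
    then show "(\<lambda>n. T + C * (1 / real (Suc n) * N)) \<longlonglongrightarrow> T" by simp
    show "\<exists>M. \<forall>n\<ge>M. (LINT x|lborel. W x * (cmod (u x))\<^sup>2) \<le> T + C * (1 / real (Suc n) * N)"
      using main2[of "1 / real (Suc n)" for n] by simp
  qed
  then show ?thesis by (simp add: W_def T_def)
qed

lemma has_weak_partial_diff:
  fixes u :: "'a::euclidean_space \<Rightarrow> complex"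
  assumes u: "u \<in> L2" and g: "g \<in> L2" "g' \<in> L2" and b: "b \<in> Basis" "b' \<in> Basis"
    and weak: "has_weak_partial u b g" "has_weak_partial u b' g'"
  shows "has_weak_partial u (b - b') (\<lambda>x. g x - g' x)"
  unfolding has_weak_partial_def
proof
  fix \<phi> :: "'a \<Rightarrow> real" assume \<phi>: "\<phi> \<in> test_functions"
  have Ck: "Ck k \<phi>" for k using \<phi> by (simp add: test_functions_def)
  have diff: "\<phi> differentiable (at x)" for x using Ck[of "Suc 0"] by simp
  obtain R where R: "closure {x. \<phi> x \<noteq> 0} \<subseteq> cball 0 R"
  proof -
    have "bounded (closure {x. \<phi> x \<noteq> 0})"
      using \<phi> by (simp add: test_functions_def compact_imp_bounded)
    then obtain R where "\<forall>x\<in>closure {x. \<phi> x \<noteq> 0}. norm x \<le> R"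
      unfolding bounded_iff by blast
    then have "closure {x. \<phi> x \<noteq> 0} \<subseteq> cball 0 R"
      by (intro subsetI) simp
    then show ?thesis by (rule that)
  qed
  have supp: "\<phi> y = 0" if "y \<notin> cball 0 R" for y
    using that R closure_subset[of "{x. \<phi> x \<noteq> 0}"] by blast
  have dsupp: "frechet_derivative \<phi> (at y) e = 0" if y: "y \<notin> cball 0 R" for y e
  proof -
    have "((\<lambda>x. 0) has_derivative (\<lambda>h. 0)) (at y within UNIV)" by simp
    then have "(\<phi> has_derivative (\<lambda>h. 0)) (at y)"
      by (rule has_derivative_transform_within_open[where s="- cball 0 R"]) (use y supp in auto)
    from frechet_derivative_at[OF this] show ?thesis by metis
  qed
  have int\<phi>: "integrable lborel (\<lambda>x. \<phi> x *\<^sub>R f x)" if "f \<in> L2" for f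
  proof -
    have c: "continuous_on UNIV \<phi>" using Ck[of 0] by simp
    from bounded_compact_support[OF c supp]
    obtain C where "\<And>y. \<bar>\<phi> y\<bar> \<le> C * indicator (cball 0 R) y" by blast
    then show ?thesis
      by (rule L2_integrable_scaleR[OF that borel_measurable_continuous_onI[OF c]])
  qed
  have intD: "integrable lborel (\<lambda>x. frechet_derivative \<phi> (at x) e *\<^sub>R u x)" if "e \<in> Basis" for e
  proof -
    have c: "continuous_on UNIV (\<lambda>x. frechet_derivative \<phi> (at x) e)" using Ck[of "Suc 0"] that by simp
    from bounded_compact_support[OF c dsupp]
    obtain C where "\<And>y. \<bar>frechet_derivative \<phi> (at y) e\<bar> \<le> C * indicator (cball 0 R) y" by blast
    then show ?thesis
      by (rule L2_integrable_scaleR[OF u borel_measurable_continuous_onI[OF c]])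
  qed
  have "frechet_derivative \<phi> (at x) (b - b') = frechet_derivative \<phi> (at x) b - frechet_derivative \<phi> (at x) b'" for x
    using linear_frechet_derivative[OF diff] by (rule linear_diff)
  then have "(LINT x|lborel. frechet_derivative \<phi> (at x) (b - b') *\<^sub>R u x) =
     (LINT x|lborel. frechet_derivative \<phi> (at x) b *\<^sub>R u x) - (LINT x|lborel. frechet_derivative \<phi> (at x) b' *\<^sub>R u x)"
    using intD b by (simp add: scaleR_diff_left)
  also have "\<dots> = - (LINT x|lborel. \<phi> x *\<^sub>R g x) + (LINT x|lborel. \<phi> x *\<^sub>R g' x)"
    using weak \<phi> by (simp add: has_weak_partial_def)
  also have "\<dots> = - (LINT x|lborel. \<phi> x *\<^sub>R (g x - g' x))"
    using int\<phi> g by (simp add: scaleR_diff_right)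
  finally show "(LINT x|lborel. frechet_derivative \<phi> (at x) (b - b') *\<^sub>R u x) = - (LINT x|lborel. \<phi> x *\<^sub>R (g x - g' x))" .
qed

section \<open>Pairs and triples of particles\<close>

text \<open>Bounded Borel functions, the weights whose product with \<open>|u|\<^sup>2\<close> is integrable for \<open>u\<close> in \<open>L2\<close>.\<close>
definition bounded_borel :: "('a::euclidean_space \<Rightarrow> real) \<Rightarrow> bool" where
  "bounded_borel f \<longleftrightarrow> f \<in> borel_measurable borel \<and> (\<exists>C. \<forall>x. \<bar>f x\<bar> \<le> C)"

lemma bounded_borel_const: "bounded_borel (\<lambda>x. c)"
  by (auto simp: bounded_borel_def)

lemma bounded_borel_add: "bounded_borel f \<Longrightarrow> bounded_borel g \<Longrightarrow> bounded_borel (\<lambda>x. f x + g x)"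
  unfolding bounded_borel_def
  by (safe, simp) (meson abs_triangle_ineq add_mono order_trans)

lemma bounded_borel_cmult: "bounded_borel f \<Longrightarrow> bounded_borel (\<lambda>x. c * f x)"
  unfolding bounded_borel_def abs_mult
  by (safe, simp) (meson abs_ge_zero mult_left_mono)

lemma bounded_borel_sum: "(\<And>i. i \<in> I \<Longrightarrow> bounded_borel (f i)) \<Longrightarrow> bounded_borel (\<lambda>x. \<Sum>i\<in>I. f i x)"
  by (induction I rule: infinite_finite_induct) (simp_all add: bounded_borel_const bounded_borel_add)

lemma bounded_borel_L2_integrable:
  "u \<in> L2 \<Longrightarrow> bounded_borel f \<Longrightarrow> integrable lborel (\<lambda>x. f x * (cmod (u x))\<^sup>2)"
  unfolding bounded_borel_def using L2_weighted_integrable by blast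

text \<open>Several directional inequalities at once, with a pointwise lower bound \<open>F\<close> for the total weight.\<close>
lemma sum_directional_hardy:
  fixes u :: "'a::euclidean_space \<Rightarrow> complex"
  assumes u: "u \<in> L2" and g: "\<And>\<kappa>. \<kappa> \<in> K \<Longrightarrow> g \<kappa> \<in> L2" "\<And>\<kappa>. \<kappa> \<in> K \<Longrightarrow> has_weak_partial u (b \<kappa>) (g \<kappa>)"
    and v: "\<And>\<kappa>. \<kappa> \<in> K \<Longrightarrow> C1_weight (b \<kappa>) (v \<kappa>) (v' \<kappa>)"
    and F: "bounded_borel F"
    and le: "\<And>x. F x \<le> (\<Sum>\<kappa>\<in>K. v' \<kappa> x - (v \<kappa> x)\<^sup>2)"
  shows "(LINT x|lborel. F x * (cmod (u x))\<^sup>2) \<le> (\<Sum>\<kappa>\<in>K. LINT x|lborel. (cmod (g \<kappa> x))\<^sup>2)"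
proof -
  have int: "integrable lborel (\<lambda>x. (v' \<kappa> x - (v \<kappa> x)\<^sup>2) * (cmod (u x))\<^sup>2)" if \<kappa>: "\<kappa> \<in> K" for \<kappa>
  proof -
    have c: "continuous_on UNIV (v \<kappa>)" "continuous_on UNIV (v' \<kappa>)" using v[OF \<kappa>] by (auto simp: C1_weight_def)
    obtain C1 C2 where C: "\<And>x. \<bar>v \<kappa> x\<bar> \<le> C1" "\<And>x. \<bar>v' \<kappa> x\<bar> \<le> C2" using v[OF \<kappa>] by (auto simp: C1_weight_def)
    have "\<bar>v' \<kappa> x - (v \<kappa> x)\<^sup>2\<bar> \<le> C2 + C1\<^sup>2" for x
    proof -
      have "(v \<kappa> x)\<^sup>2 \<le> C1\<^sup>2" using power_mono[OF C(1)[of x] abs_ge_zero, of 2] by simp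
      then show ?thesis using C(2)[of x] zero_le_power2[of "v \<kappa> x"] by linarith
    qed
    then show ?thesis
      by (intro L2_weighted_integrable[OF u]) (auto intro!: borel_measurable_continuous_onI continuous_intros c)
  qed
  have "(LINT x|lborel. F x * (cmod (u x))\<^sup>2) \<le> (LINT x|lborel. (\<Sum>\<kappa>\<in>K. (v' \<kappa> x - (v \<kappa> x)\<^sup>2) * (cmod (u x))\<^sup>2))"
    by (intro integral_mono bounded_borel_L2_integrable[OF u F] Bochner_Integration.integrable_sum int)
       (simp_all add: sum_distrib_right[symmetric] mult_right_mono[OF le])
  also have "\<dots> = (\<Sum>\<kappa>\<in>K. LINT x|lborel. (v' \<kappa> x - (v \<kappa> x)\<^sup>2) * (cmod (u x))\<^sup>2)"
    by (rule Bochner_Integration.integral_sum) (rule int)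
  also have "\<dots> \<le> (\<Sum>\<kappa>\<in>K. LINT x|lborel. (cmod (g \<kappa> x))\<^sup>2)"
    by (rule sum_mono, rule directional_hardy[OF u g(1) g(2) v])
  finally show ?thesis .
qed

lemma schur_inequality:
  fixes a b c :: real
  assumes "a \<ge> 0" "b \<ge> 0" "c \<ge> 0"
  shows "0 \<le> a * (a - b) * (a - c) + b * (b - a) * (b - c) + c * (c - a) * (c - b)"
proof -
  have *: "0 \<le> a * (a - b) * (a - c) + b * (b - a) * (b - c) + c * (c - a) * (c - b)"
    if "a \<ge> b" "b \<ge> c" "c \<ge> 0" for a b c :: real
  proof -
    have "0 \<le> (a - b) * ((a - b) * (a + b - c)) + c * ((a - c) * (b - c))"
      using that by (intro add_nonneg_nonneg mult_nonneg_nonneg) auto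
    then show ?thesis by (simp add: algebra_simps)
  qed
  consider "a \<ge> b \<and> b \<ge> c" | "a \<ge> c \<and> c \<ge> b" | "b \<ge> a \<and> a \<ge> c" | "b \<ge> c \<and> c \<ge> a"
    | "c \<ge> a \<and> a \<ge> b" | "c \<ge> b \<and> b \<ge> a" by linarith
  then show ?thesis
  proof cases
    case 1 then show ?thesis using *[of b a c] assms by simp
  next
    case 2 then show ?thesis using *[of c a b] assms by (simp add: algebra_simps)
  next
    case 3 then show ?thesis using *[of a b c] assms by (simp add: algebra_simps)
  next
    case 4 then show ?thesis using *[of c b a] assms by (simp add: algebra_simps)
  next
    case 5 then show ?thesis using *[of a c b] assms by (simp add: algebra_simps)
  next
    case 6 then show ?thesis using *[of b c a] assms by (simp add: algebra_simps)
  qed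
qed

text \<open>Schur's inequality, divided by \<open>2 A B C (A + B + C)\<close>.\<close>
lemma schur_quadratic_le:
  fixes A B C :: real
  assumes "A > 0" "B > 0" "C > 0"
  shows "(2 * (A * B + B * C + C * A) - (A * A + B * B + C * C)) / (2 * (A * B * C)) \<le> (9/2) / (A + B + C)"
proof -
  have "(2 * (A * B + B * C + C * A) - (A * A + B * B + C * C)) * (A + B + C) \<le> 9 * (A * B * C)"
    using schur_inequality[of A B C] assms by (simp add: algebra_simps)
  moreover have "A * B * C > 0" "A + B + C > 0" using assms by simp_all
  ultimately show ?thesis by (simp add: field_simps)
qed

text \<open>For \<open>\<epsilon> = 0\<close> the left-hand side is \<open>1 / (2 R\<^sup>2)\<close> with the circumradius \<open>R\<close> of the triangle \<open>p q r\<close>,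
  and the inequality says that the sum of the squared side lengths is at most \<open>9 R\<^sup>2\<close>. The form
  used here, with \<open>\<rho>\<close> in place of the squared distances, follows from Schur's inequality, which does
  not require \<open>\<rho>\<close> to come from a triangle.\<close>
lemma triangle_inner_sum_le:
  fixes p q r :: "'a::real_inner"
  assumes \<epsilon>: "\<epsilon> > 0"
  defines "\<rho> \<equiv> \<lambda>a b::'a. (a - b) \<bullet> (a - b) + \<epsilon>"
  shows "((p - q) \<bullet> (p - r)) / (\<rho> p q * \<rho> p r) + ((q - r) \<bullet> (q - p)) / (\<rho> q r * \<rho> q p)
      + ((r - p) \<bullet> (r - q)) / (\<rho> r p * \<rho> r q) \<le> (9/2) / (\<rho> p q + \<rho> q r + \<rho> r p)"
proof -
  define A B C where "A = \<rho> p q" and "B = \<rho> q r" and "C = \<rho> r p"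
  have pos: "A > 0" "B > 0" "C > 0" using \<epsilon> by (simp_all add: A_def B_def C_def \<rho>_def add_nonneg_pos)
  have sym: "\<rho> a b = \<rho> b a" for a b
    by (simp add: \<rho>_def inner_diff_left inner_diff_right inner_commute algebra_simps)
  have *: "((p - q) \<bullet> (p - r)) = (A + C - B - \<epsilon>) / 2" "((q - r) \<bullet> (q - p)) = (A + B - C - \<epsilon>) / 2"
      "((r - p) \<bullet> (r - q)) = (B + C - A - \<epsilon>) / 2"
    by (simp_all add: A_def B_def C_def \<rho>_def inner_diff_left inner_diff_right inner_commute algebra_simps)
  have "((p - q) \<bullet> (p - r)) / (\<rho> p q * \<rho> p r) + ((q - r) \<bullet> (q - p)) / (\<rho> q r * \<rho> q p) + ((r - p) \<bullet> (r - q)) / (\<rho> r p * \<rho> r q)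
     = (A + C - B - \<epsilon>) / 2 / (A * C) + (A + B - C - \<epsilon>) / 2 / (B * A) + (B + C - A - \<epsilon>) / 2 / (C * B)"
    unfolding * by (simp add: A_def B_def C_def sym[of p r] sym[of q p] sym[of r q])
  also have "\<dots> = ((A + C - B - \<epsilon>) * B + (A + B - C - \<epsilon>) * C + (B + C - A - \<epsilon>) * A) / (2 * (A * B * C))"
    using pos by (simp add: field_simps)
  also have "\<dots> \<le> (2 * (A * B + B * C + C * A) - (A * A + B * B + C * C)) / (2 * (A * B * C))"
  proof (rule divide_right_mono)
    have "0 \<le> \<epsilon> * (A + B + C)" using pos \<epsilon> by simp
    then show "(A + C - B - \<epsilon>) * B + (A + B - C - \<epsilon>) * C + (B + C - A - \<epsilon>) * A
      \<le> 2 * (A * B + B * C + C * A) - (A * A + B * B + C * C)" by (simp add: algebra_simps)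
  qed (use pos in simp)
  also have "\<dots> \<le> (9/2) / (A + B + C)" by (rule schur_quadratic_le[OF pos])
  finally show ?thesis by (simp add: A_def B_def C_def)
qed

text \<open>Sums over ordered triples of distinct indices.\<close>
definition triple_sum :: "('n::finite \<Rightarrow> 'n \<Rightarrow> 'n \<Rightarrow> real) \<Rightarrow> real" where
  "triple_sum h = (\<Sum>i\<in>UNIV. \<Sum>j\<in>-{i}. \<Sum>l\<in>-{i,j}. h i j l)"

lemma triple_sum_cyclic: "triple_sum h = triple_sum (\<lambda>i j l. h j l (i::'n::finite))"
proof -
  let ?D = "{(i, j, l). i \<noteq> j \<and> j \<noteq> l \<and> l \<noteq> (i::'n)}"
  have D: "triple_sum h = (\<Sum>(i,j,l)\<in>?D. h i j l)" for h :: "'n \<Rightarrow> 'n \<Rightarrow> 'n \<Rightarrow> real"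
    unfolding triple_sum_def
    by (simp add: sum.Sigma) (intro sum.cong, auto)
  show ?thesis
    unfolding D
    by (rule sum.reindex_bij_witness[where i="\<lambda>(i,j,l). (j,l,i)" and j="\<lambda>(i,j,l). (l,i,j)"]) auto
qed

lemma triple_sum_mono: "(\<And>i j l. i \<noteq> j \<Longrightarrow> j \<noteq> l \<Longrightarrow> l \<noteq> i \<Longrightarrow> h i j l \<le> h' i j l) \<Longrightarrow> triple_sum h \<le> triple_sum h'"
  unfolding triple_sum_def by (intro sum_mono) auto

lemma triple_sum_add: "triple_sum (\<lambda>i j l. h i j l + h' i j l) = triple_sum h + triple_sum h'"
  unfolding triple_sum_def by (simp add: sum.distrib)

lemma triple_sum_const: 
  assumes "CARD('n) \<ge> 2"
  shows "triple_sum (\<lambda>i j l. t (i::'n::finite)) = (real CARD('n) - 1) * (real CARD('n) - 2) * (\<Sum>i\<in>UNIV. t i)"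
proof -
  have "(\<Sum>j\<in>-{i}. \<Sum>l\<in>-{i,j}. t i) = (real CARD('n) - 1) * (real CARD('n) - 2) * t i" for i :: 'n
  proof -
    have "card (-{i,j}) = CARD('n) - 2" if "j \<in> -{i}" for j
      using that by (simp add: Compl_eq_Diff_UNIV card_Diff_subset)
    then have "(\<Sum>j\<in>-{i}. \<Sum>l\<in>-{i,j}. t i) = (\<Sum>j\<in>-{i}. real (CARD('n) - 2) * t i)"
      by (intro sum.cong) simp_all
    also have "\<dots> = real (CARD('n) - 1) * (real (CARD('n) - 2) * t i)"
      by (simp add: Compl_eq_Diff_UNIV card_Diff_subset)
    finally show ?thesis using assms by (simp add: of_nat_diff mult.assoc)
  qed
  then show ?thesis unfolding triple_sum_def by (simp add: sum_distrib_left)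
qed

lemma triple_sum_split:
  "(\<Sum>i\<in>UNIV. \<Sum>j\<in>-{i}. \<Sum>l\<in>-{i}. h i j l) = (\<Sum>i\<in>UNIV. \<Sum>j\<in>-{i}. h i j j) + triple_sum (h :: 'n::finite \<Rightarrow> _)"
proof -
  have "(\<Sum>l\<in>-{i}. h i j l) = h i j j + (\<Sum>l\<in>-{i,j}. h i j l)" if "j \<in> -{i}" for i j
  proof -
    have "-{i} - {j} = -{i,j}" by auto
    then show ?thesis using sum.remove[OF _ that, of "h i j"] by simp
  qed
  then show ?thesis unfolding triple_sum_def by (simp add: sum.distrib)
qed

text \<open>The regularised squared distance of two particles.\<close>
definition reg_dist2 :: "real \<Rightarrow> real ^ 'd ^ 'n \<Rightarrow> 'n \<Rightarrow> 'n \<Rightarrow> real" where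
  "reg_dist2 \<epsilon> x i j = (x $ i - x $ j) \<bullet> (x $ i - x $ j) + \<epsilon>"

lemma reg_dist2_ge: "reg_dist2 \<epsilon> x i j \<ge> \<epsilon>" by (simp add: reg_dist2_def)

lemma reg_dist2_pos: "\<epsilon> > 0 \<Longrightarrow> reg_dist2 \<epsilon> x i j > 0"
  using reg_dist2_ge[of \<epsilon> x i j] by linarith

lemma reg_dist2_commute: "reg_dist2 \<epsilon> x i j = reg_dist2 \<epsilon> x j i"
  by (simp add: reg_dist2_def inner_diff_left inner_diff_right inner_commute algebra_simps)

lemma continuous_reg_dist2: "continuous_on UNIV (\<lambda>x::real^'d^'n. reg_dist2 \<epsilon> x i j)"
  unfolding reg_dist2_def by (intro continuous_intros)

text \<open>Three times the sum of \<open>\<epsilon>\<close> and of the squared distances of three particles from their centre of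
  mass, written as the sum of the regularised squared side lengths of the triangle.\<close>
definition triple_dist2 :: "real \<Rightarrow> real ^ 'd ^ 'n \<Rightarrow> 'n \<Rightarrow> 'n \<Rightarrow> 'n \<Rightarrow> real" where
  "triple_dist2 \<epsilon> x i j l = reg_dist2 \<epsilon> x i j + reg_dist2 \<epsilon> x j l + reg_dist2 \<epsilon> x l i"

lemma triple_dist2_ge: "\<epsilon> > 0 \<Longrightarrow> triple_dist2 \<epsilon> x i j l \<ge> \<epsilon>"
  using reg_dist2_ge[of \<epsilon> x i j] reg_dist2_ge[of \<epsilon> x j l] reg_dist2_ge[of \<epsilon> x l i] unfolding triple_dist2_def by linarith

lemma bounded_borel_inverse:
  fixes f :: "'a::euclidean_space \<Rightarrow> real"
  assumes "continuous_on UNIV f" "\<epsilon> > 0" "\<And>x. f x \<ge> \<epsilon>"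
  shows "bounded_borel (\<lambda>x. 1 / f x)"
proof -
  have pos: "f x > 0" for x using assms(2) assms(3)[of x] by linarith
  then have "\<forall>x. f x \<noteq> 0" by (metis less_irrefl)
  then have "(\<lambda>x. 1 / f x) \<in> borel_measurable borel"
    by (intro borel_measurable_continuous_onI continuous_intros assms(1)) auto
  moreover have "\<bar>1 / f x\<bar> \<le> 1 / \<epsilon>" for x using pos[of x] assms(2) assms(3)[of x] by (simp add: frac_le)
  ultimately show ?thesis unfolding bounded_borel_def by blast
qed

lemma inner_sum_axis_square: "(\<Sum>k\<in>UNIV. (y \<bullet> axis k 1)\<^sup>2) = y \<bullet> (y :: real ^ 'd)"
proof -
  have "y \<bullet> axis k 1 = y $ k" for k by (simp add: inner_axis)
  then show ?thesis by (simp add: inner_vec_def power2_eq_square)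
qed

text \<open>The Hardy inequality in the relative coordinate of two particles. The constant is \<open>(d - 2)\<^sup>2\<close> and
  not \<open>(d - 2)\<^sup>2 / 4\<close>, because the difference of the two gradients moves \<open>x\<^sub>i - x\<^sub>j\<close> at twice the unit speed.\<close>
lemma pair_hardy:
  fixes u :: "real ^ 'd ^ 'n \<Rightarrow> complex"
  assumes u: "u \<in> L2" and g: "\<And>i k. g i k \<in> L2" "\<And>i k. has_weak_partial u (axis i (axis k 1)) (g i k)"
    and \<epsilon>: "\<epsilon> > 0" and ij: "i \<noteq> j" and d: "real CARD('d) \<ge> 2"
  shows "(real CARD('d) - 2)\<^sup>2 * (LINT x|lborel. 1 / reg_dist2 \<epsilon> x i j * (cmod (u x))\<^sup>2)
    \<le> (\<Sum>k\<in>UNIV. LINT x|lborel. (cmod (g i k x - g j k x))\<^sup>2)"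
proof -
  define s where "s = real CARD('d) - 2"
  have s: "s \<ge> 0" using d by (simp add: s_def)
  define P where "P x = x $ i - x $ j" for x :: "real ^ 'd ^ 'n"
  define b where "b k = (axis i (axis k 1) - axis j (axis k 1) :: real ^ 'd ^ 'n)" for k
  define w where "w k x = (P x \<bullet> axis k 1) / (P x \<bullet> P x + \<epsilon>)" for k x
  define w' where "w' k x = 2 * ((axis k 1 \<bullet> (axis k 1 :: real ^ 'd)) / (P x \<bullet> P x + \<epsilon>) - 2 * ((P x \<bullet> axis k 1) / (P x \<bullet> P x + \<epsilon>))\<^sup>2)" for k x
  have P: "linear P" unfolding P_def by (intro linearI) (simp_all add: algebra_simps)
  have Pb: "P (b k) = 2 *\<^sub>R axis k 1" for k
    using ij by (simp add: P_def b_def axis_def vec_eq_iff)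
  have "(LINT x|lborel. s\<^sup>2 * (1 / reg_dist2 \<epsilon> x i j) * (cmod (u x))\<^sup>2) \<le> (\<Sum>k\<in>UNIV. LINT x|lborel. (cmod (g i k x - g j k x))\<^sup>2)"
  proof (rule sum_directional_hardy[OF u, where b=b and v="\<lambda>k x. s * w k x" and v'="\<lambda>k x. s * w' k x"])
    note iw = bounded_borel_inverse[OF continuous_reg_dist2[of \<epsilon> i j] \<epsilon> reg_dist2_ge]
    show "bounded_borel (\<lambda>x::real^'d^'n. s\<^sup>2 * (1 / reg_dist2 \<epsilon> x i j))"
      by (intro bounded_borel_cmult iw)
    show "(\<lambda>x. g i k x - g j k x) \<in> L2" for k by (intro L2_diff g)
    show "has_weak_partial u (b k) (\<lambda>x. g i k x - g j k x)" for k
      unfolding b_def by (intro has_weak_partial_diff u g) (auto simp: axis_in_Basis_iff)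
    show "C1_weight (b k) (\<lambda>x. s * w k x) (\<lambda>x. s * w' k x)" for k
      unfolding w_def w'_def by (intro C1_weight_scale C1_weight_regularised[OF P Pb \<epsilon>])
    fix x :: "real ^ 'd ^ 'n"
    define Y where "Y = P x \<bullet> P x"
    define \<rho> where "\<rho> = Y + \<epsilon>"
    have Y: "0 \<le> Y" "Y \<le> \<rho>" "\<rho> > 0" using \<epsilon> by (simp_all add: Y_def \<rho>_def add_nonneg_pos)
    have sq: "(\<Sum>k\<in>UNIV. ((P x \<bullet> axis k 1) / \<rho>)\<^sup>2) = Y / \<rho>\<^sup>2"
      by (simp add: power_divide sum_divide_distrib[symmetric] inner_sum_axis_square Y_def)
    have le: "Y / \<rho>\<^sup>2 \<le> 1 / \<rho>" using Y by (simp add: power2_eq_square field_simps)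
    have "(\<Sum>k\<in>UNIV. s * w' k x - (s * w k x)\<^sup>2)
        = (\<Sum>k\<in>UNIV. s * 2 * (1 / \<rho>) - (4 * s + s\<^sup>2) * ((P x \<bullet> axis k 1) / \<rho>)\<^sup>2)"
      unfolding w_def w'_def Y_def[symmetric] \<rho>_def[symmetric]
      by (intro sum.cong) (simp_all add: inner_axis_axis power_mult_distrib power_divide add_divide_distrib algebra_simps)
    also have "\<dots> = real CARD('d) * (s * 2 * (1 / \<rho>)) - (4 * s + s\<^sup>2) * (Y / \<rho>\<^sup>2)"
      by (simp add: sum_subtractf sum_distrib_left[symmetric] sq)
    also have "\<dots> \<ge> real CARD('d) * (s * 2 * (1 / \<rho>)) - (4 * s + s\<^sup>2) * (1 / \<rho>)"
      using mult_left_mono[OF le, of "4 * s + s\<^sup>2"] s by simp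
    moreover have "real CARD('d) * (s * 2 * (1 / \<rho>)) - (4 * s + s\<^sup>2) * (1 / \<rho>) = s\<^sup>2 * (1 / \<rho>)"
    proof -
      have n: "real CARD('d) = s + 2" by (simp add: s_def)
      show ?thesis unfolding n by (simp add: algebra_simps power2_eq_square add_divide_distrib)
    qed
    moreover have "reg_dist2 \<epsilon> x i j = \<rho>" by (simp add: reg_dist2_def \<rho>_def Y_def P_def)
    ultimately show "s\<^sup>2 * (1 / reg_dist2 \<epsilon> x i j) \<le> (\<Sum>k\<in>UNIV. s * w' k x - (s * w k x)\<^sup>2)" by simp
  qed
  then show ?thesis by (simp only: s_def[symmetric] mult.assoc integral_mult_right_zero)
qed

text \<open>The Hardy inequality for three particles relative to their centre of mass \<open>c\<close>. The weights are the
  components of \<open>(d - 1) (x\<^sub>m - c) / (|x\<^sub>i - c|\<^sup>2 + |x\<^sub>j - c|\<^sup>2 + |x\<^sub>l - c|\<^sup>2 + \<epsilon>)\<close>, expressed through the three differences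
  of positions, which are the components of \<open>P x\<close>.\<close>
lemma triple_hardy:
  fixes u :: "real ^ 'd ^ 'n \<Rightarrow> complex"
  assumes u: "u \<in> L2" and g: "\<And>i k. g i k \<in> L2" "\<And>i k. has_weak_partial u (axis i (axis k 1)) (g i k)"
    and \<epsilon>: "\<epsilon> > 0" and dist: "i \<noteq> j" "j \<noteq> l" "l \<noteq> i" and d: "real CARD('d) \<ge> 1"
  defines "t \<equiv> \<lambda>i. \<Sum>k\<in>UNIV. LINT x|lborel. (cmod (g i k x))\<^sup>2"
  shows "3 * (real CARD('d) - 1)\<^sup>2 * (LINT x|lborel. 1 / triple_dist2 \<epsilon> x i j l * (cmod (u x))\<^sup>2)
    \<le> t i + t j + t l"
proof -
  define s where "s = real CARD('d) - 1"
  have s: "s \<ge> 0" using d by (simp add: s_def)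
  define P where "P x = (x $ i - x $ j, x $ j - x $ l, x $ l - x $ i)" for x :: "real ^ 'd ^ 'n"
  define K where "K = {i, j, l} \<times> (UNIV :: 'd set)"
  define b where "b \<kappa> = (axis (fst \<kappa>) (axis (snd \<kappa>) 1) :: real ^ 'd ^ 'n)" for \<kappa> :: "'n \<times> 'd"
  define w where "w \<kappa> x = (P x \<bullet> P (b \<kappa>)) / (P x \<bullet> P x + 3 * \<epsilon>)" for \<kappa> x
  define w' where "w' \<kappa> x = 1 * ((P (b \<kappa>) \<bullet> P (b \<kappa>)) / (P x \<bullet> P x + 3 * \<epsilon>) - 2 * ((P x \<bullet> P (b \<kappa>)) / (P x \<bullet> P x + 3 * \<epsilon>))\<^sup>2)" for \<kappa> x
  have P: "linear P" unfolding P_def by (intro linearI) (simp_all add: algebra_simps)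
  have Pbi: "P (b (i, k)) = (axis k 1, 0, - axis k 1)" and Pbj: "P (b (j, k)) = (- axis k 1, axis k 1, 0)"
    and Pbl: "P (b (l, k)) = (0, - axis k 1, axis k 1)" for k
    using dist by (auto simp: P_def b_def axis_def vec_eq_iff)
  have K: "(\<Sum>\<kappa>\<in>K. f \<kappa>) = (\<Sum>k\<in>UNIV. f (i, k)) + (\<Sum>k\<in>UNIV. f (j, k)) + (\<Sum>k\<in>UNIV. f (l, k))" for f :: "_ \<Rightarrow> real"
  proof -
    have "(\<Sum>\<kappa>\<in>K. f \<kappa>) = (\<Sum>m\<in>{i, j, l}. \<Sum>k\<in>UNIV. f (m, k))"
      unfolding K_def by (subst sum.cartesian_product) simp
    then show ?thesis using dist by (simp add: add.assoc)
  qed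
  have cont: "continuous_on UNIV (\<lambda>x::real^'d^'n. triple_dist2 \<epsilon> x i j l)"
    unfolding triple_dist2_def by (intro continuous_intros continuous_reg_dist2)
  have "(LINT x|lborel. 3 * s\<^sup>2 * (1 / triple_dist2 \<epsilon> x i j l) * (cmod (u x))\<^sup>2)
      \<le> (\<Sum>\<kappa>\<in>K. LINT x|lborel. (cmod (g (fst \<kappa>) (snd \<kappa>) x))\<^sup>2)"
  proof (rule sum_directional_hardy[OF u, where b=b and v="\<lambda>\<kappa> x. s * w \<kappa> x" and v'="\<lambda>\<kappa> x. s * w' \<kappa> x"])
    note iw = bounded_borel_inverse[OF cont \<epsilon> triple_dist2_ge[OF \<epsilon>]]
    show "bounded_borel (\<lambda>x::real^'d^'n. 3 * s\<^sup>2 * (1 / triple_dist2 \<epsilon> x i j l))"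
      by (intro bounded_borel_cmult iw)
    show "g (fst \<kappa>) (snd \<kappa>) \<in> L2" "has_weak_partial u (b \<kappa>) (g (fst \<kappa>) (snd \<kappa>))" for \<kappa>
      unfolding b_def by (rule g)+
    show "C1_weight (b \<kappa>) (\<lambda>x. s * w \<kappa> x) (\<lambda>x. s * w' \<kappa> x)" for \<kappa>
      unfolding w_def w'_def using \<epsilon> by (intro C1_weight_scale C1_weight_regularised[OF P]) auto
    fix x :: "real ^ 'd ^ 'n"
    define Y where "Y = P x \<bullet> P x"
    define \<rho> where "\<rho> = Y + 3 * \<epsilon>"
    have Y: "0 \<le> Y" "Y \<le> \<rho>" "\<rho> > 0" using \<epsilon> by (simp_all add: Y_def \<rho>_def add_nonneg_pos)
    have e2: "P (b \<kappa>) \<bullet> P (b \<kappa>) = 2" if "\<kappa> \<in> K" for \<kappa>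
      using that by (auto simp: K_def Pbi Pbj Pbl inner_axis_axis)
    \<comment> \<open>The three components of \<open>P x\<close> add up to zero, so that two of them determine the third.\<close>
    have sq: "(\<Sum>\<kappa>\<in>K. (P x \<bullet> P (b \<kappa>))\<^sup>2) = 3 * Y"
    proof -
      define y z where "y = x $ i - x $ j" and "z = x $ j - x $ l"
      have w: "x $ l - x $ i = - y - z" by (simp add: y_def z_def)
      have Px: "P x = (y, z, - y - z)" by (simp add: P_def w) (simp add: y_def z_def)
      have "(\<Sum>\<kappa>\<in>K. (P x \<bullet> P (b \<kappa>))\<^sup>2) =
        (\<Sum>k\<in>UNIV. (2 * (y $ k) + z $ k)\<^sup>2 + (z $ k - y $ k)\<^sup>2 + (- (y $ k) - 2 * z $ k)\<^sup>2)"
        unfolding K Pbi Pbj Pbl Px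
        by (simp add: inner_axis sum.distrib algebra_simps)
      also have "\<dots> = 3 * (\<Sum>k\<in>UNIV. (y $ k)\<^sup>2 + (z $ k)\<^sup>2 + (- (y $ k) - z $ k)\<^sup>2)"
        unfolding sum_distrib_left by (intro sum.cong) (simp_all add: power2_eq_square algebra_simps)
      also have "(\<Sum>k\<in>UNIV. (y $ k)\<^sup>2 + (z $ k)\<^sup>2 + (- (y $ k) - z $ k)\<^sup>2) = Y"
        unfolding Y_def Px by (simp add: inner_vec_def sum.distrib power2_eq_square)
      finally show ?thesis .
    qed
    have sq': "(\<Sum>\<kappa>\<in>K. ((P x \<bullet> P (b \<kappa>)) / \<rho>)\<^sup>2) = 3 * (Y / \<rho>\<^sup>2)"
      by (simp add: power_divide sum_divide_distrib[symmetric] sq)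
    have le: "Y / \<rho>\<^sup>2 \<le> 1 / \<rho>" using Y by (simp add: power2_eq_square field_simps)
    have cardK: "real (card K) = 3 * real CARD('d)" using dist by (simp add: K_def card_cartesian_product)
    have "(\<Sum>\<kappa>\<in>K. s * w' \<kappa> x - (s * w \<kappa> x)\<^sup>2)
        = (\<Sum>\<kappa>\<in>K. s * 2 * (1 / \<rho>) - (2 * s + s\<^sup>2) * ((P x \<bullet> P (b \<kappa>)) / \<rho>)\<^sup>2)"
      unfolding w_def w'_def Y_def[symmetric] \<rho>_def[symmetric]
      by (intro sum.cong) (simp_all add: e2 power_mult_distrib power_divide add_divide_distrib algebra_simps)
    also have "\<dots> = 3 * real CARD('d) * (s * 2 * (1 / \<rho>)) - (2 * s + s\<^sup>2) * (3 * (Y / \<rho>\<^sup>2))"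
      by (simp add: sum_subtractf sum_distrib_left[symmetric] sq' cardK)
    also have "\<dots> \<ge> 3 * real CARD('d) * (s * 2 * (1 / \<rho>)) - (2 * s + s\<^sup>2) * (3 * (1 / \<rho>))"
      using mult_left_mono[OF le, of "3 * (2 * s + s\<^sup>2)"] s by (simp add: mult_ac)
    moreover have "3 * real CARD('d) * (s * 2 * (1 / \<rho>)) - (2 * s + s\<^sup>2) * (3 * (1 / \<rho>)) = 3 * s\<^sup>2 * (1 / \<rho>)"
    proof -
      have n: "real CARD('d) = s + 1" by (simp add: s_def)
      show ?thesis unfolding n by (simp add: algebra_simps power2_eq_square add_divide_distrib)
    qed
    moreover have "triple_dist2 \<epsilon> x i j l = \<rho>"
      by (simp add: triple_dist2_def reg_dist2_def \<rho>_def Y_def P_def)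
    ultimately show "3 * s\<^sup>2 * (1 / triple_dist2 \<epsilon> x i j l) \<le> (\<Sum>\<kappa>\<in>K. s * w' \<kappa> x - (s * w \<kappa> x)\<^sup>2)" by simp
  qed
  then show ?thesis unfolding K t_def by (simp only: fst_conv snd_conv s_def[symmetric] mult.assoc integral_mult_right_zero)
qed

section \<open>Summation over all particles\<close>

text \<open>The regularised sum of \<open>1 / r\<^sub>i\<^sub>j\<^sup>2\<close> over ordered pairs, which counts each pair of particles twice.\<close>
definition pair_weight :: "real \<Rightarrow> real ^ 'd ^ 'n \<Rightarrow> real" where
  "pair_weight \<epsilon> x = (\<Sum>i\<in>UNIV. \<Sum>j\<in>-{i}. 1 / reg_dist2 \<epsilon> x i j)"

text \<open>The regularised sum of \<open>1 / (r\<^sub>i\<^sub>j\<^sup>2 + r\<^sub>j\<^sub>l\<^sup>2 + r\<^sub>l\<^sub>i\<^sup>2)\<close> over ordered triples, which counts each triple of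
  particles six times.\<close>
definition triple_weight :: "real \<Rightarrow> real ^ 'd ^ 'n \<Rightarrow> real" where
  "triple_weight \<epsilon> x = triple_sum (\<lambda>i j l. 1 / triple_dist2 \<epsilon> x i j l)"

lemma bounded_borel_inverse_reg_dist2:
  "\<epsilon> > 0 \<Longrightarrow> bounded_borel (\<lambda>x::real^'d^'n. 1 / reg_dist2 \<epsilon> x i j)"
  by (rule bounded_borel_inverse[OF continuous_reg_dist2 _ reg_dist2_ge])

lemma bounded_borel_inverse_triple_dist2:
  assumes "\<epsilon> > 0" shows "bounded_borel (\<lambda>x::real^'d^'n. 1 / triple_dist2 \<epsilon> x i j l)"
proof (rule bounded_borel_inverse[OF _ assms triple_dist2_ge[OF assms]])
  show "continuous_on UNIV (\<lambda>x::real^'d^'n. triple_dist2 \<epsilon> x i j l)"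
    unfolding triple_dist2_def by (intro continuous_intros continuous_reg_dist2)
qed

lemma bounded_borel_pair_weight: "\<epsilon> > 0 \<Longrightarrow> bounded_borel (pair_weight \<epsilon>)"
  unfolding pair_weight_def[abs_def] by (intro bounded_borel_sum bounded_borel_inverse_reg_dist2)

lemma bounded_borel_triple_weight: "\<epsilon> > 0 \<Longrightarrow> bounded_borel (triple_weight \<epsilon>)"
  unfolding triple_weight_def[abs_def] triple_sum_def
  by (intro bounded_borel_sum bounded_borel_inverse_triple_dist2)

text \<open>The inequality for the vector field \<open>\<alpha> F\<close> with \<open>F\<^sub>i = \<Sum>\<^sub>j (x\<^sub>i - x\<^sub>j) / \<rho>\<^sub>i\<^sub>j\<close>. In the proof, \<open>div\<close> estimates the
  divergence of \<open>F\<close> and \<open>norm\<close> the square of its length.\<close>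
lemma all_pairs_hardy:
  fixes u :: "real ^ 'd ^ 'n \<Rightarrow> complex" and \<alpha> :: real
  assumes u: "u \<in> L2" and g: "\<And>i k. g i k \<in> L2" "\<And>i k. has_weak_partial u (axis i (axis k 1)) (g i k)"
    and \<epsilon>: "\<epsilon> > 0" and \<alpha>: "\<alpha> \<ge> 0"
  shows "(\<alpha> * (real CARD('d) - 2) - \<alpha>\<^sup>2) * (LINT x|lborel. pair_weight \<epsilon> x * (cmod (u x))\<^sup>2)
      - (3/2) * \<alpha>\<^sup>2 * (LINT x|lborel. triple_weight \<epsilon> x * (cmod (u x))\<^sup>2)
    \<le> (\<Sum>i\<in>UNIV. \<Sum>k\<in>UNIV. LINT x|lborel. (cmod (g i k x))\<^sup>2)"
proof -
  define c1 c2 where "c1 = \<alpha> * (real CARD('d) - 2) - \<alpha>\<^sup>2" and "c2 = - ((3/2) * \<alpha>\<^sup>2)"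
  define b where "b \<kappa> = (axis (fst \<kappa>) (axis (snd \<kappa>) 1) :: real ^ 'd ^ 'n)" for \<kappa> :: "'n \<times> 'd"
  define w where "w j \<kappa> x = ((x $ fst \<kappa> - x $ j) \<bullet> axis (snd \<kappa>) 1) / reg_dist2 \<epsilon> x (fst \<kappa>) j"
    for j and \<kappa> :: "'n \<times> 'd" and x :: "real ^ 'd ^ 'n"
  define w' where "w' j \<kappa> x = 1 / reg_dist2 \<epsilon> x (fst \<kappa>) j - 2 * (w j \<kappa> x)\<^sup>2" for j \<kappa> x
  have w: "C1_weight (b \<kappa>) (w j \<kappa>) (w' j \<kappa>)" if "j \<in> - {fst \<kappa>}" for j \<kappa>
  proof -
    have P: "linear (\<lambda>x::real^'d^'n. x $ fst \<kappa> - x $ j)" by (intro linearI) (simp_all add: algebra_simps)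
    have Pb: "b \<kappa> $ fst \<kappa> - b \<kappa> $ j = 1 *\<^sub>R axis (snd \<kappa>) 1" using that by (simp add: b_def axis_def vec_eq_iff)
    show ?thesis
      using C1_weight_regularised[OF P Pb \<epsilon>]
      unfolding w_def[abs_def] w'_def[abs_def] reg_dist2_def by (simp add: inner_axis_axis)
  qed
  have "(LINT x|lborel. (c1 * pair_weight \<epsilon> x + c2 * triple_weight \<epsilon> x) * (cmod (u x))\<^sup>2)
      \<le> (\<Sum>\<kappa>\<in>UNIV. LINT x|lborel. (cmod (g (fst \<kappa>) (snd \<kappa>) x))\<^sup>2)"
  proof (rule sum_directional_hardy[OF u, where b=b and v="\<lambda>\<kappa> x. \<alpha> * (\<Sum>j\<in>-{fst \<kappa>}. w j \<kappa> x)"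
        and v'="\<lambda>\<kappa> x. \<alpha> * (\<Sum>j\<in>-{fst \<kappa>}. w' j \<kappa> x)"])
    show "bounded_borel (\<lambda>x::real^'d^'n. c1 * pair_weight \<epsilon> x + c2 * triple_weight \<epsilon> x)"
      by (intro bounded_borel_add bounded_borel_cmult bounded_borel_pair_weight bounded_borel_triple_weight \<epsilon>)
    show "g (fst \<kappa>) (snd \<kappa>) \<in> L2" "has_weak_partial u (b \<kappa>) (g (fst \<kappa>) (snd \<kappa>))" for \<kappa>
      unfolding b_def by (rule g)+
    show "C1_weight (b \<kappa>) (\<lambda>x. \<alpha> * (\<Sum>j\<in>-{fst \<kappa>}. w j \<kappa> x)) (\<lambda>x. \<alpha> * (\<Sum>j\<in>-{fst \<kappa>}. w' j \<kappa> x))" for \<kappa>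
      by (intro C1_weight_scale C1_weight_sum w)
    fix x :: "real ^ 'd ^ 'n"
    define \<rho> where "\<rho> = reg_dist2 \<epsilon> x"
    define y where "y i j = x $ i - x $ j" for i j
    have \<rho>: "\<rho> i j > 0" for i j unfolding \<rho>_def by (rule reg_dist2_pos[OF \<epsilon>])
    have y\<rho>: "y i j \<bullet> y i j \<le> \<rho> i j" for i j using \<epsilon> by (simp add: \<rho>_def y_def reg_dist2_def)
    have wk: "w j (i, k) x = y i j $ k / \<rho> i j" for i j k
      by (simp add: w_def y_def \<rho>_def inner_axis)
    have sq: "(\<Sum>k\<in>UNIV. (y i j $ k / \<rho> i j)\<^sup>2) \<le> 1 / \<rho> i j" for i j
    proof -
      have "(\<Sum>k\<in>UNIV. (y i j $ k / \<rho> i j)\<^sup>2) = (y i j \<bullet> y i j) / (\<rho> i j)\<^sup>2"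
        by (simp add: power_divide sum_divide_distrib[symmetric] inner_vec_def power2_eq_square)
      also have "\<dots> \<le> \<rho> i j / (\<rho> i j)\<^sup>2" by (intro divide_right_mono y\<rho>) simp
      also have "\<dots> = 1 / \<rho> i j" using \<rho>[of i j] by (simp add: power2_eq_square)
      finally show ?thesis .
    qed
    have div: "(real CARD('d) - 2) * pair_weight \<epsilon> x \<le> (\<Sum>i\<in>UNIV. \<Sum>k\<in>UNIV. \<Sum>j\<in>-{i}. w' j (i, k) x)"
    proof -
      have "(real CARD('d) - 2) * (1 / \<rho> i j) \<le> (\<Sum>k\<in>UNIV. w' j (i, k) x)" for i j
      proof -
        have "(\<Sum>k\<in>UNIV. w' j (i, k) x) = real CARD('d) * (1 / \<rho> i j) - 2 * (\<Sum>k\<in>UNIV. (y i j $ k / \<rho> i j)\<^sup>2)"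
          unfolding w'_def wk by (simp add: sum_subtractf sum_distrib_left[symmetric] \<rho>_def)
        then show ?thesis using sq[of i j] unfolding left_diff_distrib by linarith
      qed
      then have "(\<Sum>i\<in>UNIV. \<Sum>j\<in>-{i}. (real CARD('d) - 2) * (1 / \<rho> i j)) \<le> (\<Sum>i\<in>UNIV. \<Sum>j\<in>-{i}. \<Sum>k\<in>UNIV. w' j (i, k) x)"
        by (intro sum_mono)
      also have "\<dots> = (\<Sum>i\<in>UNIV. \<Sum>k\<in>UNIV. \<Sum>j\<in>-{i}. w' j (i, k) x)"
        by (intro sum.cong refl sum.swap)
      finally show ?thesis unfolding pair_weight_def sum_distrib_left \<rho>_def .
    qed
    have norm: "(\<Sum>i\<in>UNIV. \<Sum>k\<in>UNIV. (\<Sum>j\<in>-{i}. w j (i, k) x)\<^sup>2) \<le> pair_weight \<epsilon> x + (3/2) * triple_weight \<epsilon> x"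
    proof -
      define h where "h i j l = (y i j \<bullet> y i l) / (\<rho> i j * \<rho> i l)" for i j l
      have "(\<Sum>k\<in>UNIV. (\<Sum>j\<in>-{i}. w j (i, k) x)\<^sup>2) = (\<Sum>j\<in>-{i}. \<Sum>l\<in>-{i}. h i j l)" for i
      proof -
        have "(\<Sum>k\<in>UNIV. (\<Sum>j\<in>-{i}. w j (i, k) x)\<^sup>2) =
            (\<Sum>k\<in>UNIV. \<Sum>j\<in>-{i}. \<Sum>l\<in>-{i}. (y i j $ k / \<rho> i j) * (y i l $ k / \<rho> i l))"
          unfolding wk power2_eq_square sum_product ..
        also have "\<dots> = (\<Sum>j\<in>-{i}. \<Sum>k\<in>UNIV. \<Sum>l\<in>-{i}. (y i j $ k / \<rho> i j) * (y i l $ k / \<rho> i l))"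
          by (rule sum.swap)
        also have "\<dots> = (\<Sum>j\<in>-{i}. \<Sum>l\<in>-{i}. \<Sum>k\<in>UNIV. (y i j $ k / \<rho> i j) * (y i l $ k / \<rho> i l))"
          by (intro sum.cong refl sum.swap)
        also have "\<dots> = (\<Sum>j\<in>-{i}. \<Sum>l\<in>-{i}. h i j l)"
          unfolding h_def inner_vec_def by (simp add: sum_divide_distrib)
        finally show ?thesis .
      qed
      then have "(\<Sum>i\<in>UNIV. \<Sum>k\<in>UNIV. (\<Sum>j\<in>-{i}. w j (i, k) x)\<^sup>2) = (\<Sum>i\<in>UNIV. \<Sum>j\<in>-{i}. h i j j) + triple_sum h"
        by (simp only: triple_sum_split)
      moreover have "(\<Sum>i\<in>UNIV. \<Sum>j\<in>-{i}. h i j j) \<le> pair_weight \<epsilon> x"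
        unfolding pair_weight_def \<rho>_def[symmetric]
      proof (intro sum_mono)
        fix i j
        have "h i j j \<le> \<rho> i j / (\<rho> i j * \<rho> i j)"
          unfolding h_def using \<rho>[of i j] by (intro divide_right_mono y\<rho>) simp
        also have "\<dots> = 1 / \<rho> i j" using \<rho>[of i j] by simp
        finally show "h i j j \<le> 1 / \<rho> i j" .
      qed
      moreover have "3 * triple_sum h \<le> (9/2) * triple_weight \<epsilon> x"
      proof -
        \<comment> \<open>Summing over the cyclic permutations collects the three angles of each triangle.\<close>
        have "3 * triple_sum h = triple_sum h + triple_sum (\<lambda>i j l. h j l i) + triple_sum (\<lambda>i j l. h l i j)"
          using triple_sum_cyclic[of h] triple_sum_cyclic[of "\<lambda>i j l. h j l i"] by simp
        also have "\<dots> = triple_sum (\<lambda>i j l. h i j l + h j l i + h l i j)"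
          by (simp add: triple_sum_add)
        also have "\<dots> \<le> triple_sum (\<lambda>i j l. (9/2) / triple_dist2 \<epsilon> x i j l)"
          unfolding h_def y_def \<rho>_def triple_dist2_def reg_dist2_def
          by (intro triple_sum_mono triangle_inner_sum_le \<epsilon>)
        also have "\<dots> = (9/2) * triple_weight \<epsilon> x"
          unfolding triple_weight_def triple_sum_def sum_distrib_left by simp
        finally show ?thesis .
      qed
      ultimately show ?thesis by simp
    qed
    have "(\<Sum>\<kappa>\<in>UNIV. \<alpha> * (\<Sum>j\<in>-{fst \<kappa>}. w' j \<kappa> x) - (\<alpha> * (\<Sum>j\<in>-{fst \<kappa>}. w j \<kappa> x))\<^sup>2)
       = (\<Sum>i\<in>UNIV. \<Sum>k\<in>UNIV. \<alpha> * (\<Sum>j\<in>-{i}. w' j (i, k) x) - \<alpha>\<^sup>2 * (\<Sum>j\<in>-{i}. w j (i, k) x)\<^sup>2)"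
      unfolding UNIV_Times_UNIV[symmetric] sum.cartesian_product by (simp add: case_prod_unfold power_mult_distrib)
    also have "\<dots> = \<alpha> * (\<Sum>i\<in>UNIV. \<Sum>k\<in>UNIV. \<Sum>j\<in>-{i}. w' j (i, k) x)
        - \<alpha>\<^sup>2 * (\<Sum>i\<in>UNIV. \<Sum>k\<in>UNIV. (\<Sum>j\<in>-{i}. w j (i, k) x)\<^sup>2)"
      by (simp only: sum_subtractf sum_distrib_left[symmetric])
    also have "\<dots> \<ge> \<alpha> * ((real CARD('d) - 2) * pair_weight \<epsilon> x) - \<alpha>\<^sup>2 * (pair_weight \<epsilon> x + (3/2) * triple_weight \<epsilon> x)"
      by (intro diff_mono mult_left_mono div norm \<alpha>) simp
    finally show "c1 * pair_weight \<epsilon> x + c2 * triple_weight \<epsilon> x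
       \<le> (\<Sum>\<kappa>\<in>UNIV. \<alpha> * (\<Sum>j\<in>-{fst \<kappa>}. w' j \<kappa> x) - (\<alpha> * (\<Sum>j\<in>-{fst \<kappa>}. w j \<kappa> x))\<^sup>2)"
      by (simp add: c1_def c2_def algebra_simps)
  qed
  moreover have "(LINT x|lborel. (c1 * pair_weight \<epsilon> x + c2 * triple_weight \<epsilon> x) * (cmod (u x))\<^sup>2)
     = c1 * (LINT x|lborel. pair_weight \<epsilon> x * (cmod (u x))\<^sup>2) + c2 * (LINT x|lborel. triple_weight \<epsilon> x * (cmod (u x))\<^sup>2)"
    using bounded_borel_L2_integrable[OF u bounded_borel_pair_weight[OF \<epsilon>]] bounded_borel_L2_integrable[OF u bounded_borel_triple_weight[OF \<epsilon>]]
    by (simp add: distrib_right mult.assoc)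
  moreover have "(\<Sum>\<kappa>\<in>UNIV. LINT x|lborel. (cmod (g (fst \<kappa>) (snd \<kappa>) x))\<^sup>2) = (\<Sum>i\<in>UNIV. \<Sum>k\<in>UNIV. LINT x|lborel. (cmod (g i k x))\<^sup>2)"
    unfolding UNIV_Times_UNIV[symmetric] sum.cartesian_product by (simp add: case_prod_unfold)
  ultimately show ?thesis by (simp add: c1_def c2_def)
qed

text \<open>Each particle belongs to \<open>(N - 1) (N - 2)\<close> ordered triples at each of the three places.\<close>
lemma triple_weight_hardy:
  fixes u :: "real ^ 'd ^ 'n \<Rightarrow> complex"
  assumes u: "u \<in> L2" and g: "\<And>i k. g i k \<in> L2" "\<And>i k. has_weak_partial u (axis i (axis k 1)) (g i k)"
    and \<epsilon>: "\<epsilon> > 0" and d: "real CARD('d) \<ge> 1" and N: "CARD('n) \<ge> 2"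
  shows "(real CARD('d) - 1)\<^sup>2 * (LINT x|lborel. triple_weight \<epsilon> x * (cmod (u x))\<^sup>2)
    \<le> (real CARD('n) - 1) * (real CARD('n) - 2) * (\<Sum>i\<in>UNIV. \<Sum>k\<in>UNIV. LINT x|lborel. (cmod (g i k x))\<^sup>2)"
proof -
  define t where "t i = (\<Sum>k\<in>UNIV. LINT x|lborel. (cmod (g i k x))\<^sup>2)" for i
  have int: "integrable lborel (\<lambda>x. 1 / triple_dist2 \<epsilon> x i j l * (cmod (u x))\<^sup>2)" for i j l
    by (intro bounded_borel_L2_integrable[OF u] bounded_borel_inverse_triple_dist2 \<epsilon>)
  have "3 * ((real CARD('d) - 1)\<^sup>2 * (LINT x|lborel. triple_weight \<epsilon> x * (cmod (u x))\<^sup>2))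
      = triple_sum (\<lambda>i j l. 3 * (real CARD('d) - 1)\<^sup>2 * (LINT x|lborel. 1 / triple_dist2 \<epsilon> x i j l * (cmod (u x))\<^sup>2))"
    unfolding triple_weight_def triple_sum_def sum_distrib_right
    using int by (simp add: sum_distrib_left mult.assoc)
  also have "\<dots> \<le> triple_sum (\<lambda>i j l. t i + t j + t l)"
    unfolding t_def by (intro triple_sum_mono triple_hardy[OF u g \<epsilon>] d)
  also have "\<dots> = triple_sum (\<lambda>i j l. t i) + triple_sum (\<lambda>i j l. t j) + triple_sum (\<lambda>i j l. t l)"
    by (simp add: triple_sum_add)
  also have "\<dots> = 3 * triple_sum (\<lambda>i j l. t i)"
    using triple_sum_cyclic[of "\<lambda>i j l. t i"] triple_sum_cyclic[of "\<lambda>i j l. t j"] by simp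
  also have "\<dots> = 3 * ((real CARD('n) - 1) * (real CARD('n) - 2) * (\<Sum>i\<in>UNIV. t i))"
    by (simp only: triple_sum_const[OF N])
  finally show ?thesis by (simp add: t_def)
qed

lemma sum_norm_diff_le:
  fixes a :: "'n::finite \<Rightarrow> 'b::real_inner"
  shows "(\<Sum>i\<in>UNIV. \<Sum>j\<in>UNIV. (norm (a i - a j))\<^sup>2) \<le> 2 * real CARD('n) * (\<Sum>i\<in>UNIV. (norm (a i))\<^sup>2)"
proof -
  define s where "s = (\<Sum>i\<in>UNIV. a i)"
  have ss: "(\<Sum>i\<in>UNIV. \<Sum>j\<in>UNIV. a i \<bullet> a j) = s \<bullet> s"
    unfolding s_def inner_sum_right inner_sum_left by (rule sum.swap)
  have "(\<Sum>i\<in>UNIV. \<Sum>j\<in>UNIV. (norm (a i - a j))\<^sup>2) =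
     (\<Sum>i\<in>UNIV. \<Sum>j\<in>UNIV. (norm (a i))\<^sup>2 + (norm (a j))\<^sup>2 - 2 * (a i \<bullet> a j))"
    by (intro sum.cong refl) (simp add: power2_norm_eq_inner inner_diff_left inner_diff_right inner_commute)
  also have "\<dots> = 2 * real CARD('n) * (\<Sum>i\<in>UNIV. (norm (a i))\<^sup>2) - 2 * (s \<bullet> s)"
    by (simp add: sum_subtractf sum.distrib sum_distrib_left[symmetric] ss)
  finally show ?thesis by simp
qed

lemma pair_weight_hardy:
  fixes u :: "real ^ 'd ^ 'n \<Rightarrow> complex"
  assumes u: "u \<in> L2" and g: "\<And>i k. g i k \<in> L2" "\<And>i k. has_weak_partial u (axis i (axis k 1)) (g i k)"
    and \<epsilon>: "\<epsilon> > 0" and d: "real CARD('d) \<ge> 2"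
  shows "(real CARD('d) - 2)\<^sup>2 * (LINT x|lborel. pair_weight \<epsilon> x * (cmod (u x))\<^sup>2)
    \<le> 2 * real CARD('n) * (\<Sum>i\<in>UNIV. \<Sum>k\<in>UNIV. LINT x|lborel. (cmod (g i k x))\<^sup>2)"
proof -
  have int: "integrable lborel (\<lambda>x. 1 / reg_dist2 \<epsilon> x i j * (cmod (u x))\<^sup>2)" for i j
    by (intro bounded_borel_L2_integrable[OF u] bounded_borel_inverse_reg_dist2 \<epsilon>)
  have gd: "integrable lborel (\<lambda>x. (cmod (g i k x - g j k x))\<^sup>2)" for i j k
    using L2_diff[OF g(1) g(1), of i k j k] by (simp add: L2_def)
  have gi: "integrable lborel (\<lambda>x. (cmod (g i k x))\<^sup>2)" for i k
    using g(1)[of i k] by (simp add: L2_def)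
  have "(real CARD('d) - 2)\<^sup>2 * (LINT x|lborel. pair_weight \<epsilon> x * (cmod (u x))\<^sup>2)
      = (\<Sum>i\<in>UNIV. \<Sum>j\<in>-{i}. (real CARD('d) - 2)\<^sup>2 * (LINT x|lborel. 1 / reg_dist2 \<epsilon> x i j * (cmod (u x))\<^sup>2))"
    unfolding pair_weight_def sum_distrib_right using int by (simp add: sum_distrib_left)
  also have "\<dots> \<le> (\<Sum>i\<in>UNIV. \<Sum>j\<in>-{i}. \<Sum>k\<in>UNIV. LINT x|lborel. (cmod (g i k x - g j k x))\<^sup>2)"
    by (intro sum_mono pair_hardy[OF u g \<epsilon> _ d]) auto
  also have "\<dots> \<le> (\<Sum>i\<in>UNIV. \<Sum>j\<in>UNIV. \<Sum>k\<in>UNIV. LINT x|lborel. (cmod (g i k x - g j k x))\<^sup>2)"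
    by (intro sum_mono sum_mono2 sum_nonneg Bochner_Integration.integral_nonneg) auto
  also have "\<dots> = (\<Sum>k\<in>UNIV. \<Sum>i\<in>UNIV. \<Sum>j\<in>UNIV. LINT x|lborel. (cmod (g i k x - g j k x))\<^sup>2)"
  proof -
    have swap: "(\<Sum>i\<in>UNIV. \<Sum>j\<in>UNIV. \<Sum>k\<in>UNIV. f i j k) = (\<Sum>k\<in>UNIV. \<Sum>i\<in>UNIV. \<Sum>j\<in>UNIV. f i j k)"
      for f :: "'n \<Rightarrow> 'n \<Rightarrow> 'd \<Rightarrow> real"
    proof -
      have "(\<Sum>i\<in>UNIV. \<Sum>j\<in>UNIV. \<Sum>k\<in>UNIV. f i j k) = (\<Sum>i\<in>UNIV. \<Sum>k\<in>UNIV. \<Sum>j\<in>UNIV. f i j k)"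
        by (intro sum.cong refl sum.swap)
      also have "\<dots> = (\<Sum>k\<in>UNIV. \<Sum>i\<in>UNIV. \<Sum>j\<in>UNIV. f i j k)" by (rule sum.swap)
      finally show ?thesis .
    qed
    show ?thesis by (rule swap)
  qed
  also have "\<dots> = (\<Sum>k\<in>UNIV. LINT x|lborel. (\<Sum>i\<in>UNIV. \<Sum>j\<in>UNIV. (cmod (g i k x - g j k x))\<^sup>2))"
    using gd by simp
  also have "\<dots> \<le> (\<Sum>k\<in>UNIV. LINT x|lborel. 2 * real CARD('n) * (\<Sum>i\<in>UNIV. (cmod (g i k x))\<^sup>2))"
    using gd gi by (intro sum_mono integral_mono sum_norm_diff_le) auto
  also have "\<dots> = 2 * real CARD('n) * (\<Sum>k\<in>UNIV. \<Sum>i\<in>UNIV. LINT x|lborel. (cmod (g i k x))\<^sup>2)"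
    using gi by (simp add: sum_distrib_left)
  also have "(\<Sum>k\<in>UNIV. \<Sum>i\<in>UNIV. LINT x|lborel. (cmod (g i k x))\<^sup>2) = (\<Sum>i\<in>UNIV. \<Sum>k\<in>UNIV. LINT x|lborel. (cmod (g i k x))\<^sup>2)"
    by (rule sum.swap)
  finally show ?thesis .
qed

text \<open>For \<open>q = sqrt (1 + m\<^sup>2 \<beta>)\<close> the best choice of the parameter is \<open>\<alpha> = m / (1 + q)\<close>. The factor 2 on the
  right-hand side is there because \<open>A\<close> will be a sum over ordered pairs.\<close>
lemma optimal_coupling:
  fixes A B T m \<beta> \<gamma> :: real
  assumes hardy: "\<And>\<alpha>. \<alpha> \<ge> 0 \<Longrightarrow> (\<alpha> * m - \<alpha>\<^sup>2) * A - (3/2) * \<alpha>\<^sup>2 * B \<le> T"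
    and B: "(3/2) * B \<le> \<beta> * T" and "m > 0" "\<beta> \<ge> 0"
  shows "m\<^sup>2 / (1 + sqrt (1 + m\<^sup>2 * \<beta>)) * A \<le> 2 * T"
proof -
  define q where "q = sqrt (1 + m\<^sup>2 * \<beta>)"
  have q2: "q\<^sup>2 = 1 + m\<^sup>2 * \<beta>" and q1: "q \<ge> 1" using assms by (auto simp: q_def)
  define \<alpha> where "\<alpha> = m / (1 + q)"
  have "\<alpha> \<ge> 0" using q1 \<open>m > 0\<close> by (simp add: \<alpha>_def)
  have "(\<alpha> * m - \<alpha>\<^sup>2) * A \<le> T + \<alpha>\<^sup>2 * ((3/2) * B)"
    using hardy[OF \<open>\<alpha> \<ge> 0\<close>] by (simp add: algebra_simps)
  also have "\<dots> \<le> T + \<alpha>\<^sup>2 * (\<beta> * T)" by (intro add_left_mono mult_left_mono B) simp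
  finally have *: "(\<alpha> * m - \<alpha>\<^sup>2) * A \<le> (1 + \<alpha>\<^sup>2 * \<beta>) * T" by (simp add: algebra_simps)
  have "\<alpha> * m - \<alpha>\<^sup>2 = q / (1 + q) * (m\<^sup>2 / (1 + q))"
  proof -
    have "q / (1 + q) = 1 - 1 / (1 + q)" using q1 by (simp add: field_simps)
    then show ?thesis by (simp only: left_diff_distrib) (simp add: \<alpha>_def power2_eq_square)
  qed
  moreover have "1 + \<alpha>\<^sup>2 * \<beta> = q / (1 + q) * 2"
  proof -
    have "\<alpha>\<^sup>2 * \<beta> = (q\<^sup>2 - 1) / (1 + q)\<^sup>2" using q2 by (simp add: \<alpha>_def power_divide)
    also have "q\<^sup>2 - 1 = (q - 1) * (1 + q)" by (simp add: power2_eq_square algebra_simps)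
    also have "(q - 1) * (1 + q) / (1 + q)\<^sup>2 = (q - 1) / (1 + q)"
      using q1 by (simp add: power2_eq_square)
    finally show ?thesis using q1 by (simp add: field_simps)
  qed
  ultimately have "q / (1 + q) * (m\<^sup>2 / (1 + q) * A) \<le> q / (1 + q) * (2 * T)"
    using * by (simp add: mult.assoc)
  moreover have "q / (1 + q) > 0" using q1 by simp
  ultimately have "m\<^sup>2 / (1 + q) * A \<le> 2 * T" by (simp only: mult_le_cancel_left_pos)
  then show ?thesis by (simp add: q_def)
qed

section \<open>The limit of vanishing regularisation and the Hardy constant\<close>

lemma pair_weight_less:
  fixes x :: "real ^ 'd ^ 'n::{finite,linorder}"
  shows "pair_weight \<epsilon> x = 2 * (\<Sum>(i, j)\<in>{(i, j). i < j}. 1 / reg_dist2 \<epsilon> x i j)"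
proof -
  let ?f = "\<lambda>(i, j). 1 / reg_dist2 \<epsilon> x i j"
  have "pair_weight \<epsilon> x = (\<Sum>p\<in>{(i, j). i \<noteq> j}. ?f p)"
    unfolding pair_weight_def by (simp add: sum.Sigma) (intro sum.cong, auto)
  also have "{(i, j). i \<noteq> (j::'n)} = {(i, j). i < j} \<union> {(i, j). j < i}" by auto
  also have "(\<Sum>p\<in>{(i, j). i < j} \<union> {(i, j). j < i}. ?f p) = (\<Sum>p\<in>{(i, j). i < j}. ?f p) + (\<Sum>p\<in>{(i, j). j < (i::'n)}. ?f p)"
    by (intro sum.union_disjoint) auto
  also have "(\<Sum>p\<in>{(i, j). j < (i::'n)}. ?f p) = (\<Sum>p\<in>{(i, j). i < j}. ?f p)"
    by (rule sum.reindex_bij_witness[where i="\<lambda>(i, j). (j, i)" and j="\<lambda>(i, j). (j, i)"])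
       (auto simp: reg_dist2_commute)
  finally show ?thesis by simp
qed

lemma borel_measurable_particle_dist [measurable]:
  "(\<lambda>x::real^'d^'n. dist (x $ i) (x $ j)) \<in> borel_measurable borel"
  by (intro borel_measurable_continuous_onI continuous_intros)

text \<open>Fatou's lemma removes the regularisation. Terms with \<open>x\<^sub>i = x\<^sub>j\<close> are dropped before passing to the
  pointwise limit, which agrees with the value zero of division by zero in the denominator.\<close>
lemma hardy_denominator_le:
  fixes u :: "real ^ 'd ^ 'n::{finite,linorder} \<Rightarrow> complex"
  assumes u: "u \<in> L2"
    and le: "\<And>\<epsilon>. \<epsilon> > 0 \<Longrightarrow> (LINT x|lborel. pair_weight \<epsilon> x * (cmod (u x))\<^sup>2) \<le> 2 * M"
  shows "hardy_denominator u \<le> ennreal M"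
proof -
  have [measurable]: "u \<in> borel_measurable borel" using u by (simp add: L2_def)
  define E where "E = {(i, j). i < (j::'n)}"
  define \<epsilon> where "\<epsilon> n = 1 / real (Suc n)" for n
  have \<epsilon>: "\<epsilon> n > 0" for n by (simp add: \<epsilon>_def)
  define q where "q n x = (\<Sum>(i, j)\<in>E. (cmod (u x))\<^sup>2 / reg_dist2 (\<epsilon> n) x i j)" for n x
  have q: "q n x = (1/2) * (pair_weight (\<epsilon> n) x * (cmod (u x))\<^sup>2)" for n x
    unfolding q_def pair_weight_less E_def by (simp add: sum_distrib_right case_prod_unfold)
  have iq: "integrable lborel (q n)" for n
    unfolding q[abs_def] using bounded_borel_L2_integrable[OF u bounded_borel_pair_weight[OF \<epsilon>]] by simp
  have q0: "q n x \<ge> 0" for n x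
    unfolding q_def using reg_dist2_pos[OF \<epsilon>] by (intro sum_nonneg) (auto intro!: divide_nonneg_pos)
  have "hardy_denominator u = (\<integral>\<^sup>+x. (\<Sum>(i, j)\<in>E. ennreal ((cmod (u x))\<^sup>2 / (dist (x $ i) (x $ j))\<^sup>2)) \<partial>lborel)"
    unfolding hardy_denominator_def E_def case_prod_unfold by (subst nn_integral_sum) auto
  also have "\<dots> \<le> (\<integral>\<^sup>+x. liminf (\<lambda>n. ennreal (q n x)) \<partial>lborel)"
  proof (intro nn_integral_mono)
    fix x :: "real ^ 'd ^ 'n::{finite,linorder}"
    define p where "p n = (\<Sum>(i, j)\<in>E. if x $ i = x $ j then 0 else (cmod (u x))\<^sup>2 / reg_dist2 (\<epsilon> n) x i j)" for n
    have "p \<longlonglongrightarrow> (\<Sum>(i, j)\<in>E. (cmod (u x))\<^sup>2 / (dist (x $ i) (x $ j))\<^sup>2)"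
      unfolding p_def
    proof (intro tendsto_sum, clarify)
      fix i j
      show "(\<lambda>n. if x $ i = x $ j then 0 else (cmod (u x))\<^sup>2 / reg_dist2 (\<epsilon> n) x i j)
         \<longlonglongrightarrow> (cmod (u x))\<^sup>2 / (dist (x $ i) (x $ j))\<^sup>2"
      proof (cases "x $ i = x $ j")
        case False
        have "(\<lambda>n. reg_dist2 (\<epsilon> n) x i j) \<longlonglongrightarrow> (x $ i - x $ j) \<bullet> (x $ i - x $ j) + 0"
          unfolding reg_dist2_def \<epsilon>_def by (intro tendsto_intros LIMSEQ_Suc[OF lim_inverse_n'])
        then have "(\<lambda>n. reg_dist2 (\<epsilon> n) x i j) \<longlonglongrightarrow> (dist (x $ i) (x $ j))\<^sup>2"
          by (simp add: dist_norm power2_norm_eq_inner)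
        then have "(\<lambda>n. (cmod (u x))\<^sup>2 / reg_dist2 (\<epsilon> n) x i j) \<longlonglongrightarrow> (cmod (u x))\<^sup>2 / (dist (x $ i) (x $ j))\<^sup>2"
          using False by (intro tendsto_divide tendsto_const) auto
        then show ?thesis using False by simp
      qed simp
    qed
    then have lim: "(\<lambda>n. ennreal (p n)) \<longlonglongrightarrow> ennreal (\<Sum>(i, j)\<in>E. (cmod (u x))\<^sup>2 / (dist (x $ i) (x $ j))\<^sup>2)"
      by (rule tendsto_ennrealI)
    have "p n \<le> q n x" for n
      unfolding p_def q_def using reg_dist2_pos[OF \<epsilon>[of n], of x]
      by (intro sum_mono) (auto simp: less_imp_le)
    then have "liminf (\<lambda>n. ennreal (p n)) \<le> liminf (\<lambda>n. ennreal (q n x))"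
      by (intro Liminf_mono always_eventually allI ennreal_leI)
    moreover have "liminf (\<lambda>n. ennreal (p n)) = ennreal (\<Sum>(i, j)\<in>E. (cmod (u x))\<^sup>2 / (dist (x $ i) (x $ j))\<^sup>2)"
      using lim by (intro lim_imp_Liminf) auto
    moreover have "(\<Sum>(i, j)\<in>E. ennreal ((cmod (u x))\<^sup>2 / (dist (x $ i) (x $ j))\<^sup>2)) =
        ennreal (\<Sum>(i, j)\<in>E. (cmod (u x))\<^sup>2 / (dist (x $ i) (x $ j))\<^sup>2)"
      unfolding case_prod_unfold by (rule sum_ennreal) simp
    ultimately show "(\<Sum>(i, j)\<in>E. ennreal ((cmod (u x))\<^sup>2 / (dist (x $ i) (x $ j))\<^sup>2)) \<le> liminf (\<lambda>n. ennreal (q n x))"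
      by simp
  qed
  also have "\<dots> \<le> liminf (\<lambda>n. \<integral>\<^sup>+x. ennreal (q n x) \<partial>lborel)"
    using iq by (intro nn_integral_liminf) auto
  also have "\<dots> \<le> liminf (\<lambda>n. ennreal M)"
  proof (intro Liminf_mono always_eventually allI)
    fix n
    have "(\<integral>\<^sup>+x. ennreal (q n x) \<partial>lborel) = ennreal (LINT x|lborel. q n x)"
      using iq q0 by (intro nn_integral_eq_integral) auto
    also have "(LINT x|lborel. q n x) = (1/2) * (LINT x|lborel. pair_weight (\<epsilon> n) x * (cmod (u x))\<^sup>2)"
      unfolding q by (rule integral_mult_right_zero)
    also have "\<dots> \<le> M" using le[OF \<epsilon>[of n]] by simp
    finally show "(\<integral>\<^sup>+x. ennreal (q n x) \<partial>lborel) \<le> ennreal M" by (simp add: ennreal_leI)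
  qed
  also have "\<dots> = ennreal M" by (simp add: Liminf_const)
  finally show ?thesis .
qed

text \<open>This is needed since \<open>0 / 0 = 0\<close> in the extended nonnegative reals. It holds because two particles
  coincide only on a null set.\<close>
lemma hardy_denominator_nonzero:
  fixes u :: "real ^ 'd ^ 'n::{finite,linorder} \<Rightarrow> complex"
  assumes u: "u \<in> L2" and nz: "\<not> (AE x in lborel. u x = 0)" and N: "CARD('n) \<ge> 2"
  shows "hardy_denominator u \<noteq> 0"
proof
  assume 0: "hardy_denominator u = 0"
  have [measurable]: "u \<in> borel_measurable borel" using u by (simp add: L2_def)
  obtain i j :: 'n where "i \<noteq> j"
    using N card_2_iff'[of "UNIV :: 'n set"] ex_card[OF N] by (metis UNIV_I card_2_iff)
  then obtain i j :: 'n where ij: "i < j" by (metis neq_iff)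
  have "(\<integral>\<^sup>+ x. ennreal ((cmod (u x))\<^sup>2 / (dist (x $ i) (x $ j))\<^sup>2) \<partial>lborel) = 0"
    using 0 ij unfolding hardy_denominator_def by (subst (asm) sum_eq_0_iff) auto
  then have ae: "AE x in lborel. ennreal ((cmod (u x))\<^sup>2 / (dist (x $ i) (x $ j))\<^sup>2) = 0"
    by (subst (asm) nn_integral_0_iff_AE) auto
  fix k :: 'd
  define a where "a = (axis i (axis k 1) - axis j (axis k 1) :: real ^ 'd ^ 'n::{finite,linorder})"
  have ax: "a \<bullet> x = x $ i $ k - x $ j $ k" for x
    by (simp add: a_def inner_diff_left inner_axis' inner_axis)
  have "a \<noteq> 0"
  proof
    assume "a = 0"
    then have "a $ i $ k = 0" by simp
    moreover have "i \<noteq> j" using ij by simp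
    ultimately show False by (simp add: a_def axis_def)
  qed
  then have "negligible {x. a \<bullet> x = 0}" by (intro negligible_hyperplane) simp
  then have "AE x in lebesgue. \<not> a \<bullet> x = 0"
    by (subst AE_iff_null) (auto simp: negligible_iff_null_sets)
  then have "AE x in lborel. \<not> a \<bullet> x = 0"
    by (simp add: AE_completion_iff)
  with ae have "AE x in lborel. u x = 0"
  proof eventually_elim
    case (elim x)
    then have "x $ i \<noteq> x $ j" by (auto simp: ax)
    then have "0 < (dist (x $ i) (x $ j))\<^sup>2" by simp
    then show ?case using elim(1) by (simp add: ennreal_eq_0_iff divide_le_0_iff)
  qed
  with nz show False by simp
qed

theorem theorem2p1:
  fixes d N :: nat
  assumes "d = CARD('d::finite)" and "N = CARD('n::{finite,linorder})"
    and "d \<ge> 3" and "N \<ge> 2"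
  shows "hardy_const TYPE('d) TYPE('n) \<ge>
    ennreal ((real d - 2)\<^sup>2 *
      max (1 / real N)
          (1 / (1 + sqrt (1 + 3 * (real d - 2)\<^sup>2 / (2 * (real d - 1)\<^sup>2) *
                              (real N - 1) * (real N - 2)))))"
  unfolding hardy_const_def
proof (rule INF_greatest)
  fix u :: "real ^ 'd ^ 'n::{finite,linorder} \<Rightarrow> complex"
  assume "u \<in> {u \<in> H1. \<not> (AE x in lborel. u x = 0)}"
  then have u: "u \<in> L2" and nz: "\<not> (AE x in lborel. u x = 0)"
    and H1: "\<And>b. b \<in> Basis \<Longrightarrow> \<exists>g\<in>L2. has_weak_partial u b g" by (auto simp: H1_def)
  have wp: "weak_partial u b \<in> L2 \<and> has_weak_partial u b (weak_partial u b)" if "b \<in> Basis" for b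
  proof -
    have "\<exists>g. g \<in> L2 \<and> has_weak_partial u b g" using H1[OF that] by blast
    then show ?thesis unfolding weak_partial_def by (rule someI_ex)
  qed
  define g where "g i k = weak_partial u (axis i (axis k 1))" for i k
  have ax: "axis i (axis k 1) \<in> (Basis :: (real ^ 'd ^ 'n::{finite,linorder}) set)" for i k by (simp add: axis_in_Basis_iff)
  have g: "g i k \<in> L2" "has_weak_partial u (axis i (axis k 1)) (g i k)" for i k
    using wp[OF ax] by (simp_all add: g_def)
  define T where "T = (\<Sum>i\<in>UNIV. \<Sum>k\<in>UNIV. LINT x|lborel. (cmod (g i k x))\<^sup>2)"
  have T: "(\<integral>\<^sup>+ x. ennreal (weak_grad_sq u x) \<partial>lborel) = ennreal T"
  proof -
    have gi: "integrable lborel (\<lambda>x. (cmod (g i k x))\<^sup>2)" for i k using g(1)[of i k] by (simp add: L2_def)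
    have "weak_grad_sq u x = (\<Sum>i\<in>UNIV. \<Sum>k\<in>UNIV. (cmod (g i k x))\<^sup>2)" for x
    proof -
      have B: "(Basis :: (real ^ 'd ^ 'n::{finite,linorder}) set) = (\<lambda>(i, k). axis i (axis k 1)) ` UNIV"
        by (auto simp: Basis_vec_def)
      have inj: "inj (\<lambda>(i, k). axis i (axis k 1) :: real ^ 'd ^ 'n::{finite,linorder})"
        by (auto simp: inj_on_def axis_eq_axis)
      show ?thesis
        unfolding weak_grad_sq_def B sum.reindex[OF inj]
        unfolding UNIV_Times_UNIV[symmetric] sum.cartesian_product
        by (simp add: case_prod_unfold g_def)
    qed
    then have "(\<integral>\<^sup>+ x. ennreal (weak_grad_sq u x) \<partial>lborel) = ennreal (LINT x|lborel. (\<Sum>i\<in>UNIV. \<Sum>k\<in>UNIV. (cmod (g i k x))\<^sup>2))"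
      using gi by (simp add: nn_integral_eq_integral sum_nonneg)
    also have "(LINT x|lborel. (\<Sum>i\<in>UNIV. \<Sum>k\<in>UNIV. (cmod (g i k x))\<^sup>2)) = T"
      using gi by (simp add: T_def)
    finally show ?thesis .
  qed
  define m \<beta> c where "m = real d - 2" and "\<beta> = 3 * (real N - 1) * (real N - 2) / (2 * (real d - 1)\<^sup>2)"
    and "c = m\<^sup>2 * max (1 / real N) (1 / (1 + sqrt (1 + m\<^sup>2 * \<beta>)))"
  have m: "m > 0" and d: "real CARD('d) \<ge> 2" "real CARD('d) \<ge> 1" and N: "CARD('n) \<ge> 2"
    using assms by (auto simp: m_def)
  have \<beta>: "\<beta> \<ge> 0" using assms by (simp add: \<beta>_def)
  have c: "c > 0" using m assms(4) by (simp add: c_def zero_less_mult_iff less_max_iff_disj)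
  have "hardy_denominator u \<le> ennreal (T / c)"
  proof (rule hardy_denominator_le[OF u])
    fix \<epsilon> :: real assume \<epsilon>: "\<epsilon> > 0"
    define A B where "A = (LINT x|lborel. pair_weight \<epsilon> x * (cmod (u x))\<^sup>2)"
      and "B = (LINT x|lborel. triple_weight \<epsilon> x * (cmod (u x))\<^sup>2)"
    have "m\<^sup>2 * A \<le> 2 * real N * T"
      using pair_weight_hardy[OF u g \<epsilon> d(1)] assms(1,2) by (simp add: m_def A_def T_def)
    then have 1: "m\<^sup>2 * (1 / real N) * A \<le> 2 * T" using assms by (simp add: field_simps)
    have "(real d - 1)\<^sup>2 * B \<le> (real N - 1) * (real N - 2) * T"
      using triple_weight_hardy[OF u g \<epsilon> d(2) N] assms(1,2) by (simp add: B_def T_def)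
    then have B: "(3/2) * B \<le> \<beta> * T" using assms by (simp add: \<beta>_def field_simps)
    have "m\<^sup>2 / (1 + sqrt (1 + m\<^sup>2 * \<beta>)) * A \<le> 2 * T"
    proof (rule optimal_coupling[OF _ B m \<beta>])
      fix \<alpha> :: real assume "\<alpha> \<ge> 0"
      from all_pairs_hardy[OF u g \<epsilon> this]
      show "(\<alpha> * m - \<alpha>\<^sup>2) * A - (3/2) * \<alpha>\<^sup>2 * B \<le> T"
        using assms(1) by (simp add: m_def A_def B_def T_def)
    qed
    with 1 have "c * A \<le> 2 * T" by (auto simp: c_def max_def)
    then show "A \<le> 2 * (T / c)" using c by (simp add: field_simps)
  qed
  then have "ennreal c * hardy_denominator u \<le> ennreal c * ennreal (T / c)" by (intro mult_left_mono) auto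
  also have "\<dots> = ennreal T" using c by (simp add: ennreal_mult'[symmetric])
  finally have "ennreal c * hardy_denominator u \<le> ennreal T" .
  then have "ennreal c * hardy_denominator u / hardy_denominator u \<le> ennreal T / hardy_denominator u"
    by (rule divide_right_mono_ennreal)
  moreover have "ennreal c * hardy_denominator u / hardy_denominator u = ennreal c"
  proof (rule ennreal_mult_divide_eq)
    show "hardy_denominator u \<noteq> 0" by (rule hardy_denominator_nonzero[OF u nz N])
    show "hardy_denominator u \<noteq> top" using \<open>hardy_denominator u \<le> ennreal (T / c)\<close> ennreal_less_top
      by (auto simp: top_unique)
  qed
  moreover have "(real d - 2)\<^sup>2 * max (1 / real N) (1 / (1 + sqrt (1 + 3 * (real d - 2)\<^sup>2 / (2 * (real d - 1)\<^sup>2) *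
                              (real N - 1) * (real N - 2)))) = c"
  proof -
    have "3 * (real d - 2)\<^sup>2 / (2 * (real d - 1)\<^sup>2) * (real N - 1) * (real N - 2) = m\<^sup>2 * \<beta>"
      by (simp add: m_def \<beta>_def mult_ac)
    then show ?thesis by (simp only: c_def m_def)
  qed
  ultimately show "ennreal ((real d - 2)\<^sup>2 * max (1 / real N) (1 / (1 + sqrt (1 + 3 * (real d - 2)\<^sup>2 / (2 * (real d - 1)\<^sup>2) *
                              (real N - 1) * (real N - 2)))))
     \<le> (\<integral>\<^sup>+ x. ennreal (weak_grad_sq u x) \<partial>lborel) / hardy_denominator u"
    unfolding T by simp
qed

end
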